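(* For every integer $n\ge1$ there is a constant $C_n>0$, independent of $t$ and of the initial data, such that the following holds. Let $u_0=0$ and $u_1\in L^2(\mathbf{R}^n)\cap L^{1,1}(\mathbf{R}^n)$, and let $u$ be the unique solution of $$u_{tt}+Lu+Lu_t=0\ \text{ in }(0,\infty)\times\mathbf{R}^n,\qquad u(0,x)=u_0(x)=0,\quad u_t(0,x)=u_1(x).$$ Put $P_1:=\int_{\mathbf{R}^n}u_1(x)\,dx$ and $I_0:=\|u_1\|_{L^2}+\|(1+|x|)u_1\|_{L^1}$. Then, for all sufficiently large $t$: (i) if $n=1$, then $C_1|P_1|\sqrt t\le\|u(t,\cdot)\|_{L^2}\le C_1^{-1}I_0\sqrt t$; (ii) if $n=2$, then $C_2|P_1|\sqrt{\log t}\le\|u(t,\cdot)\|_{L^2}\le C_2^{-1}I_0\sqrt{\log t}$; (iii) if $n\ge3$, then $C_n|P_1|\,t^{-\frac{n-2}{4}}\le\|u(t,\cdot)\|_{L^2}\le C_n^{-1}I_0\,t^{-\frac{n-2}{4}}$. (The threshold beyond which $t$ is sufficiently large may depend on the data.)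
   Context: The Fourier transform is $\hat f(\xi)=\int_{\mathbf{R}^n}e^{-ix\cdot\xi}f(x)\,dx$, and $\mathcal{F}^{-1}_{\xi\to x}$ is its inverse. $L^{1,1}(\mathbf{R}^n)=\{f\in L^1(\mathbf{R}^n):\int_{\mathbf{R}^n}(1+|x|)|f(x)|dx<\infty\}$. The operator $L=\log(I-\Delta)$ is the nonnegative self-adjoint operator on $L^2(\mathbf{R}^n)$ given by $Lf=\mathcal{F}^{-1}_{\xi\to x}(\log(1+|\xi|^2)\hat f(\xi))$ with domain $D(L)=\{f\in L^2(\mathbf{R}^n):\int_{\mathbf{R}^n}(\log(1+|\xi|^2))^2|\hat f|^2d\xi<\infty\}$; $L^{1/2}$ is the multiplier with symbol $\sqrt{\log(1+|\xi|^2)}$, with domain $D(L^{1/2})=\{f\in L^2(\mathbf{R}^n):\int_{\mathbf{R}^n}\log(1+|\xi|^2)|\hat f|^2d\xi<\infty\}$. The solution is the unique mild solution $u\in C([0,\infty);D(L^{1/2}))\cap C^1([0,\infty);L^2(\mathbf{R}^n))$; equivalently, for a.e. $\xi$, $\hat u(\cdot,\xi)$ solves $\hat u_{tt}+\log(1+|\xi|^2)\hat u+\log(1+|\xi|^2)\hat u_t=0$ with $\hat u(0,\xi)=\hat u_0(\xi)$, $\hat u_t(0,\xi)=\hat u_1(\xi)$. *)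

theory Defs
  imports "HOL-Analysis.Analysis"
begin

text \<open>
  Elements of Lebesgue spaces are represented by Lebesgue measurable complex-valued functions;
  functions that agree almost everywhere are different representatives of the same element.
\<close>

definition L2_space :: "('a::euclidean_space \<Rightarrow> complex) set" where
  "L2_space = {f. f \<in> borel_measurable lebesgue \<and> integrable lebesgue (\<lambda>x. (norm (f x))\<^sup>2)}"

definition L2_norm :: "('a::euclidean_space \<Rightarrow> complex) \<Rightarrow> real" where
  "L2_norm f = sqrt (\<integral>x. (norm (f x))\<^sup>2 \<partial>lebesgue)"

definition L11_space :: "('a::euclidean_space \<Rightarrow> complex) set" where
  "L11_space = {f. integrable lebesgue f \<and> integrable lebesgue (\<lambda>x. (1 + norm x) * norm (f x))}"

text \<open>
  Convergence in $L^2$. The nonnegative integral takes the value infinity on differences that are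
  not square integrable, whereas the Bochner integral would take the value 0.
\<close>

definition L2_tendsto ::
    "('i \<Rightarrow> 'a::euclidean_space \<Rightarrow> complex) \<Rightarrow> ('a \<Rightarrow> complex) \<Rightarrow> 'i filter \<Rightarrow> bool" where
  "L2_tendsto f g F \<longleftrightarrow>
     ((\<lambda>i. \<integral>\<^sup>+x. ennreal ((norm (f i x - g x))\<^sup>2) \<partial>lebesgue) \<longlongrightarrow> 0) F"

definition L2_continuous_on :: "real set \<Rightarrow> (real \<Rightarrow> 'a::euclidean_space \<Rightarrow> complex) \<Rightarrow> bool" where
  "L2_continuous_on I u \<longleftrightarrow>
     (\<forall>t\<in>I. u t \<in> L2_space) \<and> (\<forall>t\<in>I. L2_tendsto u (u t) (at t within I))"

definition L2_has_derivative_on ::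
    "real set \<Rightarrow> (real \<Rightarrow> 'a::euclidean_space \<Rightarrow> complex) \<Rightarrow> (real \<Rightarrow> 'a \<Rightarrow> complex) \<Rightarrow> bool" where
  "L2_has_derivative_on I u v \<longleftrightarrow>
     (\<forall>t\<in>I. L2_tendsto (\<lambda>s x. (u s x - u t x) / of_real (s - t)) (v t) (at t within I))"

text \<open>
  \<open>L2_fourier f g\<close>: the function g is a version of the Fourier transform (without normalising
  factor) of the $L^2$ function f, i.e. the $L^2$ limit of the Fourier integrals of the truncations
  of f to balls. The truncations are integrable, and for integrable f the limit is almost
  everywhere the usual Fourier integral. The transform is determined almost everywhere only, hence
  a relation.
\<close>

definition L2_fourier :: "('a::euclidean_space \<Rightarrow> complex) \<Rightarrow> ('a \<Rightarrow> complex) \<Rightarrow> bool" where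
  "L2_fourier f g \<longleftrightarrow> f \<in> L2_space \<and> g \<in> L2_space \<and>
     L2_tendsto
       (\<lambda>R \<xi>. set_lebesgue_integral lebesgue (cball 0 R) (\<lambda>x. exp (- \<i> * of_real (x \<bullet> \<xi>)) * f x))
       g (at_top :: real filter)"

definition logL_symbol :: "'a::euclidean_space \<Rightarrow> real" where
  "logL_symbol \<xi> = ln (1 + (norm \<xi>)\<^sup>2)"

definition dom_sqrtL :: "('a::euclidean_space \<Rightarrow> complex) set" where
  "dom_sqrtL = {f. \<exists>g. L2_fourier f g \<and> integrable lebesgue (\<lambda>\<xi>. logL_symbol \<xi> * (norm (g \<xi>))\<^sup>2)}"

text \<open>\<open>sqrtL f h\<close>: the function h is a version of $L^{1/2} f$.\<close>

definition sqrtL :: "('a::euclidean_space \<Rightarrow> complex) \<Rightarrow> ('a \<Rightarrow> complex) \<Rightarrow> bool" where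
  "sqrtL f h \<longleftrightarrow> f \<in> dom_sqrtL \<and>
     (\<exists>g k. L2_fourier f g \<and> L2_fourier h k \<and>
        (AE \<xi> in lebesgue. k \<xi> = of_real (sqrt (logL_symbol \<xi>)) * g \<xi>))"

text \<open>
  The class $C([0,\infty); D(L^{1/2})) \cap C^1([0,\infty); L^2)$, where v is the time derivative
  of u. Continuity for the graph norm of $L^{1/2}$ is continuity in $L^2$ of both u and
  $L^{1/2} u$.
\<close>

definition solution_class ::
    "(real \<Rightarrow> 'a::euclidean_space \<Rightarrow> complex) \<Rightarrow> (real \<Rightarrow> 'a \<Rightarrow> complex) \<Rightarrow> bool" where
  "solution_class u v \<longleftrightarrow>
     L2_continuous_on {0..} u \<and>
     (\<exists>w. (\<forall>t\<ge>0. sqrtL (u t) (w t)) \<and> L2_continuous_on {0..} w) \<and>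
     L2_has_derivative_on {0..} u v \<and> L2_continuous_on {0..} v"

text \<open>
  \<open>mild_solution u0 u1 u\<close>: u belongs to the above class, has initial data u0 and u1, and suitable
  versions of the Fourier transforms of the functions \<open>u t\<close> solve, for almost every frequency, the
  transformed equation in t (with one-sided derivatives at 0). In the last clause z is the time
  derivative of the transform at the frequency \<open>\<xi>\<close>.
\<close>

definition mild_solution ::
    "('a::euclidean_space \<Rightarrow> complex) \<Rightarrow> ('a \<Rightarrow> complex) \<Rightarrow> (real \<Rightarrow> 'a \<Rightarrow> complex) \<Rightarrow> bool" where
  "mild_solution u0 u1 u \<longleftrightarrow>
     (\<exists>v. solution_class u v \<and>
        (AE x in lebesgue. u 0 x = u0 x) \<and> (AE x in lebesgue. v 0 x = u1 x)) \<and>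
     (\<exists>uh u0h u1h. (\<forall>t\<ge>0. L2_fourier (u t) (uh t)) \<and> L2_fourier u0 u0h \<and> L2_fourier u1 u1h \<and>
        (AE \<xi> in lebesgue. \<exists>z. uh 0 \<xi> = u0h \<xi> \<and> z 0 = u1h \<xi> \<and>
           (\<forall>t\<ge>0.
              ((\<lambda>s. uh s \<xi>) has_vector_derivative z t) (at t within {0..}) \<and>
              (z has_vector_derivative
                 - of_real (logL_symbol \<xi>) * uh t \<xi> - of_real (logL_symbol \<xi>) * z t)
                (at t within {0..}))))"

definition P1 :: "('a::euclidean_space \<Rightarrow> complex) \<Rightarrow> complex" where
  "P1 u1 = (\<integral>x. u1 x \<partial>lebesgue)"

definition I0 :: "('a::euclidean_space \<Rightarrow> complex) \<Rightarrow> real" where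
  "I0 u1 = L2_norm u1 + (\<integral>x. (1 + norm x) * norm (u1 x) \<partial>lebesgue)"

end

theory Submission
  imports Defs "HOL-Probability.Probability" "HOL-Real_Asymp.Real_Asymp"
begin

text \<open>
  At the frequency \<open>\<xi>\<close> the equation is a damped oscillator with damping and stiffness both equal to
  $a = \log(1 + |\xi|^2)$. For $|\xi| \ge 1$ its solutions decay exponentially, uniformly in \<open>\<xi>\<close>
  (a Lyapunov function shows this without solving the equation). For $|\xi| < 1$ the solution is
  $e^{-at/2}\,\omega^{-1} \sin(\omega t)\,\hat u_1(\xi)$ with $\omega^2 = a - a^2/4$, where
  $a \sim |\xi|^2$ and $\omega \sim |\xi|$. By Plancherel's theorem the norm of the solution is, up to the
  exponentially small part, governed by
  $\int_{|\xi| < \rho} e^{-at}\,\omega^{-2} \sin^2(\omega t)\,d\xi$, since $\hat u_1$ is bounded by the $L^1$ norm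
  of the datum and is close to $P_1$ near the origin. In polar coordinates the relevant region is
  $r \sim 1/t$ for $n = 1$, $1/t \ll r \ll t^{-1/2}$ for $n = 2$ and $r \sim t^{-1/2}$ for $n \ge 3$.
\<close>

section \<open>Gaussian integrals\<close>

text \<open>The Fourier transform enters as the relation \<open>L2_fourier\<close>, a limit of
  truncated integrals determined only almost everywhere. Two bridges make it usable: norms transfer
  with the exact factor (2 pi)^n, and for the integrable datum every version agrees almost
  everywhere with the bounded continuous function \<open>fourier u1\<close>. Boundedness serves the
  upper estimate, continuity at 0 the lower one. The obstacle in the lower estimate is the
  oscillation: for n >= 2 the factor sin^2(\<omega> t) has zeros in the region that matters, so no
  pointwise bound works. With s = \<omega> t as variable, the integrals of sin^2(s)/s and sin^2(s)
  are bounded through explicit primitives; the key fact about this substitution is \<omega>'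
  \<omega> <= r. Damping costs only a factor e^(-1) while r^2 t <= 1. The radii used for the lower
  bound shrink to 0 as t grows. Cutting at a small radius \<rho> therefore affects the time from
  which the bound holds, but not the constant, and \<rho> may depend on the datum while C_n does
  not.\<close>

text \<open>Up to the factor sqrt(2 pi) the integral is the characteristic function of the standard
  normal distribution.\<close>

lemma gaussian_fourier_real:
  fixes t :: real
  shows "integrable lborel (\<lambda>x. exp (\<i> * of_real (t * x)) * of_real (exp (- x\<^sup>2 / 2)) :: complex)"
    and "(\<integral>x. exp (\<i> * of_real (t * x)) * of_real (exp (- x\<^sup>2 / 2)) \<partial>lborel)
      = complex_of_real (sqrt (2 * pi) * exp (- t\<^sup>2 / 2))"
proof -
  have *: "exp (\<i> * of_real (t * x)) * of_real (exp (- x\<^sup>2 / 2)) =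
      complex_of_real (sqrt (2 * pi)) * (std_normal_density x *\<^sub>R exp (\<i> * of_real (t * x)))" for x
    by (simp add: std_normal_density_def scaleR_conv_of_real)
  have 1: "integrable lborel (\<lambda>x. std_normal_density x *\<^sub>R exp (\<i> * of_real (t * x)))"
  proof (rule Bochner_Integration.integrable_bound)
    show "integrable lborel std_normal_density" by simp
  qed (auto simp: norm_exp_eq_Re)
  show "integrable lborel (\<lambda>x. exp (\<i> * of_real (t * x)) * of_real (exp (- x\<^sup>2 / 2)) :: complex)"
    unfolding * by (intro integrable_mult_right 1)
  have "(\<integral>x. std_normal_density x *\<^sub>R exp (\<i> * of_real (t * x)) \<partial>lborel) = char std_normal_distribution t"
    unfolding char_def by (subst integral_density) auto
  also have "\<dots> = complex_of_real (exp (- t\<^sup>2 / 2))"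
    by (simp add: char_std_normal_distribution)
  finally show "(\<integral>x. exp (\<i> * of_real (t * x)) * of_real (exp (- x\<^sup>2 / 2)) \<partial>lborel)
      = complex_of_real (sqrt (2 * pi) * exp (- t\<^sup>2 / 2))"
    unfolding * integral_mult_right_zero by simp
qed

text \<open>\<open>lborel\<close> is the image of a product of real Lebesgue measures, and both the
  character and the Gaussian are products over the coordinates, so the integral factors into
  one-dimensional ones.\<close>

lemma gaussian_fourier:
  fixes z :: "'a::euclidean_space"
  shows "integrable lborel (\<lambda>x. exp (\<i> * of_real (z \<bullet> x)) * of_real (exp (- (norm x)\<^sup>2 / 2)) :: complex)"
    and "(\<integral>x. exp (\<i> * of_real (z \<bullet> x)) * of_real (exp (- (norm x)\<^sup>2 / 2)) \<partial>lborel)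
      = complex_of_real (sqrt (2 * pi) ^ DIM('a) * exp (- (norm z)\<^sup>2 / 2))"
proof -
  interpret product_sigma_finite "\<lambda>b::'a. lborel :: real measure" ..
  define g where "g = (\<lambda>(b::'a) s. exp (\<i> * of_real ((z \<bullet> b) * s)) * of_real (exp (- s\<^sup>2 / 2)) :: complex)"
  have nrm: "(norm w)\<^sup>2 = (\<Sum>b\<in>Basis. (w \<bullet> b)\<^sup>2)" for w :: 'a
    by (subst power2_norm_eq_inner, subst euclidean_inner) (simp add: power2_eq_square)
  have prod: "exp (\<i> * of_real (z \<bullet> (\<Sum>b\<in>Basis. f b *\<^sub>R b))) *
      of_real (exp (- (norm (\<Sum>b\<in>Basis. f b *\<^sub>R b))\<^sup>2 / 2)) = (\<Prod>b\<in>Basis. g b (f b))" for f :: "'a \<Rightarrow> real"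
    unfolding g_def prod.distrib nrm
    by (simp add: inner_sum_right sum_distrib_left mult_ac of_real_sum flip: exp_sum sum_negf sum_divide_distrib of_real_prod)
  have m[measurable]: "(\<lambda>x::'a. exp (\<i> * of_real (z \<bullet> x)) * of_real (exp (- (norm x)\<^sup>2 / 2)) :: complex)
     \<in> borel_measurable borel" by measurable
  have i: "integrable lborel (g b)" for b
    unfolding g_def by (rule gaussian_fourier_real)
  show "integrable lborel (\<lambda>x. exp (\<i> * of_real (z \<bullet> x)) * of_real (exp (- (norm x)\<^sup>2 / 2)) :: complex)"
    by (subst lborel_eq, subst integrable_distr_eq) (auto simp only: prod intro!: product_integrable_prod i m finite_Basis, measurable)
  have "(\<integral>x. exp (\<i> * of_real (z \<bullet> x)) * of_real (exp (- (norm x)\<^sup>2 / 2)) \<partial>lborel) = (\<Prod>b\<in>Basis. integral\<^sup>L lborel (g b))"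
    by (subst lborel_eq, subst integral_distr) (auto simp only: prod intro!: product_integral_prod i m finite_Basis, measurable)
  also have "\<dots> = (\<Prod>b\<in>Basis. complex_of_real (sqrt (2 * pi) * exp (- (z \<bullet> b)\<^sup>2 / 2)))"
    unfolding g_def gaussian_fourier_real(2) ..
  also have "\<dots> = complex_of_real (sqrt (2 * pi) ^ DIM('a) * exp (- (norm z)\<^sup>2 / 2))"
    by (simp add: prod.distrib nrm sum_negf sum_divide_distrib flip: exp_sum of_real_prod)
  finally show "(\<integral>x. exp (\<i> * of_real (z \<bullet> x)) * of_real (exp (- (norm x)\<^sup>2 / 2)) \<partial>lborel)
      = complex_of_real (sqrt (2 * pi) ^ DIM('a) * exp (- (norm z)\<^sup>2 / 2))" .
qed

lemma lborel_integrable_affine: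
  fixes f :: "'a::euclidean_space \<Rightarrow> 'b::{banach, second_countable_topology}" and c :: real
  assumes "c \<noteq> 0" "integrable lborel f"
  shows "integrable lborel (\<lambda>x. f (t + c *\<^sub>R x))"
proof -
  have [measurable]: "f \<in> borel_measurable borel" using assms by auto
  have "integrable (density (distr lborel borel (\<lambda>x. t + c *\<^sub>R x)) (\<lambda>_. ennreal (\<bar>c\<bar>^DIM('a)))) f"
    using assms by (simp only: lborel_affine[OF assms(1), of t, symmetric])
  then show ?thesis
    using assms integrable_scaleR_right[of "inverse (\<bar>c\<bar> ^ DIM('a))" lborel "\<lambda>x. \<bar>c\<bar> ^ DIM('a) *\<^sub>R f (t + c *\<^sub>R x)"]
    by (auto simp: integrable_density integrable_distr_eq)
qed

lemma lborel_integral_affine: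
  fixes f :: "'a::euclidean_space \<Rightarrow> 'b::{banach, second_countable_topology}" and c :: real
  assumes "c \<noteq> 0" and [measurable]: "f \<in> borel_measurable borel"
  shows "(\<integral>x. f x \<partial>lborel) = \<bar>c\<bar> ^ DIM('a) *\<^sub>R (\<integral>x. f (t + c *\<^sub>R x) \<partial>lborel)"
proof -
  have "(\<integral>x. f x \<partial>lborel) = integral\<^sup>L (density (distr lborel borel (\<lambda>x. t + c *\<^sub>R x)) (\<lambda>_. ennreal (\<bar>c\<bar>^DIM('a)))) f"
    by (simp only: lborel_affine[OF assms(1), of t, symmetric])
  also have "\<dots> = (\<integral>x. \<bar>c\<bar> ^ DIM('a) *\<^sub>R f (t + c *\<^sub>R x) \<partial>lborel)"
    by (subst integral_density) (auto simp: integral_distr)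
  finally show ?thesis by simp
qed

section \<open>The Fourier transform of integrable functions\<close>

text \<open>The pointwise transform, next to the relation \<open>L2_fourier\<close>. For a function
  that is not integrable it is 0 by the convention for the Bochner integral.\<close>

definition fourier :: "('a::euclidean_space \<Rightarrow> complex) \<Rightarrow> 'a \<Rightarrow> complex" where
  "fourier f \<xi> = (\<integral>x. exp (- \<i> * of_real (x \<bullet> \<xi>)) * f x \<partial>lebesgue)"

definition gauss :: "'a::euclidean_space \<Rightarrow> real" where
  "gauss x = exp (- (norm x)\<^sup>2 / 2)"

lemma borel_measurable_gauss [measurable]: "gauss \<in> borel_measurable borel"
  unfolding gauss_def[abs_def] by measurable

lemma borel_measurable_cnj [measurable]: "cnj \<in> borel_measurable borel"
  by (intro borel_measurable_continuous_onI continuous_intros)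

lemma gauss_pos: "gauss x > 0"
  by (simp add: gauss_def)

lemma gauss_minus [simp]: "gauss (- x) = gauss x"
  by (simp add: gauss_def)

lemma norm_exp_ii: "norm (exp (- \<i> * of_real s)) = 1" "norm (exp (\<i> * of_real s)) = 1"
  by (auto simp: norm_exp_eq_Re)

lemma integrable_exp_mult:
  fixes f :: "'a::euclidean_space \<Rightarrow> complex"
  assumes "integrable lebesgue f"
  shows "integrable lebesgue (\<lambda>x. exp (- \<i> * of_real (x \<bullet> \<xi>)) * f x)"
proof (rule Bochner_Integration.integrable_bound[OF assms])
  have [measurable]: "f \<in> borel_measurable lebesgue" using assms by auto
  have [measurable]: "(\<lambda>x::'a. exp (- \<i> * of_real (x \<bullet> \<xi>)) :: complex) \<in> borel_measurable lebesgue"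
    by (intro measurable_completion) measurable
  show "(\<lambda>x. exp (- \<i> * of_real (x \<bullet> \<xi>)) * f x) \<in> borel_measurable lebesgue" by measurable
qed (simp add: norm_mult norm_exp_ii)

lemma norm_fourier_le: "norm (fourier f \<xi>) \<le> (\<integral>x. norm (f x) \<partial>lebesgue)"
  unfolding fourier_def
  by (rule order_trans[OF integral_norm_bound]) (simp add: norm_mult norm_exp_ii)

lemma continuous_on_fourier:
  fixes f :: "'a::euclidean_space \<Rightarrow> complex"
  assumes f: "integrable lebesgue f"
  shows "continuous_on UNIV (fourier f)"
  unfolding continuous_on_sequentially comp_def
proof safe
  fix X :: "nat \<Rightarrow> 'a" and \<xi> assume X: "X \<longlonglongrightarrow> \<xi>"
  show "(\<lambda>n. fourier f (X n)) \<longlonglongrightarrow> fourier f \<xi>"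
    unfolding fourier_def
  proof (rule integral_dominated_convergence)
    show "integrable lebesgue (\<lambda>x. norm (f x))" using f by simp
    show "AE x in lebesgue. (\<lambda>n. exp (- \<i> * of_real (x \<bullet> X n)) * f x) \<longlonglongrightarrow> exp (- \<i> * of_real (x \<bullet> \<xi>)) * f x"
      by (intro AE_I2 tendsto_intros X)
    show "AE x in lebesgue. norm (exp (- \<i> * of_real (x \<bullet> X n)) * f x) \<le> norm (f x)" for n
      by (simp add: norm_mult norm_exp_ii)
  qed (use integrable_exp_mult[OF f] in auto)
qed

lemma borel_measurable_fourier [measurable]:
  "integrable lebesgue f \<Longrightarrow> fourier f \<in> borel_measurable borel"
  by (rule borel_measurable_continuous_onI[OF continuous_on_fourier])

lemma fourier_diff:
  assumes "integrable lebesgue f" "integrable lebesgue g"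
  shows "fourier (\<lambda>x. f x - g x) \<xi> = fourier f \<xi> - fourier g \<xi>"
  unfolding fourier_def right_diff_distrib
  by (intro Bochner_Integration.integral_diff integrable_exp_mult assms)

section \<open>Inversion and Plancherel with Gaussian regularisation\<close>

text \<open>Tonelli reduces joint integrability to a product of two finite integrals. In both uses
  of Fubini below one factor comes from the function, the other from a Gaussian.\<close>

lemma integrable_lborel_pair_bound:
  fixes F :: "'a::euclidean_space \<times> 'b::euclidean_space \<Rightarrow> complex" and f :: "'a \<Rightarrow> real" and g :: "'b \<Rightarrow> real"
  assumes [measurable]: "F \<in> borel_measurable (lborel \<Otimes>\<^sub>M lborel)"
    and f: "integrable lborel f" and g: "integrable lborel g"
    and le: "\<And>x y. norm (F (x, y)) \<le> f x * g y" and f0: "\<And>x. f x \<ge> 0"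
  shows "integrable (lborel \<Otimes>\<^sub>M lborel) F"
proof (rule integrableI_bounded)
  have [measurable]: "f \<in> borel_measurable lborel" "g \<in> borel_measurable lborel" using f g by auto
  have le': "norm (F (x, y)) \<le> f x * norm (g y)" for x y
    using le[of x y] f0[of x] by (smt (verit) mult_left_mono real_norm_def)
  have "(\<integral>\<^sup>+p. ennreal (norm (F p)) \<partial>(lborel \<Otimes>\<^sub>M lborel)) = (\<integral>\<^sup>+x. \<integral>\<^sup>+y. ennreal (norm (F (x, y))) \<partial>lborel \<partial>lborel)"
    by (subst lborel.nn_integral_fst[symmetric]) auto
  also have "\<dots> \<le> (\<integral>\<^sup>+x. \<integral>\<^sup>+y. ennreal (f x) * ennreal (norm (g y)) \<partial>lborel \<partial>lborel)"
    by (intro nn_integral_mono) (simp add: le'[unfolded real_norm_def] f0 flip: ennreal_mult)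
  also have "\<dots> = (\<integral>\<^sup>+x. ennreal (f x) \<partial>lborel) * (\<integral>\<^sup>+y. ennreal (norm (g y)) \<partial>lborel)"
    by (simp add: nn_integral_cmult nn_integral_multc)
  also have "\<dots> < \<infinity>"
    using f g f0 by (auto simp: integrable_iff_bounded ennreal_mult_less_top)
  finally show "(\<integral>\<^sup>+p. ennreal (norm (F p)) \<partial>(lborel \<Otimes>\<^sub>M lborel)) < \<infinity>" .
qed fact

lemma gaussian_fourier_scaled:
  fixes z :: "'a::euclidean_space"
  assumes "e > 0"
  shows "integrable lborel (\<lambda>x::'a. gauss (e *\<^sub>R x))"
    and "(\<integral>x. exp (\<i> * of_real (z \<bullet> x)) * of_real (gauss (e *\<^sub>R x)) \<partial>lborel)
      = complex_of_real (inverse e ^ DIM('a) * sqrt (2 * pi) ^ DIM('a) * gauss (inverse e *\<^sub>R z))"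
proof -
  have "complex_integrable lborel (\<lambda>x::'a. of_real (gauss x))"
    using gaussian_fourier(1)[of "0::'a"] by (simp add: gauss_def)
  then have "integrable lborel (gauss :: 'a \<Rightarrow> real)" by (simp add: complex_of_real_integrable_eq)
  from lborel_integrable_affine[OF _ this, of e 0] assms
  show "integrable lborel (\<lambda>x::'a. gauss (e *\<^sub>R x))" by simp
  have "(\<integral>x. exp (\<i> * of_real (z \<bullet> x)) * of_real (gauss (e *\<^sub>R x)) \<partial>lborel)
     = \<bar>inverse e\<bar> ^ DIM('a) *\<^sub>R (\<integral>x. exp (\<i> * of_real ((inverse e *\<^sub>R z) \<bullet> x)) * of_real (gauss x) \<partial>lborel)"
    using assms by (subst lborel_integral_affine[where c="inverse e" and t=0]) (simp_all)
  also have "(\<integral>x. exp (\<i> * of_real ((inverse e *\<^sub>R z) \<bullet> x)) * of_real (gauss x) \<partial>lborel)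
      = complex_of_real (sqrt (2 * pi) ^ DIM('a) * gauss (inverse e *\<^sub>R z))"
    using gaussian_fourier(2)[of "inverse e *\<^sub>R z"] unfolding gauss_def by simp
  finally show "(\<integral>x. exp (\<i> * of_real (z \<bullet> x)) * of_real (gauss (e *\<^sub>R x)) \<partial>lborel)
      = complex_of_real (inverse e ^ DIM('a) * sqrt (2 * pi) ^ DIM('a) * gauss (inverse e *\<^sub>R z))"
    using assms by (simp add: scaleR_conv_of_real)
qed

lemma integrable_lborel_continuous_supported:
  fixes f :: "'a::euclidean_space \<Rightarrow> complex"
  assumes "continuous_on UNIV f" "\<And>x. x \<notin> cball 0 R \<Longrightarrow> f x = 0"
  shows "integrable lborel f"
proof -
  have "integrable lborel (\<lambda>x. indicator (cball 0 R) x *\<^sub>R f x)"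
    by (rule borel_integrable_compact) (auto intro: continuous_on_subset[OF assms(1)])
  also have "(\<lambda>x. indicator (cball 0 R) x *\<^sub>R f x) = f"
    using assms(2) by (auto simp: indicator_def)
  finally show ?thesis .
qed

lemma fourier_lborel:
  assumes "f \<in> borel_measurable borel"
  shows "fourier f \<xi> = (\<integral>x. exp (- \<i> * of_real (x \<bullet> \<xi>)) * f x \<partial>lborel)"
  unfolding fourier_def using assms by (intro integral_completion) measurable

text \<open>Exchanging the integrals leaves the transform of a Gaussian, which is explicit and
  concentrated at scale \<open>e\<close>. The result is an average of \<open>f\<close> around
  \<open>x\<close>, an approximate identity as \<open>e\<close> tends to 0.\<close>

lemma fourier_gauss_inversion:
  fixes f :: "'a::euclidean_space \<Rightarrow> complex"
  assumes f: "integrable lborel f" and e: "e > 0"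
  shows "(\<integral>\<xi>. exp (\<i> * of_real (x \<bullet> \<xi>)) * (fourier f \<xi> * of_real (gauss (e *\<^sub>R \<xi>))) \<partial>lborel)
    = of_real (sqrt (2 * pi) ^ DIM('a)) * (\<integral>w. f (x - e *\<^sub>R w) * of_real (gauss w) \<partial>lborel)"
proof -
  have [measurable]: "f \<in> borel_measurable borel" using f by auto
  let ?F = "\<lambda>(y, \<xi>). exp (\<i> * of_real ((x - y) \<bullet> \<xi>)) * f y * of_real (gauss (e *\<^sub>R \<xi>))"
  have int: "integrable (lborel \<Otimes>\<^sub>M lborel) ?F"
    by (rule integrable_lborel_pair_bound[where f="\<lambda>y. norm (f y)" and g="\<lambda>\<xi>. gauss (e *\<^sub>R \<xi>)"])
      (use f gaussian_fourier_scaled(1)[OF e] in \<open>auto simp: norm_mult norm_exp_ii abs_of_pos[OF gauss_pos]\<close>)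
  have "(\<integral>\<xi>. exp (\<i> * of_real (x \<bullet> \<xi>)) * (fourier f \<xi> * of_real (gauss (e *\<^sub>R \<xi>))) \<partial>lborel)
    = (\<integral>\<xi>. \<integral>y. exp (\<i> * of_real ((x - y) \<bullet> \<xi>)) * f y * of_real (gauss (e *\<^sub>R \<xi>)) \<partial>lborel \<partial>lborel)"
  proof (rule Bochner_Integration.integral_cong[OF refl])
    fix \<xi>
    have "exp (\<i> * of_real ((x - y) \<bullet> \<xi>)) * f y * of_real (gauss (e *\<^sub>R \<xi>))
      = (exp (\<i> * of_real (x \<bullet> \<xi>)) * of_real (gauss (e *\<^sub>R \<xi>))) * (exp (- \<i> * of_real (y \<bullet> \<xi>)) * f y)" for y
      by (simp add: inner_diff_left right_diff_distrib exp_diff exp_minus field_simps)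
    then show "exp (\<i> * of_real (x \<bullet> \<xi>)) * (fourier f \<xi> * of_real (gauss (e *\<^sub>R \<xi>)))
      = (\<integral>y. exp (\<i> * of_real ((x - y) \<bullet> \<xi>)) * f y * of_real (gauss (e *\<^sub>R \<xi>)) \<partial>lborel)"
      by (simp only: integral_mult_right_zero fourier_lborel[OF \<open>f \<in> borel_measurable borel\<close>]) (simp only: mult_ac)
  qed
  also have "\<dots> = (\<integral>y. \<integral>\<xi>. exp (\<i> * of_real ((x - y) \<bullet> \<xi>)) * f y * of_real (gauss (e *\<^sub>R \<xi>)) \<partial>lborel \<partial>lborel)"
    using lborel_pair.Fubini_integral[OF int] by simp
  also have "\<dots> = (\<integral>y. f y * complex_of_real (inverse e ^ DIM('a) * sqrt (2 * pi) ^ DIM('a) * gauss (inverse e *\<^sub>R (x - y))) \<partial>lborel)"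
  proof (rule Bochner_Integration.integral_cong[OF refl])
    fix y
    have "exp (\<i> * of_real ((x - y) \<bullet> \<xi>)) * f y * of_real (gauss (e *\<^sub>R \<xi>))
      = f y * (exp (\<i> * of_real ((x - y) \<bullet> \<xi>)) * of_real (gauss (e *\<^sub>R \<xi>)))" for \<xi>
      by simp
    then show "(\<integral>\<xi>. exp (\<i> * of_real ((x - y) \<bullet> \<xi>)) * f y * of_real (gauss (e *\<^sub>R \<xi>)) \<partial>lborel)
      = f y * complex_of_real (inverse e ^ DIM('a) * sqrt (2 * pi) ^ DIM('a) * gauss (inverse e *\<^sub>R (x - y)))"
      using gaussian_fourier_scaled(2)[OF e, of "x - y"] by (simp only: integral_mult_right_zero)
  qed
  \<comment> \<open>Substitution y = x - e w: its Jacobian e^n cancels the factor e^(-n) of the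
    transformed Gaussian.\<close>
  also have "\<dots> = of_real (sqrt (2 * pi) ^ DIM('a)) * (\<integral>w. f (x - e *\<^sub>R w) * of_real (gauss w) \<partial>lborel)"
    using e by (subst lborel_integral_affine[where c="-e" and t=x])
      (simp_all add: scaleR_conv_of_real field_simps flip: integral_mult_right_zero)
  finally show ?thesis .
qed

text \<open>
  The Gaussian makes Fubini applicable. Scaling it out, the inner integral tends to a multiple of
  \<open>f x\<close> as \<open>e\<close> tends to 0, which yields Plancherel's theorem for continuous \<open>f\<close>.
\<close>

lemma plancherel_gauss:
  fixes f :: "'a::euclidean_space \<Rightarrow> complex"
  assumes f: "integrable lborel f" and e: "e > 0"
  shows "integrable lborel (\<lambda>\<xi>. (norm (fourier f \<xi>))\<^sup>2 * gauss (e *\<^sub>R \<xi>))"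
    and "complex_of_real (\<integral>\<xi>. (norm (fourier f \<xi>))\<^sup>2 * gauss (e *\<^sub>R \<xi>) \<partial>lborel)
      = of_real (sqrt (2 * pi) ^ DIM('a)) *
        (\<integral>x. cnj (f x) * (\<integral>w. f (x - e *\<^sub>R w) * of_real (gauss w) \<partial>lborel) \<partial>lborel)"
proof -
  have [measurable]: "f \<in> borel_measurable borel" using f by auto
  have fl: "integrable lebesgue f" using f by (simp add: integrable_completion)
  note [measurable] = borel_measurable_fourier[OF fl]
  define N where "N = (\<integral>x. norm (f x) \<partial>lebesgue)"
  have N: "norm (fourier f \<xi>) \<le> N" for \<xi>
    unfolding N_def by (rule norm_fourier_le)
  have g: "integrable lborel (\<lambda>\<xi>::'a. gauss (e *\<^sub>R \<xi>))" by (rule gaussian_fourier_scaled(1)[OF e])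
  show "integrable lborel (\<lambda>\<xi>. (norm (fourier f \<xi>))\<^sup>2 * gauss (e *\<^sub>R \<xi>))"
  proof (rule Bochner_Integration.integrable_bound)
    show "integrable lborel (\<lambda>\<xi>::'a. N\<^sup>2 * gauss (e *\<^sub>R \<xi>))" using g by simp
  qed (auto intro!: mult_mono power_mono N simp: abs_mult abs_of_pos[OF gauss_pos] less_imp_le[OF gauss_pos])
  let ?F = "\<lambda>(x, \<xi>). cnj (f x) * (exp (\<i> * of_real (x \<bullet> \<xi>)) * (fourier f \<xi> * of_real (gauss (e *\<^sub>R \<xi>))))"
  have int: "integrable (lborel \<Otimes>\<^sub>M lborel) ?F"
  proof (rule integrable_lborel_pair_bound[where f="\<lambda>x. norm (f x)" and g="\<lambda>\<xi>. N * gauss (e *\<^sub>R \<xi>)"])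
    show "norm (?F (x, \<xi>)) \<le> norm (f x) * (N * gauss (e *\<^sub>R \<xi>))" for x \<xi>
      by (auto simp: norm_mult norm_exp_ii abs_of_pos[OF gauss_pos] less_imp_le[OF gauss_pos] intro!: mult_left_mono mult_right_mono N)
  qed (use f g in auto)
  have "complex_of_real (\<integral>\<xi>. (norm (fourier f \<xi>))\<^sup>2 * gauss (e *\<^sub>R \<xi>) \<partial>lborel)
    = (\<integral>\<xi>. complex_of_real ((norm (fourier f \<xi>))\<^sup>2 * gauss (e *\<^sub>R \<xi>)) \<partial>lborel)"
    by (rule integral_complex_of_real[symmetric])
  also have "\<dots> = (\<integral>\<xi>. \<integral>x. ?F (x, \<xi>) \<partial>lborel \<partial>lborel)"
  proof (rule Bochner_Integration.integral_cong[OF refl])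
    fix \<xi>
    have "cnj (fourier f \<xi>) = (\<integral>x. cnj (exp (- \<i> * of_real (x \<bullet> \<xi>)) * f x) \<partial>lborel)"
      by (simp only: fourier_lborel[OF \<open>f \<in> borel_measurable borel\<close>] Bochner_Integration.integral_cnj)
    also have "\<dots> = (\<integral>x. cnj (f x) * exp (\<i> * of_real (x \<bullet> \<xi>)) \<partial>lborel)"
      by (simp add: exp_cnj mult.commute)
    finally have c: "cnj (fourier f \<xi>) = \<dots>" .
    have "complex_of_real ((norm (fourier f \<xi>))\<^sup>2 * gauss (e *\<^sub>R \<xi>)) = cnj (fourier f \<xi>) * (fourier f \<xi> * of_real (gauss (e *\<^sub>R \<xi>)))"
      by (simp only: of_real_mult complex_norm_square mult_ac)
    also have "\<dots> = (\<integral>x. ?F (x, \<xi>) \<partial>lborel)"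
      unfolding c by (simp add: mult.assoc flip: integral_mult_left_zero)
    finally show "complex_of_real ((norm (fourier f \<xi>))\<^sup>2 * gauss (e *\<^sub>R \<xi>)) = (\<integral>x. ?F (x, \<xi>) \<partial>lborel)" .
  qed
  also have "\<dots> = (\<integral>x. \<integral>\<xi>. ?F (x, \<xi>) \<partial>lborel \<partial>lborel)"
    using lborel_pair.Fubini_integral[OF int] by simp
  also have "\<dots> = (\<integral>x. cnj (f x) * (of_real (sqrt (2 * pi) ^ DIM('a)) * (\<integral>w. f (x - e *\<^sub>R w) * of_real (gauss w) \<partial>lborel)) \<partial>lborel)"
    by (simp only: prod.case integral_mult_right_zero fourier_gauss_inversion[OF f e])
  also have "\<dots> = of_real (sqrt (2 * pi) ^ DIM('a)) *
        (\<integral>x. cnj (f x) * (\<integral>w. f (x - e *\<^sub>R w) * of_real (gauss w) \<partial>lborel) \<partial>lborel)"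
    by (simp only: mult.left_commute[of "cnj _"] integral_mult_right_zero)
  finally show "complex_of_real (\<integral>\<xi>. (norm (fourier f \<xi>))\<^sup>2 * gauss (e *\<^sub>R \<xi>) \<partial>lborel)
      = of_real (sqrt (2 * pi) ^ DIM('a)) *
        (\<integral>x. cnj (f x) * (\<integral>w. f (x - e *\<^sub>R w) * of_real (gauss w) \<partial>lborel) \<partial>lborel)" .
qed

lemma bounded_continuous_supported:
  fixes f :: "'a::euclidean_space \<Rightarrow> complex"
  assumes "continuous_on UNIV f" "\<And>x. x \<notin> cball 0 R \<Longrightarrow> f x = 0"
  obtains B where "\<And>x. norm (f x) \<le> B"
proof -
  have "compact (f ` cball 0 R)"
    by (intro compact_continuous_image continuous_on_subset[OF assms(1)]) auto
  then obtain B where B: "\<forall>x\<in>f ` cball 0 R. norm x \<le> B"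
    using compact_imp_bounded bounded_iff by metis
  have "norm (f x) \<le> max B 0" for x
    using B assms(2)[of x] by (cases "x \<in> cball 0 R") force+
  then show thesis by (rule that)
qed

text \<open>The width of the Gaussian tends to 0 on both sides of the regularised identity: by
  dominated convergence in space, as \<open>f\<close> is bounded and integrable, and by monotone
  convergence in frequency.\<close>

lemma plancherel_continuous:
  fixes f :: "'a::euclidean_space \<Rightarrow> complex"
  assumes cont: "continuous_on UNIV f" and supp: "\<And>x. x \<notin> cball 0 R \<Longrightarrow> f x = 0"
  shows "(\<integral>\<^sup>+\<xi>. ennreal ((norm (fourier f \<xi>))\<^sup>2) \<partial>lebesgue)
    = ennreal ((2 * pi) ^ DIM('a)) * (\<integral>\<^sup>+x. ennreal ((norm (f x))\<^sup>2) \<partial>lebesgue)"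
proof -
  have f: "integrable lborel f" by (rule integrable_lborel_continuous_supported[OF cont supp])
  have [measurable]: "f \<in> borel_measurable borel" using f by auto
  have fl: "integrable lebesgue f" using f by (simp add: integrable_completion)
  note [measurable] = borel_measurable_fourier[OF fl]
  obtain B where B: "\<And>x. norm (f x) \<le> B" using bounded_continuous_supported[OF cont supp] by blast
  have B0: "B \<ge> 0" using B[of 0] norm_ge_zero order_trans by blast
  define e where "e k = inverse (real (Suc k))" for k
  have e: "e k > 0" "e k \<le> 1" for k by (auto simp: e_def inverse_le_1_iff)
  have e0: "e \<longlonglongrightarrow> 0" unfolding e_def by (rule LIMSEQ_inverse_real_of_nat)
  have g: "integrable lborel (gauss :: 'a \<Rightarrow> real)" using gaussian_fourier_scaled(1)[of 1] by simp
  define G where "G = sqrt (2 * pi) ^ DIM('a)"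
  have Gint: "(\<integral>w. of_real (gauss w) \<partial>(lborel :: 'a measure)) = complex_of_real G"
    using gaussian_fourier_scaled(2)[of 1 "0::'a"] by (simp add: G_def gauss_def)
  have gc: "integrable lborel (\<lambda>w::'a. B * gauss w)" using g by simp
  define K where "K k x = (\<integral>w. f (x - e k *\<^sub>R w) * of_real (gauss w) \<partial>lborel)" for k x
  have Kb: "norm (K k x) \<le> B * G" for k x
  proof -
    have "norm (K k x) \<le> (\<integral>w. B * gauss w \<partial>(lborel :: 'a measure))"
      unfolding K_def
    proof (rule Bochner_Integration.integral_norm_bound_integral[OF _ gc])
      show "complex_integrable lborel (\<lambda>w. f (x - e k *\<^sub>R w) * of_real (gauss w))"
        by (rule Bochner_Integration.integrable_bound[OF gc])
          (auto simp: norm_mult abs_mult abs_of_pos[OF gauss_pos] B0 less_imp_le[OF gauss_pos] intro!: mult_right_mono B)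
    qed (auto simp: norm_mult abs_of_pos[OF gauss_pos] less_imp_le[OF gauss_pos] intro!: mult_right_mono B)
    also have "(\<integral>w. B * gauss w \<partial>(lborel :: 'a measure)) = B * G"
      using Gint by (simp del: of_real_power add: integral_complex_of_real)
    finally show ?thesis .
  qed
  have Klim: "(\<lambda>k. K k x) \<longlonglongrightarrow> f x * of_real G" for x
  proof -
    have "(\<lambda>k. K k x) \<longlonglongrightarrow> (\<integral>w. f x * of_real (gauss w) \<partial>(lborel :: 'a measure))"
      unfolding K_def
    proof (rule integral_dominated_convergence[OF _ _ gc])
      show "AE w in lborel. (\<lambda>k. f (x - e k *\<^sub>R w) * of_real (gauss w)) \<longlonglongrightarrow> f x * complex_of_real (gauss w)"
      proof (rule AE_I2)
        fix w :: 'a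
        have "(\<lambda>k. x - e k *\<^sub>R w) \<longlonglongrightarrow> x - 0 *\<^sub>R w" by (intro tendsto_intros e0)
        then have "(\<lambda>k. f (x - e k *\<^sub>R w)) \<longlonglongrightarrow> f x"
          using continuous_on_tendsto_compose[OF cont, of "\<lambda>k. x - e k *\<^sub>R w" x sequentially] by simp
        then show "(\<lambda>k. f (x - e k *\<^sub>R w) * of_real (gauss w)) \<longlonglongrightarrow> f x * complex_of_real (gauss w)"
          by (intro tendsto_intros)
      qed
    qed (auto simp: norm_mult abs_of_pos[OF gauss_pos] less_imp_le[OF gauss_pos] intro!: mult_right_mono B)
    then show ?thesis by (simp only: integral_mult_right_zero Gint)
  qed
  have Km[measurable]: "K k \<in> borel_measurable borel" for k
    unfolding K_def[abs_def] by (rule lborel.borel_measurable_lebesgue_integral) measurable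
  have "(\<lambda>k. \<integral>x. cnj (f x) * K k x \<partial>lborel) \<longlonglongrightarrow> (\<integral>x. cnj (f x) * (f x * of_real G) \<partial>lborel)"
  proof (rule integral_dominated_convergence)
    show "integrable lborel (\<lambda>x. norm (f x) * (B * G))" using f by simp
    show "AE x in lborel. (\<lambda>k. cnj (f x) * K k x) \<longlonglongrightarrow> cnj (f x) * (f x * of_real G)"
      by (intro AE_I2 tendsto_intros Klim)
  qed (auto simp: norm_mult intro!: mult_left_mono Kb)
  moreover have "(\<integral>x. cnj (f x) * (f x * of_real G) \<partial>lborel) = of_real (G * (\<integral>x. (norm (f x))\<^sup>2 \<partial>lborel))"
  proof -
    have "cnj (f x) * (f x * of_real G) = of_real (G * (norm (f x))\<^sup>2)" for x
      unfolding of_real_mult complex_norm_square by (simp only: mult_ac)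
    then show ?thesis by (simp only: integral_complex_of_real integral_mult_right_zero)
  qed
  ultimately have "(\<lambda>k. complex_of_real G * (\<integral>x. cnj (f x) * K k x \<partial>lborel)) \<longlonglongrightarrow> of_real G * of_real (G * (\<integral>x. (norm (f x))\<^sup>2 \<partial>lborel))"
    by (intro tendsto_intros) simp
  then have "(\<lambda>k. complex_of_real (\<integral>\<xi>. (norm (fourier f \<xi>))\<^sup>2 * gauss (e k *\<^sub>R \<xi>) \<partial>lborel)) \<longlonglongrightarrow> of_real (G * G * (\<integral>x. (norm (f x))\<^sup>2 \<partial>lborel))"
    by (simp only: plancherel_gauss(2)[OF f e(1)] K_def G_def of_real_mult mult.assoc)
  then have lim: "(\<lambda>k. \<integral>\<xi>. (norm (fourier f \<xi>))\<^sup>2 * gauss (e k *\<^sub>R \<xi>) \<partial>lborel) \<longlonglongrightarrow> G * G * (\<integral>x. (norm (f x))\<^sup>2 \<partial>lborel)"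
    by (simp only: tendsto_of_real_iff)
  \<comment> \<open>\<open>e k\<close> decreases, so the Gaussian weights increase to 1. Monotone
    convergence yields the square integrability of \<open>fourier f\<close> together with its value;
    no dominating function is at hand.\<close>
  have mono: "AE \<xi> in lborel. mono (\<lambda>k. (norm (fourier f \<xi>))\<^sup>2 * gauss (e k *\<^sub>R \<xi>))"
  proof (intro AE_I2 monoI mult_left_mono)
    fix \<xi> :: 'a and j k :: nat assume "j \<le> k"
    then have "e k \<le> e j" by (simp add: e_def divide_simps)
    then show "gauss (e j *\<^sub>R \<xi>) \<le> gauss (e k *\<^sub>R \<xi>)"
      using e(1)[of k] by (auto simp: gauss_def power_mult_distrib intro!: mult_right_mono power_mono)
  qed auto
  have ptw: "AE \<xi> in lborel. (\<lambda>k. (norm (fourier f \<xi>))\<^sup>2 * gauss (e k *\<^sub>R \<xi>)) \<longlonglongrightarrow> (norm (fourier f \<xi>))\<^sup>2"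
  proof (rule AE_I2)
    fix \<xi> :: 'a
    have "(\<lambda>k. (norm (fourier f \<xi>))\<^sup>2 * gauss (e k *\<^sub>R \<xi>)) \<longlonglongrightarrow> (norm (fourier f \<xi>))\<^sup>2 * exp (- (norm (0 *\<^sub>R \<xi>))\<^sup>2 / 2)"
      unfolding gauss_def by (intro tendsto_intros e0) auto
    then show "(\<lambda>k. (norm (fourier f \<xi>))\<^sup>2 * gauss (e k *\<^sub>R \<xi>)) \<longlonglongrightarrow> (norm (fourier f \<xi>))\<^sup>2" by simp
  qed
  have i1: "integrable lborel (\<lambda>\<xi>. (norm (fourier f \<xi>))\<^sup>2)" and
    i2: "(\<integral>\<xi>. (norm (fourier f \<xi>))\<^sup>2 \<partial>lborel) = G * G * (\<integral>x. (norm (f x))\<^sup>2 \<partial>lborel)"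
    using integrable_monotone_convergence[OF plancherel_gauss(1)[OF f e(1)] mono ptw lim]
      integral_monotone_convergence[OF plancherel_gauss(1)[OF f e(1)] mono ptw lim] by simp_all
  have i3: "integrable lborel (\<lambda>x. (norm (f x))\<^sup>2)"
  proof (rule Bochner_Integration.integrable_bound)
    show "integrable lborel (\<lambda>x. B * norm (f x))" using f by simp
  qed (auto simp: power2_eq_square abs_mult intro!: mult_right_mono order_trans[OF B])
  \<comment> \<open>One factor \<open>G\<close> is the constant of the transformed Gaussian, the
    other the mass of \<open>gauss\<close>.\<close>
  have "G * G = (sqrt (2 * pi) * sqrt (2 * pi)) ^ DIM('a)"
    by (simp only: G_def power_mult_distrib)
  then have "G * G = (2 * pi) ^ DIM('a)" by simp
  then have "(\<integral>\<xi>. (norm (fourier f \<xi>))\<^sup>2 \<partial>lborel) = (2 * pi) ^ DIM('a) * (\<integral>x. (norm (f x))\<^sup>2 \<partial>lborel)"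
    unfolding i2 by (simp only:)
  then show ?thesis
    unfolding nn_integral_completion nn_integral_eq_integral[OF i1 AE_I2, OF zero_le_power2]
      nn_integral_eq_integral[OF i3 AE_I2, OF zero_le_power2]
    by (simp only:) (rule ennreal_mult, auto)
qed

section \<open>Plancherel's theorem\<close>

text \<open>Valued in \<open>ennreal\<close>, so that limits and Fatou's lemma apply before square
  integrability is known.\<close>

abbreviation sq_int :: "('a::euclidean_space \<Rightarrow> complex) \<Rightarrow> ennreal" where
  "sq_int f \<equiv> \<integral>\<^sup>+x. ennreal ((norm (f x))\<^sup>2) \<partial>lebesgue"

section \<open>Passing norm identities to L2 limits\<close>

text \<open>Young's inequality for the cross term of (|b| + |a - b|)^2. The weight
  \<open>\<eta>\<close> keeps the factor of |b|^2 arbitrarily close to 1, so that norm identities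
  survive a limit with their exact constant.\<close>

lemma norm_power2_le_weighted:
  fixes a b :: "'a::real_normed_vector"
  assumes "\<eta> > 0"
  shows "(norm a)\<^sup>2 \<le> (1 + \<eta>) * (norm b)\<^sup>2 + (1 + inverse \<eta>) * (norm (a - b))\<^sup>2"
proof -
  have "norm a \<le> norm b + norm (a - b)"
    using norm_triangle_sub by blast
  then have "(norm a)\<^sup>2 \<le> (norm b + norm (a - b))\<^sup>2"
    by (rule power_mono) simp
  also have "\<dots> \<le> (1 + \<eta>) * (norm b)\<^sup>2 + (1 + inverse \<eta>) * (norm (a - b))\<^sup>2"
  proof -
    have "0 \<le> (\<eta> * norm b - norm (a - b))\<^sup>2 * inverse \<eta>" using assms by simp
    also have "(\<eta> * norm b - norm (a - b))\<^sup>2 * inverse \<eta>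
      = \<eta> * (norm b)\<^sup>2 - 2 * norm b * norm (a - b) + inverse \<eta> * (norm (a - b))\<^sup>2"
      using assms by (simp add: power2_eq_square field_simps)
    finally show ?thesis by (simp add: power2_sum algebra_simps)
  qed
  finally show ?thesis .
qed

lemma sq_int_le_weighted:
  assumes [measurable]: "f \<in> borel_measurable lebesgue" "g \<in> borel_measurable lebesgue" and "\<eta> > 0"
  shows "sq_int f \<le> ennreal (1 + \<eta>) * sq_int g + ennreal (1 + inverse \<eta>) * sq_int (\<lambda>x. f x - g x)"
proof -
  have "sq_int f \<le> (\<integral>\<^sup>+x. ennreal (1 + \<eta>) * ennreal ((norm (g x))\<^sup>2)
      + ennreal (1 + inverse \<eta>) * ennreal ((norm (f x - g x))\<^sup>2) \<partial>lebesgue)"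
    using assms(3) norm_power2_le_weighted[OF assms(3)]
    by (intro nn_integral_mono) (simp flip: ennreal_mult ennreal_plus)
  also have "\<dots> = ennreal (1 + \<eta>) * sq_int g + ennreal (1 + inverse \<eta>) * sq_int (\<lambda>x. f x - g x)"
    by (simp add: nn_integral_add nn_integral_cmult)
  finally show ?thesis .
qed

lemma sq_int_diff_commute: "sq_int (\<lambda>x. f x - g x) = sq_int (\<lambda>x. g x - f x)"
  by (simp add: norm_minus_commute)

text \<open>For fixed \<open>\<eta>\<close> the error terms vanish along \<open>F\<close> and a
  factor (1 + \<eta>)^2 remains, one power for each of the two families; then \<open>\<eta>\<close>
  tends to 0.\<close>

lemma sq_int_limit_le:
  fixes f :: "'i \<Rightarrow> 'a::euclidean_space \<Rightarrow> complex" and f' :: "'i \<Rightarrow> 'b::euclidean_space \<Rightarrow> complex"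
  assumes lim: "L2_tendsto f g F" "L2_tendsto f' g' F" and F: "F \<noteq> bot"
    and [measurable]: "\<And>i. f i \<in> borel_measurable lebesgue" "\<And>i. f' i \<in> borel_measurable lebesgue"
      "g \<in> borel_measurable lebesgue" "g' \<in> borel_measurable lebesgue"
    and le: "\<And>i. sq_int (f i) \<le> ennreal c * sq_int (f' i)"
  shows "sq_int g \<le> ennreal c * sq_int g'"
proof -
  have *: "sq_int g \<le> ennreal ((1 + \<eta>)\<^sup>2) * (ennreal c * sq_int g')" if \<eta>: "\<eta> > 0" for \<eta>
  proof -
    let ?p = "ennreal (1 + \<eta>)" and ?q = "ennreal (1 + inverse \<eta>)"
    let ?B = "\<lambda>i. ?p * (ennreal c * (?p * sq_int g' + ?q * sq_int (\<lambda>x. f' i x - g' x))) + ?q * sq_int (\<lambda>x. f i x - g x)"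
    have "sq_int g \<le> ?B i" for i
    proof -
      have "sq_int g \<le> ?p * sq_int (f i) + ?q * sq_int (\<lambda>x. g x - f i x)"
        by (intro sq_int_le_weighted \<eta>) measurable
      also have "\<dots> = ?p * sq_int (f i) + ?q * sq_int (\<lambda>x. f i x - g x)"
        by (simp only: sq_int_diff_commute)
      also have "\<dots> \<le> ?p * (ennreal c * sq_int (f' i)) + ?q * sq_int (\<lambda>x. f i x - g x)"
        by (intro add_mono mult_left_mono le) auto
      also have "\<dots> \<le> ?B i"
        by (intro add_mono mult_left_mono order.refl sq_int_le_weighted \<eta>) auto
      finally show ?thesis .
    qed
    moreover have "(?B \<longlongrightarrow> ?p * (ennreal c * (?p * sq_int g' + ?q * 0)) + ?q * 0) F"
      using lim unfolding L2_tendsto_def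
      by (intro tendsto_add ennreal_tendsto_cmult tendsto_const) auto
    ultimately have "sq_int g \<le> ?p * (ennreal c * (?p * sq_int g' + ?q * 0)) + ?q * 0"
      by (intro tendsto_lowerbound[OF _ _ F]) auto
    also have "\<dots> = ennreal ((1 + \<eta>)\<^sup>2) * (ennreal c * sq_int g')"
      using \<eta> by (simp add: power2_eq_square ennreal_mult mult_ac)
    finally show ?thesis .
  qed
  have "(\<lambda>k. ennreal ((1 + inverse (real (Suc k)))\<^sup>2) * (ennreal c * sq_int g')) \<longlonglongrightarrow> ennreal ((1 + 0)\<^sup>2) * (ennreal c * sq_int g')"
    by (intro tendsto_mult_ennreal tendsto_ennrealI tendsto_intros LIMSEQ_inverse_real_of_nat) auto
  then show ?thesis
    using * by (intro tendsto_lowerbound[OF _ _ sequentially_bot, of _ _ "sq_int g"]) auto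
qed

text \<open>The preceding inequality, used with \<open>c\<close> in one direction and with
  \<open>inverse c\<close> in the other.\<close>

lemma sq_int_limit_eq:
  assumes "L2_tendsto f g F" "L2_tendsto f' g' F" "F \<noteq> bot"
    and "\<And>i. f i \<in> borel_measurable lebesgue" "\<And>i. f' i \<in> borel_measurable lebesgue"
      "g \<in> borel_measurable lebesgue" "g' \<in> borel_measurable lebesgue"
    and eq: "\<And>i. sq_int (f i) = ennreal c * sq_int (f' i)" and c: "c > 0"
  shows "sq_int g = ennreal c * sq_int g'"
proof (rule antisym)
  show "sq_int g \<le> ennreal c * sq_int g'"
    using assms by (intro sq_int_limit_le[of f g F f' g' c]) auto
  have cc: "ennreal (inverse c) * ennreal c = 1" "ennreal c * ennreal (inverse c) = 1"
    using c by (simp_all flip: ennreal_mult)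
  have "sq_int (f' i) = ennreal (inverse c) * sq_int (f i)" for i
    by (simp only: eq mult.assoc[symmetric] cc mult_1_left)
  then have "sq_int g' \<le> ennreal (inverse c) * sq_int g"
    using assms by (intro sq_int_limit_le[of f' g' F f g]) auto
  then have "ennreal c * sq_int g' \<le> ennreal c * (ennreal (inverse c) * sq_int g)"
    by (rule mult_left_mono) simp
  also have "\<dots> = sq_int g"
    by (simp only: mult.assoc[symmetric] cc mult_1_left)
  finally show "ennreal c * sq_int g' \<le> sq_int g" .
qed

section \<open>Approximation by continuous functions of bounded support\<close>

text \<open>For M > 0 the radial retraction of the plane onto the closed disc of radius
  \<open>M\<close>: it bounds the values of a function without destroying continuity.\<close>

definition clamp_ball :: "real \<Rightarrow> complex \<Rightarrow> complex" where
  "clamp_ball M z = inverse (max 1 (norm z / M)) *\<^sub>R z"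

lemma continuous_on_clamp_ball: "M > 0 \<Longrightarrow> continuous_on A (clamp_ball M)"
  unfolding clamp_ball_def[abs_def] by (intro continuous_intros) (auto simp: max_def)

lemma borel_measurable_clamp_ball: "M > 0 \<Longrightarrow> clamp_ball M \<in> borel_measurable borel"
  by (intro borel_measurable_continuous_onI continuous_on_clamp_ball)

lemma clamp_ball_bounds:
  assumes "M > 0"
  shows "norm (clamp_ball M z) \<le> M" "norm (z - clamp_ball M z) \<le> norm z"
proof -
  have m: "max 1 (norm z / M) \<ge> 1" "max 1 (norm z / M) \<ge> norm z / M" by auto
  have "norm z = M * (norm z / M)" using assms by simp
  also have "\<dots> \<le> M * max 1 (norm z / M)"
    using m(2) assms by (intro mult_left_mono) auto
  finally have "norm z \<le> M * max 1 (norm z / M)" .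
  then show "norm (clamp_ball M z) \<le> M"
    unfolding clamp_ball_def using m(1) by (simp add: divide_inverse[symmetric] mult.commute pos_divide_le_eq)
  have "z - clamp_ball M z = (1 - inverse (max 1 (norm z / M))) *\<^sub>R z"
    by (simp add: clamp_ball_def scaleR_diff_left)
  moreover have "0 \<le> 1 - inverse (max 1 (norm z / M))" "1 - inverse (max 1 (norm z / M)) \<le> 1"
    using m(1) by (auto simp: inverse_le_1_iff)
  ultimately show "norm (z - clamp_ball M z) \<le> norm z"
    by (simp add: mult_left_le_one_le)
qed

lemma clamp_ball_id: "M > 0 \<Longrightarrow> norm z \<le> M \<Longrightarrow> clamp_ball M z = z"
  by (simp add: clamp_ball_def max_def)

lemma clamp_ball_0 [simp]: "clamp_ball M 0 = 0"
  by (simp add: clamp_ball_def)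

text \<open>A measurable function is almost everywhere a limit of continuous ones; clamping and a
  cut-off give these a common bound and a common bounded support, so dominated convergence applies.
  The integrand controls the L^1 and the L^2 distance at once: the first is needed for pointwise
  convergence of the transforms, the second for the norms.\<close>

lemma continuous_approx_bounded:
  fixes f :: "'a::euclidean_space \<Rightarrow> complex"
  assumes f[measurable]: "f \<in> borel_measurable lebesgue" and supp: "\<And>x. x \<notin> cball 0 R \<Longrightarrow> f x = 0"
    and M: "M > 0" "\<And>x. norm (f x) \<le> M"
  obtains h where "\<And>n::nat. continuous_on UNIV (h n)" "\<And>n x. x \<notin> cball 0 (R + 1) \<Longrightarrow> h n x = 0"
    "(\<lambda>n. \<integral>\<^sup>+x. ennreal (norm (f x - h n x) + (norm (f x - h n x))\<^sup>2) \<partial>lebesgue) \<longlonglongrightarrow> 0"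
proof -
  have "f measurable_on UNIV"
    by (rule lebesgue_measurable_imp_measurable_on[OF f]) simp
  then obtain N g where N: "negligible N" and g: "\<And>n. continuous_on UNIV (g n)"
      "\<And>x. x \<notin> N \<Longrightarrow> (\<lambda>n. g n x) \<longlonglongrightarrow> f x"
    unfolding measurable_on_def by auto
  \<comment> \<open>Equal to 1 on the ball of radius \<open>R\<close> and to 0 outside radius R + 1,
    with a linear ramp between; hence the enlarged support.\<close>
  define cut where "cut x = max 0 (min 1 (R + 1 - norm x))" for x :: 'a
  define h where "h n x = cut x *\<^sub>R clamp_ball M (g n x)" for n x
  have cutc: "continuous_on UNIV cut" unfolding cut_def[abs_def] by (intro continuous_intros)
  have hc: "continuous_on UNIV (h n)" for n
    unfolding h_def[abs_def]
    by (intro continuous_intros cutc continuous_on_compose2[OF continuous_on_clamp_ball[OF M(1)] g(1)]) auto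
  have [measurable]: "h n \<in> borel_measurable lebesgue" for n
    by (intro measurable_completion) (simp add: borel_measurable_continuous_onI hc)
  have hs: "h n x = 0" if "x \<notin> cball 0 (R + 1)" for n x
    using that by (simp add: h_def cut_def)
  have hb: "norm (h n x) \<le> M" for n x
  proof -
    have "\<bar>cut x\<bar> \<le> 1" by (auto simp: cut_def)
    then have "\<bar>cut x\<bar> * norm (clamp_ball M (g n x)) \<le> 1 * M"
      using M by (intro mult_mono clamp_ball_bounds) auto
    then show ?thesis by (simp add: h_def)
  qed
  have hl: "(\<lambda>n. h n x) \<longlonglongrightarrow> f x" if "x \<notin> N" for x
  proof -
    have "(\<lambda>n. clamp_ball M (g n x)) \<longlonglongrightarrow> clamp_ball M (f x)"
      using continuous_on_tendsto_compose[OF continuous_on_clamp_ball[OF M(1), of UNIV] g(2)[OF that]] by simp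
    then have "(\<lambda>n. h n x) \<longlonglongrightarrow> cut x *\<^sub>R clamp_ball M (f x)"
      unfolding h_def by (intro tendsto_intros)
    also have "cut x *\<^sub>R clamp_ball M (f x) = f x"
      using supp[of x] by (cases "x \<in> cball 0 R") (auto simp: cut_def clamp_ball_id M)
    finally show ?thesis .
  qed
  have [measurable]: "cball 0 (R + 1) \<in> sets (lebesgue :: 'a measure)" by simp
  let ?w = "\<lambda>x. ennreal (2 * M + (2 * M)\<^sup>2) * indicator (cball 0 (R + 1)) x"
  have "(\<lambda>n. \<integral>\<^sup>+x. ennreal (norm (f x - h n x) + (norm (f x - h n x))\<^sup>2) \<partial>lebesgue) \<longlonglongrightarrow> (\<integral>\<^sup>+x. 0 \<partial>(lebesgue :: 'a measure))"
  proof (rule nn_integral_dominated_convergence[where w="?w"])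
    show "(\<integral>\<^sup>+ x. ?w x \<partial>(lebesgue :: 'a measure)) < \<infinity>"
      using emeasure_bounded_finite[OF bounded_cball, of "0::'a" "R + 1"]
      by (simp add: nn_integral_completion nn_integral_cmult_indicator ennreal_mult_less_top)
    show "AE x in lebesgue. ennreal (norm (f x - h n x) + (norm (f x - h n x))\<^sup>2) \<le> ?w x" for n
    proof (rule AE_I2)
      fix x :: 'a
      show "ennreal (norm (f x - h n x) + (norm (f x - h n x))\<^sup>2) \<le> ?w x"
      proof (cases "x \<in> cball 0 (R + 1)")
        case True
        have "norm (f x - h n x) \<le> 2 * M"
          using norm_triangle_ineq4[of "f x" "h n x"] M(2)[of x] hb[of n x] by linarith
        then have "norm (f x - h n x) + (norm (f x - h n x))\<^sup>2 \<le> 2 * M + (2 * M)\<^sup>2"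
          by (intro add_mono power_mono) auto
        then show ?thesis using True by (simp add: ennreal_leI del: ennreal_plus)
      next
        case False
        then show ?thesis using supp[of x] hs[of x n] by auto
      qed
    qed
    have "AE x in lebesgue. x \<notin> N"
      using N by (simp add: negligible_iff_null_sets AE_not_in)
    then show "AE x in lebesgue. (\<lambda>n. ennreal (norm (f x - h n x) + (norm (f x - h n x))\<^sup>2)) \<longlonglongrightarrow> 0"
    proof eventually_elim
      case (elim x)
      have "(\<lambda>n. ennreal (norm (f x - h n x) + (norm (f x - h n x))\<^sup>2)) \<longlonglongrightarrow> ennreal (norm (f x - f x) + (norm (f x - f x))\<^sup>2)"
        by (intro tendsto_ennrealI tendsto_intros hl elim)
      then show ?case by simp
    qed
  qed (measurable)
  then show thesis using hc hs by (intro that[of h]) auto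
qed

text \<open>On a set of finite measure L^2 is contained in L^1, here through |f| <= 1 + |f|^2 with
  the 1 integrated over the ball only.\<close>

lemma sq_int_le_imp_integrable:
  fixes f :: "'a::euclidean_space \<Rightarrow> complex"
  assumes f[measurable]: "f \<in> borel_measurable lebesgue" and supp: "\<And>x. x \<notin> cball 0 R \<Longrightarrow> f x = 0"
    and fin: "sq_int f < \<infinity>"
  shows "(\<integral>\<^sup>+x. ennreal (norm (f x) + (norm (f x))\<^sup>2) \<partial>lebesgue) < \<infinity>" "integrable lebesgue f"
proof -
  have [measurable]: "cball 0 R \<in> sets (lebesgue :: 'a measure)" by simp
  have "(\<integral>\<^sup>+x. ennreal (norm (f x) + (norm (f x))\<^sup>2) \<partial>lebesgue)
      \<le> (\<integral>\<^sup>+x. indicator (cball 0 R) x + 2 * ennreal ((norm (f x))\<^sup>2) \<partial>lebesgue)"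
  proof (rule nn_integral_mono)
    fix x :: 'a
    have "norm (f x) \<le> 1 + (norm (f x))\<^sup>2" using zero_le_power2[of "norm (f x) - 1/2"] unfolding power2_eq_square by (simp add: algebra_simps)
    then have "norm (f x) + (norm (f x))\<^sup>2 \<le> 1 + 2 * (norm (f x))\<^sup>2" by simp
    then have "ennreal (norm (f x) + (norm (f x))\<^sup>2) \<le> ennreal (1 + 2 * (norm (f x))\<^sup>2)"
      by (rule ennreal_leI)
    also have "\<dots> = 1 + 2 * ennreal ((norm (f x))\<^sup>2)"
      by (subst ennreal_plus) (auto simp: ennreal_mult)
    finally have "ennreal (norm (f x) + (norm (f x))\<^sup>2) \<le> 1 + 2 * ennreal ((norm (f x))\<^sup>2)" .
    then show "ennreal (norm (f x) + (norm (f x))\<^sup>2) \<le> indicator (cball 0 R) x + 2 * ennreal ((norm (f x))\<^sup>2)"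
      using supp[of x] by (cases "x \<in> cball 0 R") auto
  qed
  also have "\<dots> = emeasure lborel (cball 0 R :: 'a set) + 2 * sq_int f"
    by (subst nn_integral_add) (auto simp: nn_integral_cmult)
  also have "\<dots> < \<infinity>"
    using fin emeasure_bounded_finite[OF bounded_cball, of "0::'a" R] by (simp add: ennreal_mult_less_top)
  finally show 1: "(\<integral>\<^sup>+x. ennreal (norm (f x) + (norm (f x))\<^sup>2) \<partial>lebesgue) < \<infinity>" .
  have "(\<integral>\<^sup>+x. ennreal (norm (f x)) \<partial>lebesgue) \<le> (\<integral>\<^sup>+x. ennreal (norm (f x) + (norm (f x))\<^sup>2) \<partial>lebesgue)"
    by (intro nn_integral_mono ennreal_leI) simp
  with 1 show "integrable lebesgue f" by (intro integrableI_bounded) auto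
qed

text \<open>Clamping the values reduces to bounded functions. Since it moves no value by more than
  its norm, the function itself provides the dominating bound. Choosing both approximations for each
  tolerance turns the double limit into one sequence.\<close>

lemma continuous_approx:
  fixes f :: "'a::euclidean_space \<Rightarrow> complex"
  assumes f[measurable]: "f \<in> borel_measurable lebesgue" and supp: "\<And>x. x \<notin> cball 0 R \<Longrightarrow> f x = 0"
    and fin: "sq_int f < \<infinity>"
  obtains h where "\<And>n::nat. continuous_on UNIV (h n)" "\<And>n x. x \<notin> cball 0 (R + 1) \<Longrightarrow> h n x = 0"
    "(\<lambda>n. \<integral>\<^sup>+x. ennreal (norm (f x - h n x) + (norm (f x - h n x))\<^sup>2) \<partial>lebesgue) \<longlonglongrightarrow> 0"
proof -
  let ?\<Phi> = "\<lambda>f. \<integral>\<^sup>+x. ennreal (norm (f x) + (norm (f x))\<^sup>2) \<partial>(lebesgue :: 'a measure)"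
  define c where "c m x = clamp_ball (real (Suc m)) (f x)" for m x
  have cm[measurable]: "c m \<in> borel_measurable lebesgue" for m
    unfolding c_def[abs_def] by (rule measurable_compose[OF f borel_measurable_clamp_ball]) simp
  have "(\<lambda>m. ?\<Phi> (\<lambda>x. f x - c m x)) \<longlonglongrightarrow> (\<integral>\<^sup>+x. 0 \<partial>(lebesgue :: 'a measure))"
  proof (rule nn_integral_dominated_convergence[where w="\<lambda>x. ennreal (norm (f x) + (norm (f x))\<^sup>2)"])
    show "?\<Phi> f < \<infinity>" by (rule sq_int_le_imp_integrable(1)[OF f supp fin])
    show "AE x in lebesgue. ennreal (norm (f x - c m x) + (norm (f x - c m x))\<^sup>2) \<le> ennreal (norm (f x) + (norm (f x))\<^sup>2)" for m
      unfolding c_def by (intro AE_I2 ennreal_leI add_mono power_mono clamp_ball_bounds) auto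
    show "AE x in lebesgue. (\<lambda>m. ennreal (norm (f x - c m x) + (norm (f x - c m x))\<^sup>2)) \<longlonglongrightarrow> 0"
    proof (rule AE_I2, rule tendsto_eventually)
      fix x
      have "eventually (\<lambda>m. norm (f x) \<le> real (Suc m)) sequentially"
        using eventually_ge_at_top[of "nat \<lceil>norm (f x)\<rceil>"] by eventually_elim linarith
      then show "eventually (\<lambda>m. ennreal (norm (f x - c m x) + (norm (f x - c m x))\<^sup>2) = 0) sequentially"
        by eventually_elim (simp add: c_def clamp_ball_id)
    qed
  qed measurable
  then have c0: "(\<lambda>m. ?\<Phi> (\<lambda>x. f x - c m x)) \<longlonglongrightarrow> 0" by simp
  \<comment> \<open>Each of the two approximations has error below 1/(k+1); splitting the square
    costs a factor 2, and the two terms add up to 4/(k+1).\<close>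
  have "\<exists>h. continuous_on UNIV h \<and> (\<forall>x. x \<notin> cball 0 (R + 1) \<longrightarrow> h x = 0) \<and>
      ?\<Phi> (\<lambda>x. f x - h x) \<le> ennreal (4 * inverse (real (Suc k)))" for k
  proof -
    define d where "d = ennreal (inverse (real (Suc k)))"
    have d: "d > 0" by (simp add: d_def)
    obtain m where m: "?\<Phi> (\<lambda>x. f x - c m x) < d"
      using eventually_happens[OF order_tendstoD(2)[OF c0 d]] by auto
    have "c m x = 0" if "x \<notin> cball 0 R" for x using supp[OF that] by (simp add: c_def)
    moreover have "norm (c m x) \<le> real (Suc m)" for x unfolding c_def by (rule clamp_ball_bounds) simp
    ultimately obtain h where hc: "\<And>n::nat. continuous_on UNIV (h n)" and hs: "\<And>n x. x \<notin> cball 0 (R + 1) \<Longrightarrow> h n x = 0"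
      and hl: "(\<lambda>n. ?\<Phi> (\<lambda>x. c m x - h n x)) \<longlonglongrightarrow> 0"
      using continuous_approx_bounded[OF cm[of m], of R "real (Suc m)"] by auto
    obtain n where n: "?\<Phi> (\<lambda>x. c m x - h n x) < d"
      using eventually_happens[OF order_tendstoD(2)[OF hl d]] by auto
    have [measurable]: "h n \<in> borel_measurable lebesgue" for n
      by (intro measurable_completion) (simp add: borel_measurable_continuous_onI hc)
    have "?\<Phi> (\<lambda>x. f x - h n x) \<le> (\<integral>\<^sup>+x. 2 * ennreal (norm (f x - c m x) + (norm (f x - c m x))\<^sup>2)
        + 2 * ennreal (norm (c m x - h n x) + (norm (c m x - h n x))\<^sup>2) \<partial>lebesgue)"
    proof (rule nn_integral_mono)
      fix x
      have "norm (f x - h n x) \<le> norm (f x - c m x) + norm (c m x - h n x)"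
        by (rule norm_diff_triangle_le) auto
      moreover have "(norm (f x - h n x))\<^sup>2 \<le> 2 * (norm (f x - c m x))\<^sup>2 + 2 * (norm (c m x - h n x))\<^sup>2"
        using norm_power2_le_weighted[of 1 "f x - h n x" "f x - c m x"] by (simp add: norm_minus_commute)
      ultimately have "norm (f x - h n x) + (norm (f x - h n x))\<^sup>2 \<le>
        2 * (norm (f x - c m x) + (norm (f x - c m x))\<^sup>2) + 2 * (norm (c m x - h n x) + (norm (c m x - h n x))\<^sup>2)"
        using norm_ge_zero[of "f x - c m x"] norm_ge_zero[of "c m x - h n x"] by (simp only: distrib_left)
      then have "ennreal (norm (f x - h n x) + (norm (f x - h n x))\<^sup>2) \<le> ennreal \<dots>"
        by (rule ennreal_leI)
      also have "\<dots> = 2 * ennreal (norm (f x - c m x) + (norm (f x - c m x))\<^sup>2)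
        + 2 * ennreal (norm (c m x - h n x) + (norm (c m x - h n x))\<^sup>2)"
        by (subst ennreal_plus) (auto simp: ennreal_mult simp del: ennreal_plus distrib_left_numeral)
      finally show "ennreal (norm (f x - h n x) + (norm (f x - h n x))\<^sup>2) \<le>
        2 * ennreal (norm (f x - c m x) + (norm (f x - c m x))\<^sup>2)
        + 2 * ennreal (norm (c m x - h n x) + (norm (c m x - h n x))\<^sup>2)" .
    qed
    also have "\<dots> = 2 * ?\<Phi> (\<lambda>x. f x - c m x) + 2 * ?\<Phi> (\<lambda>x. c m x - h n x)"
      by (subst nn_integral_add, measurable) (simp add: nn_integral_cmult del: ennreal_plus)
    also have "\<dots> \<le> 2 * d + 2 * d"
      using m n by (intro add_mono mult_left_mono) auto
    also have "2 * d = ennreal (2 * inverse (real (Suc k)))"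
      by (simp add: d_def ennreal_mult del: of_nat_Suc)
    also have "ennreal (2 * inverse (real (Suc k))) + ennreal (2 * inverse (real (Suc k))) = ennreal (4 * inverse (real (Suc k)))"
      by (subst ennreal_plus[symmetric]) auto
    finally show ?thesis using hc hs by blast
  qed
  from choice[OF allI, OF this] obtain h where h: "\<forall>k. continuous_on UNIV (h k) \<and>
      (\<forall>x. x \<notin> cball 0 (R + 1) \<longrightarrow> h k x = 0) \<and>
      ?\<Phi> (\<lambda>x. f x - h k x) \<le> ennreal (4 * inverse (real (Suc k)))" by (rule exE)
  have "(\<lambda>k. ennreal (4 * inverse (real (Suc k)))) \<longlonglongrightarrow> ennreal (4 * 0)"
    by (intro tendsto_ennrealI tendsto_intros LIMSEQ_inverse_real_of_nat)
  then have lim: "(\<lambda>k. ennreal (4 * inverse (real (Suc k)))) \<longlonglongrightarrow> 0" by simp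
  have "(\<lambda>k. ?\<Phi> (\<lambda>x. f x - h k x)) \<longlonglongrightarrow> 0"
  proof (rule tendsto_sandwich[OF _ _ tendsto_const lim])
    show "eventually (\<lambda>k. ?\<Phi> (\<lambda>x. f x - h k x) \<le> ennreal (4 * inverse (real (Suc k)))) sequentially"
      using h by (intro always_eventually) blast
  qed simp
  then show thesis using h by (intro that[of h]) blast+
qed

text \<open>L^1 convergence of the approximations makes their transforms converge pointwise; the
  identity for continuous functions controls differences of these transforms in L^2; Fatou's lemma
  then shows that the pointwise limit \<open>fourier f\<close> is also the L^2 limit.\<close>

lemma plancherel_bounded_support:
  fixes f :: "'a::euclidean_space \<Rightarrow> complex"
  assumes f[measurable]: "f \<in> borel_measurable lebesgue" and supp: "\<And>x. x \<notin> cball 0 R \<Longrightarrow> f x = 0"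
    and fin: "sq_int f < \<infinity>"
  shows "sq_int (fourier f) = ennreal ((2 * pi) ^ DIM('a)) * sq_int f"
proof -
  let ?c = "ennreal ((2 * pi) ^ DIM('a))"
  obtain h where hc: "\<And>n::nat. continuous_on UNIV (h n)" and hs: "\<And>n x. x \<notin> cball 0 (R + 1) \<Longrightarrow> h n x = 0"
    and hl: "(\<lambda>n. \<integral>\<^sup>+x. ennreal (norm (f x - h n x) + (norm (f x - h n x))\<^sup>2) \<partial>lebesgue) \<longlonglongrightarrow> 0"
    using continuous_approx[OF f supp fin] by blast
  have [measurable]: "h n \<in> borel_measurable lebesgue" for n
    by (intro measurable_completion) (simp add: borel_measurable_continuous_onI hc)
  have hi: "integrable lebesgue (h n)" for n
    using integrable_lborel_continuous_supported[OF hc hs] by (simp add: integrable_completion)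
  have fi: "integrable lebesgue f" by (rule sq_int_le_imp_integrable(2)[OF f supp fin])
  have Fm[measurable]: "fourier f \<in> borel_measurable lebesgue" "fourier (h n) \<in> borel_measurable lebesgue" for n
    using borel_measurable_fourier[OF fi] borel_measurable_fourier[OF hi] by (auto intro: measurable_completion)
  have "(\<lambda>n. \<integral>\<^sup>+x. ennreal ((norm (f x - h n x))\<^sup>2) \<partial>lebesgue) \<longlonglongrightarrow> 0"
    by (rule tendsto_sandwich[OF _ _ tendsto_const hl]) (auto intro!: always_eventually nn_integral_mono ennreal_leI simp del: ennreal_plus)
  then have h2: "(\<lambda>n. sq_int (\<lambda>x. h n x - f x)) \<longlonglongrightarrow> 0"
    by (simp only: norm_minus_commute)
  then have h2': "L2_tendsto h f sequentially" unfolding L2_tendsto_def .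
  have "(\<lambda>n. \<integral>\<^sup>+x. ennreal (norm (f x - h n x)) \<partial>lebesgue) \<longlonglongrightarrow> 0"
    by (rule tendsto_sandwich[OF _ _ tendsto_const hl]) (auto intro!: always_eventually nn_integral_mono ennreal_leI simp del: ennreal_plus)
  moreover have "(\<integral>\<^sup>+x. ennreal (norm (f x - h n x)) \<partial>lebesgue) = ennreal (\<integral>x. norm (f x - h n x) \<partial>lebesgue)" for n
    using fi hi by (intro nn_integral_eq_integral) auto
  ultimately have h1: "(\<lambda>n. \<integral>x. norm (f x - h n x) \<partial>lebesgue) \<longlonglongrightarrow> 0"
    by (simp flip: ennreal_0)
  have ptw: "(\<lambda>n. fourier (h n) \<xi>) \<longlonglongrightarrow> fourier f \<xi>" for \<xi>
  proof -
    have "norm (fourier f \<xi> - fourier (h n) \<xi>) \<le> (\<integral>x. norm (f x - h n x) \<partial>lebesgue)" for n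
      using norm_fourier_le[of "\<lambda>x. f x - h n x" \<xi>] by (simp add: fourier_diff fi hi)
    then have "(\<lambda>n. fourier f \<xi> - fourier (h n) \<xi>) \<longlonglongrightarrow> 0"
      by (intro tendsto_norm_zero_cancel[OF tendsto_sandwich[OF _ _ tendsto_const h1]]) auto
    then have "(\<lambda>n. fourier f \<xi> - (fourier f \<xi> - fourier (h n) \<xi>)) \<longlonglongrightarrow> fourier f \<xi> - 0"
      by (intro tendsto_intros)
    then show ?thesis by simp
  qed
  have diff: "sq_int (\<lambda>\<xi>. fourier (h k) \<xi> - fourier (h l) \<xi>) = ?c * sq_int (\<lambda>x. h k x - h l x)" for k l
    unfolding fourier_diff[OF hi hi, symmetric]
    by (rule plancherel_continuous[of _ "R + 1"]) (auto intro!: continuous_intros hc simp: hs)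
  \<comment> \<open>Fatou in \<open>l\<close> with \<open>k\<close> fixed; the contribution of
    \<open>h l\<close> minus \<open>f\<close> disappears in the limit inferior.\<close>
  have D: "sq_int (\<lambda>\<xi>. fourier (h k) \<xi> - fourier f \<xi>) \<le> ?c * (2 * sq_int (\<lambda>x. h k x - f x))" for k
  proof -
    have "sq_int (\<lambda>\<xi>. fourier (h k) \<xi> - fourier f \<xi>)
      = (\<integral>\<^sup>+\<xi>. liminf (\<lambda>l. ennreal ((norm (fourier (h k) \<xi> - fourier (h l) \<xi>))\<^sup>2)) \<partial>lebesgue)"
    proof (rule nn_integral_cong)
      fix \<xi>
      have "(\<lambda>l. ennreal ((norm (fourier (h k) \<xi> - fourier (h l) \<xi>))\<^sup>2)) \<longlonglongrightarrow> ennreal ((norm (fourier (h k) \<xi> - fourier f \<xi>))\<^sup>2)"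
        by (intro tendsto_ennrealI tendsto_intros ptw)
      then show "ennreal ((norm (fourier (h k) \<xi> - fourier f \<xi>))\<^sup>2) = liminf (\<lambda>l. ennreal ((norm (fourier (h k) \<xi> - fourier (h l) \<xi>))\<^sup>2))"
        by (rule lim_imp_Liminf[OF sequentially_bot, symmetric])
    qed
    also have "\<dots> \<le> liminf (\<lambda>l. sq_int (\<lambda>\<xi>. fourier (h k) \<xi> - fourier (h l) \<xi>))"
      by (rule nn_integral_liminf) measurable
    also have "\<dots> \<le> liminf (\<lambda>l. ?c * (2 * sq_int (\<lambda>x. h k x - f x) + 2 * sq_int (\<lambda>x. h l x - f x)))"
    proof (intro Liminf_mono always_eventually allI)
      fix l
      have "sq_int (\<lambda>x. h k x - h l x) \<le> ennreal (1 + 1) * sq_int (\<lambda>x. h k x - f x)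
          + ennreal (1 + inverse 1) * sq_int (\<lambda>x. (h k x - h l x) - (h k x - f x))"
        by (rule sq_int_le_weighted) simp_all
      then have "sq_int (\<lambda>x. h k x - h l x) \<le> 2 * sq_int (\<lambda>x. h k x - f x) + 2 * sq_int (\<lambda>x. h l x - f x)"
        by (simp add: norm_minus_commute)
      then show "sq_int (\<lambda>\<xi>. fourier (h k) \<xi> - fourier (h l) \<xi>) \<le> ?c * (2 * sq_int (\<lambda>x. h k x - f x) + 2 * sq_int (\<lambda>x. h l x - f x))"
        unfolding diff by (rule mult_left_mono) simp
    qed
    also have "\<dots> = ?c * (2 * sq_int (\<lambda>x. h k x - f x) + 2 * 0)"
      by (intro lim_imp_Liminf ennreal_tendsto_cmult tendsto_add tendsto_const h2) (auto simp: less_top)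
    finally show ?thesis by simp
  qed
  have "(\<lambda>k. ?c * (2 * sq_int (\<lambda>x. h k x - f x))) \<longlonglongrightarrow> ?c * (2 * 0)"
    by (intro ennreal_tendsto_cmult h2) (auto simp: less_top)
  then have lim: "(\<lambda>k. ?c * (2 * sq_int (\<lambda>x. h k x - f x))) \<longlonglongrightarrow> 0" by simp
  have "L2_tendsto (\<lambda>k. fourier (h k)) (fourier f) sequentially"
    unfolding L2_tendsto_def
    by (rule tendsto_sandwich[OF _ always_eventually[OF allI[OF D]] tendsto_const lim]) simp
  from sq_int_limit_eq[OF this h2' sequentially_bot Fm(2) _ Fm(1) f plancherel_continuous[OF hc hs]]
  show ?thesis by simp
qed

section \<open>Plancherel and consistency for the relation \<open>L2_fourier\<close>\<close>

lemma L2_fourier_eq: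
  "set_lebesgue_integral lebesgue (cball 0 R) (\<lambda>x. exp (- \<i> * of_real (x \<bullet> \<xi>)) * f x)
    = fourier (\<lambda>x. indicator (cball 0 R) x *\<^sub>R f x) \<xi>"
  unfolding set_lebesgue_integral_def fourier_def by simp

text \<open>The definition uses real radii; integer radii give access to Fatou's lemma and dominated
  convergence for sequences.\<close>

lemma L2_fourier_sequentially:
  assumes "L2_fourier f g"
  shows "L2_tendsto (\<lambda>n. fourier (\<lambda>x. indicator (cball 0 (real n)) x *\<^sub>R f x)) g sequentially"
  using assms unfolding L2_fourier_def L2_tendsto_def L2_fourier_eq
  by (auto intro: filterlim_compose[OF _ filterlim_real_sequentially])

lemma L2_space_sq_int:
  assumes "f \<in> L2_space"
  shows "sq_int f = ennreal ((L2_norm f)\<^sup>2)"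
  using assms by (auto simp: L2_space_def L2_norm_def nn_integral_eq_integral)

lemma tendsto_indicator_cball:
  fixes x :: "'a::euclidean_space"
  shows "(\<lambda>n. indicator (cball 0 (real n)) x *\<^sub>R f x) \<longlonglongrightarrow> (f x :: complex)"
proof (rule tendsto_eventually)
  show "eventually (\<lambda>n. indicator (cball 0 (real n)) x *\<^sub>R f x = f x) sequentially"
    using eventually_ge_at_top[of "nat \<lceil>norm x\<rceil>"]
  proof eventually_elim
    case (elim n)
    then have "norm x \<le> real n" by linarith
    then show ?case by simp
  qed
qed

text \<open>The truncations in the definition of \<open>L2_fourier\<close> have bounded support, so
  the identity holds for each of them. They converge to \<open>f\<close> in L^2, and their
  transforms converge to \<open>g\<close> by definition.\<close>

theorem plancherel:
  fixes f g :: "'a::euclidean_space \<Rightarrow> complex"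
  assumes fg: "L2_fourier f g"
  shows "(L2_norm g)\<^sup>2 = (2 * pi) ^ DIM('a) * (L2_norm f)\<^sup>2"
proof -
  have fs: "f \<in> L2_space" and gs: "g \<in> L2_space" using fg by (auto simp: L2_fourier_def)
  then have [measurable]: "f \<in> borel_measurable lebesgue" "g \<in> borel_measurable lebesgue"
    by (auto simp: L2_space_def)
  define T where "T n x = indicator (cball 0 (real n)) x *\<^sub>R f x" for n x
  have [measurable]: "cball 0 R \<in> sets (lebesgue :: 'a measure)" for R by simp
  have Tm[measurable]: "T n \<in> borel_measurable lebesgue" for n unfolding T_def by measurable
  have Ts: "T n x = 0" if "x \<notin> cball 0 (real n)" for n x using that by (auto simp: T_def)
  have fin: "sq_int f < \<infinity>" by (simp add: L2_space_sq_int[OF fs])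
  have Tle: "norm (T n x) \<le> norm (f x)" "norm (T n x - f x) \<le> norm (f x)" for n x
    by (auto simp: T_def indicator_def)
  have Tfin: "sq_int (T n) < \<infinity>" for n
    by (rule le_less_trans[OF nn_integral_mono fin]) (auto intro!: ennreal_leI power_mono Tle)
  have Ti: "integrable lebesgue (T n)" for n
    by (rule sq_int_le_imp_integrable(2)[OF Tm Ts Tfin])
  have "(\<lambda>n. sq_int (\<lambda>x. T n x - f x)) \<longlonglongrightarrow> (\<integral>\<^sup>+x. 0 \<partial>(lebesgue :: 'a measure))"
  proof (rule nn_integral_dominated_convergence[where w="\<lambda>x. ennreal ((norm (f x))\<^sup>2)"])
    show "AE x in lebesgue. (\<lambda>n. ennreal ((norm (T n x - f x))\<^sup>2)) \<longlonglongrightarrow> 0"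
    proof (rule AE_I2)
      fix x
      have "(\<lambda>n. ennreal ((norm (T n x - f x))\<^sup>2)) \<longlonglongrightarrow> ennreal ((norm (f x - f x))\<^sup>2)"
        unfolding T_def by (intro tendsto_ennrealI tendsto_intros tendsto_indicator_cball)
      then show "(\<lambda>n. ennreal ((norm (T n x - f x))\<^sup>2)) \<longlonglongrightarrow> 0" by simp
    qed
  qed (use fin in \<open>auto intro!: AE_I2 ennreal_leI power_mono Tle\<close>)
  then have Tl: "L2_tendsto T f sequentially" unfolding L2_tendsto_def by simp
  have "sq_int g = ennreal ((2 * pi) ^ DIM('a)) * sq_int f"
  proof (rule sq_int_limit_eq[OF L2_fourier_sequentially[OF fg, folded T_def] Tl sequentially_bot])
    show "fourier (T n) \<in> borel_measurable lebesgue" for n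
      by (intro measurable_completion) (simp add: borel_measurable_fourier[OF Ti])
    show "sq_int (fourier (T n)) = ennreal ((2 * pi) ^ DIM('a)) * sq_int (T n)" for n
      by (rule plancherel_bounded_support[OF Tm Ts Tfin])
  qed auto
  then show ?thesis
    by (simp add: L2_space_sq_int[OF fs] L2_space_sq_int[OF gs] flip: ennreal_mult)
qed

text \<open>The transforms of the truncations converge pointwise to \<open>fourier f\<close> and in
  L^2 to \<open>g\<close>, so Fatou's lemma forces the limits to agree. The transformed datum may
  thus be treated as a bounded continuous function.\<close>

lemma L2_fourier_integrable:
  fixes f g :: "'a::euclidean_space \<Rightarrow> complex"
  assumes fg: "L2_fourier f g" and f: "integrable lebesgue f"
  shows "AE \<xi> in lebesgue. g \<xi> = fourier f \<xi>"
proof -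
  have [measurable]: "f \<in> borel_measurable lebesgue" "g \<in> borel_measurable lebesgue"
    using fg by (auto simp: L2_fourier_def L2_space_def)
  define T where "T n x = indicator (cball 0 (real n)) x *\<^sub>R f x" for n x
  have [measurable]: "cball 0 R \<in> sets (lebesgue :: 'a measure)" for R by simp
  have Tm[measurable]: "T n \<in> borel_measurable lebesgue" for n unfolding T_def by measurable
  have Tle: "norm (T n x) \<le> norm (f x)" for n x by (auto simp: T_def indicator_def)
  have Ti: "integrable lebesgue (T n)" for n
    by (rule Bochner_Integration.integrable_bound[OF f Tm]) (simp add: Tle)
  have [measurable]: "fourier (T n) \<in> borel_measurable lebesgue" "fourier f \<in> borel_measurable lebesgue" for n
    by (auto intro!: measurable_completion simp: borel_measurable_fourier[OF Ti] borel_measurable_fourier[OF f])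
  have ptw: "(\<lambda>n. fourier (T n) \<xi>) \<longlonglongrightarrow> fourier f \<xi>" for \<xi>
    unfolding fourier_def
  proof (rule integral_dominated_convergence)
    show "AE x in lebesgue. (\<lambda>n. exp (- \<i> * of_real (x \<bullet> \<xi>)) * T n x) \<longlonglongrightarrow> exp (- \<i> * of_real (x \<bullet> \<xi>)) * f x"
      unfolding T_def by (intro AE_I2 tendsto_intros tendsto_indicator_cball)
    show "integrable lebesgue (\<lambda>x. norm (f x))" using f by simp
    show "AE x in lebesgue. norm (exp (- \<i> * of_real (x \<bullet> \<xi>)) * T n x) \<le> norm (f x)" for n
      using Tle by (simp add: norm_mult norm_exp_ii)
  qed (use integrable_exp_mult[OF f] integrable_exp_mult[OF Ti] in auto)
  have "sq_int (\<lambda>\<xi>. fourier f \<xi> - g \<xi>)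
      = (\<integral>\<^sup>+\<xi>. liminf (\<lambda>n. ennreal ((norm (fourier (T n) \<xi> - g \<xi>))\<^sup>2)) \<partial>lebesgue)"
    by (intro nn_integral_cong lim_imp_Liminf[symmetric] tendsto_ennrealI tendsto_intros ptw) simp
  also have "\<dots> \<le> liminf (\<lambda>n. sq_int (\<lambda>\<xi>. fourier (T n) \<xi> - g \<xi>))"
    by (rule nn_integral_liminf) measurable
  also have "\<dots> = 0"
    using L2_fourier_sequentially[OF fg, folded T_def] unfolding L2_tendsto_def
    by (intro lim_imp_Liminf) auto
  finally have "AE \<xi> in lebesgue. ennreal ((norm (fourier f \<xi> - g \<xi>))\<^sup>2) = 0"
    by (subst (asm) le_zero_eq, subst (asm) nn_integral_0_iff_AE) measurable
  then show ?thesis by eventually_elim simp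
qed

section \<open>The damped oscillator\<close>

text \<open>The integrating factor exp(-c t) produces a function whose derivative vanishes on the
  convex set \<open>{0..}\<close>, including the one-sided derivative at 0.\<close>

lemma linear_ode_unique:
  fixes y :: "real \<Rightarrow> complex"
  assumes "\<And>t. t \<ge> 0 \<Longrightarrow> (y has_vector_derivative c * y t) (at t within {0..})" and t: "t \<ge> 0"
  shows "y t = exp (c * of_real t) * y 0"
proof -
  have d: "((\<lambda>t. exp (- c * of_real t) * y t) has_vector_derivative 0) (at t within {0..})" if "t \<in> {0..}" for t
  proof -
    from that have y: "(y has_vector_derivative c * y t) (at t within {0..})" using assms(1) by simp
    have e: "((\<lambda>t. exp (- c * of_real t)) has_vector_derivative - c * exp (- c * of_real t)) (at t within {0..})"
    proof -
      have "((\<lambda>x. - c * of_real x) has_vector_derivative - c * 1) (at t within {0..})"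
        by (intro derivative_intros) (auto intro!: derivative_eq_intros)
      from field_vector_diff_chain_within[OF this, of exp "exp (- c * of_real t)"]
      show ?thesis by (auto simp: o_def intro!: DERIV_exp has_field_derivative_at_within)
    qed
    show "((\<lambda>t. exp (- c * of_real t) * y t) has_vector_derivative 0) (at t within {0..})"
      using has_vector_derivative_mult[OF e y] by simp
  qed
  obtain k where k: "\<And>t. t \<in> {0..} \<Longrightarrow> exp (- c * of_real t) * y t = k"
    using has_vector_derivative_zero_constant[OF _ d] by (metis convex_real_interval(1))
  have "exp (- c * of_real t) * y t = y 0"
    using k[of 0] k[of t] t by simp
  then show ?thesis
    by (simp add: exp_minus field_simps)
qed

text \<open>
  If \<open>k\<close> and \<open>m\<close> are the characteristic roots, then $z - m u$ solves $y' = k y$; the two resulting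
  equations determine \<open>u\<close>.
\<close>

lemma damped_oscillator_solution:
  fixes u z :: "real \<Rightarrow> complex" and a :: real
  assumes a: "0 < a" "a < 4"
    and u: "\<And>t. t \<ge> 0 \<Longrightarrow> (u has_vector_derivative z t) (at t within {0..})"
    and z: "\<And>t. t \<ge> 0 \<Longrightarrow> (z has_vector_derivative - of_real a * u t - of_real a * z t) (at t within {0..})"
    and u0: "u 0 = 0" and t: "t \<ge> 0"
  defines "\<omega> \<equiv> sqrt (a - a\<^sup>2 / 4)"
  shows "u t = of_real (exp (- (a * t) / 2) * (sin (\<omega> * t) / \<omega>)) * z 0"
proof -
  have "a\<^sup>2 / 4 < a" using a by (simp add: power2_eq_square)
  then have w: "\<omega> > 0" "\<omega>\<^sup>2 = a - a\<^sup>2 / 4" by (auto simp: \<omega>_def)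
  \<comment> \<open>For a < 4 the discriminant a^2 - 4 a is negative: the characteristic roots are
    the conjugate pair with real part -a/2 and imaginary parts \<omega> and -\<omega>, and their
    product is a^2/4 + \<omega>^2 = a.\<close>
  define l1 where "l1 = Complex (- a / 2) \<omega>"
  define l2 where "l2 = Complex (- a / 2) (- \<omega>)"
  have l: "l1 + l2 = - of_real a" "l1 * l2 = of_real a"
    using w by (auto simp: l1_def l2_def complex_eq_iff power2_eq_square)
  have sol: "z t - m * u t = exp (k * of_real t) * z 0" if km: "k + m = - of_real a" "k * m = of_real a" for k m :: complex
  proof -
    have "((\<lambda>t. z t - m * u t) has_vector_derivative k * (z t - m * u t)) (at t within {0..})" if "t \<ge> 0" for t
    proof -
      have *: "((\<lambda>t. z t - m * u t) has_vector_derivative (- of_real a * u t - of_real a * z t) - m * z t) (at t within {0..})"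
        by (intro derivative_intros u z that)
      have "of_real a + m = - k"
        using arg_cong[OF km(1), of "\<lambda>x. of_real a + x - k"] by (simp add: algebra_simps)
      have "(- of_real a * u t - of_real a * z t) - m * z t = - of_real a * u t - (of_real a + m) * z t"
        by (simp add: algebra_simps)
      also have "\<dots> = k * z t - (k * m) * u t"
        by (simp add: \<open>of_real a + m = - k\<close> km(2))
      finally have "(- of_real a * u t - of_real a * z t) - m * z t = k * (z t - m * u t)"
        by (simp add: algebra_simps)
      with * show ?thesis by simp
    qed
    from linear_ode_unique[OF this t] u0 show ?thesis by simp
  qed
  have "(l1 - l2) * u t = (z t - l2 * u t) - (z t - l1 * u t)" by (simp add: algebra_simps)
  also have "\<dots> = (exp (l1 * of_real t) - exp (l2 * of_real t)) * z 0"
    using sol[of l1 l2] sol[of l2 l1] l by (simp add: algebra_simps)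
  also have "exp (l1 * of_real t) - exp (l2 * of_real t) = 2 * \<i> * of_real (exp (- (a * t) / 2) * sin (\<omega> * t))"
    by (simp add: l1_def l2_def complex_eq_iff Re_exp Im_exp)
  also have "l1 - l2 = 2 * \<i> * of_real \<omega>"
    by (simp add: l1_def l2_def complex_eq_iff)
  finally have "2 * \<i> * (of_real \<omega> * u t) = 2 * \<i> * (of_real (exp (- (a * t) / 2) * sin (\<omega> * t)) * z 0)"
    by (simp only: mult.assoc)
  then have "of_real \<omega> * u t = of_real (exp (- (a * t) / 2) * sin (\<omega> * t)) * z 0"
    by simp
  then show ?thesis using w(1) by (simp add: field_simps)
qed

text \<open>The explicit formula degenerates at a = 4, where the characteristic roots coincide, and
  the slow root tends to -1 as a grows. An energy estimate that is uniform in a >= 1/2 covers all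
  these cases.\<close>

lemma damped_oscillator_decay:
  fixes u z :: "real \<Rightarrow> complex" and a :: real
  assumes a: "a \<ge> 1 / 2"
    and u: "\<And>t. t \<ge> 0 \<Longrightarrow> (u has_vector_derivative z t) (at t within {0..})"
    and z: "\<And>t. t \<ge> 0 \<Longrightarrow> (z has_vector_derivative - of_real a * u t - of_real a * z t) (at t within {0..})"
    and u0: "u 0 = 0" and t: "t \<ge> 0"
  shows "(norm (u t))\<^sup>2 \<le> 4 * exp (- t / 4) * (norm (z 0))\<^sup>2"
proof -
  \<comment> \<open>The cross term makes the energy dissipate in the direction of \<open>u\<close> too; its coefficient is
    small enough for \<open>V\<close> to stay coercive when $a \ge 1/2$.\<close>
  define V where "V t = z t \<bullet> z t + (5 / 4) * (a * (u t \<bullet> u t)) + (1 / 2) * (z t \<bullet> u t)" for t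
  \<comment> \<open>The derivative of \<open>V\<close> along the equation. The weight 5/4 is the one
    for which the terms in a (z \<bullet> u) cancel: -2 + 5/2 - 1/2 = 0.\<close>
  define V' where "V' t = (1 / 2) * (z t \<bullet> z t) - 2 * (a * (z t \<bullet> z t)) - (1 / 2) * (a * (u t \<bullet> u t))" for t
  have zu: "\<bar>z t \<bullet> u t\<bar> \<le> (z t \<bullet> z t + u t \<bullet> u t) / 2" for t
  proof -
    have "0 \<le> (z t + u t) \<bullet> (z t + u t)" "0 \<le> (z t - u t) \<bullet> (z t - u t)" by simp_all
    then show ?thesis by (simp add: inner_add inner_diff inner_commute)
  qed
  have uu: "u t \<bullet> u t \<le> 2 * (a * (u t \<bullet> u t))" "0 \<le> a * (u t \<bullet> u t)" for t
    using a mult_right_mono[of 1 "2 * a" "u t \<bullet> u t"] by (auto simp: mult.assoc)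
  have az: "z t \<bullet> z t \<le> 2 * (a * (z t \<bullet> z t))" for t
    using a mult_right_mono[of 1 "2 * a" "z t \<bullet> z t"] by (auto simp: mult.assoc)
  have V': "V' t \<le> - V t / 4" for t
  proof -
    \<comment> \<open>\<open>ap\<close> and \<open>aq\<close> stand for a |z|^2 and a |u|^2, treated
      as free variables tied by linear inequalities, so the rate 1/4 does not depend on
      \<open>a\<close>.\<close>
    have *: "p / 2 - 2 * ap - aq / 2 \<le> - (p + 5 / 4 * aq + r / 2) / 4"
      if "\<bar>r\<bar> \<le> (p + q) / 2" "q \<le> 2 * aq" "0 \<le> aq" "p \<le> 2 * ap" "0 \<le> p" for p q r ap aq :: real
      using that by (simp add: field_simps abs_le_iff)
    show ?thesis
      using *[OF zu uu az inner_ge_zero, of t] unfolding V_def V'_def by simp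
  qed
  have Vge: "u t \<bullet> u t \<le> 4 * V t" for t
  proof -
    have *: "q \<le> 4 * (p + 5 / 4 * aq + r / 2)"
      if "\<bar>r\<bar> \<le> (p + q) / 2" "q \<le> 2 * aq" "0 \<le> aq" "0 \<le> p" for p q r aq :: real
      using that by (simp add: field_simps abs_le_iff)
    show ?thesis
      using *[OF zu uu inner_ge_zero, of t] unfolding V_def by simp
  qed
  have dV: "(V has_vector_derivative V' t) (at t within {0..})" if "t \<ge> 0" for t
  proof -
    note inn = bounded_bilinear.has_vector_derivative[OF bounded_bilinear_inner]
    have "(V has_vector_derivative (z t \<bullet> (- of_real a * u t - of_real a * z t) + (- of_real a * u t - of_real a * z t) \<bullet> z t)
       + (5 / 4) * (a * (u t \<bullet> z t + z t \<bullet> u t)) + (1 / 2) * (z t \<bullet> z t + (- of_real a * u t - of_real a * z t) \<bullet> u t)) (at t within {0..})"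
      unfolding V_def[abs_def] by (intro has_vector_derivative_add has_vector_derivative_mult_right inn u z that)
    moreover have "of_real a * w = a *\<^sub>R w" for w :: complex
      by (simp add: scaleR_conv_of_real)
    ultimately show ?thesis
      by (rule_tac has_vector_derivative_eq_rhs) (auto simp: V'_def inner_diff inner_commute[of "u t" "z t"] algebra_simps)
  qed
  \<comment> \<open>Gronwall: with the weight exp(t/4) the inequality V' <= -V/4 says that the
    product is nonincreasing.\<close>
  have dW: "((\<lambda>t. exp (t / 4) * V t) has_vector_derivative exp (t / 4) * V' t + exp (t / 4) / 4 * V t) (at t within {0..})" if "t \<ge> 0" for t
  proof (rule has_vector_derivative_mult[OF _ dV[OF that]])
    show "((\<lambda>t. exp (t / 4)) has_vector_derivative exp (t / 4) / 4) (at t within {0..})"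
      by (auto simp: has_real_derivative_iff_has_vector_derivative[symmetric] intro!: derivative_eq_intros)
  qed
  have "exp (t / 4) * V t \<le> V 0"
  proof -
    have "\<exists>s\<in>{0..t}. exp (t / 4) * V t - exp (0 / 4) * V 0 = (\<lambda>h. h *\<^sub>R (exp (s / 4) * V' s + exp (s / 4) / 4 * V s)) (t - 0)"
    proof (rule mvt_very_simple[OF t])
      fix s assume "0 \<le> s" "s \<le> t"
      then show "((\<lambda>t. exp (t / 4) * V t) has_derivative (\<lambda>h. h *\<^sub>R (exp (s / 4) * V' s + exp (s / 4) / 4 * V s))) (at s within {0..t})"
        using has_vector_derivative_within_subset[OF dW[of s], of "{0..t}"] by (auto simp: has_vector_derivative_def)
    qed
    then obtain s where s: "exp (t / 4) * V t - V 0 = t * (exp (s / 4) * V' s + exp (s / 4) / 4 * V s)" by auto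
    have "exp (s / 4) * V' s + exp (s / 4) / 4 * V s = exp (s / 4) * (V' s + V s / 4)" by (simp add: algebra_simps)
    also have "\<dots> \<le> 0" using V'[of s] by (intro mult_nonneg_nonpos) auto
    finally have "t * (exp (s / 4) * V' s + exp (s / 4) / 4 * V s) \<le> 0" using t by (intro mult_nonneg_nonpos)
    with s show ?thesis by simp
  qed
  also have "V 0 = (norm (z 0))\<^sup>2" by (simp add: V_def u0 power2_norm_eq_inner)
  finally have "V t \<le> exp (- t / 4) * (norm (z 0))\<^sup>2"
    by (simp add: exp_minus field_simps)
  with Vge[of t] show ?thesis by (simp add: power2_norm_eq_inner)
qed

section \<open>Radial integrals\<close>

text \<open>Half-lines generate the Borel sets, and on them both measures give the volume of a ball;
  the density is the derivative of that volume in the radius.\<close>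

lemma distr_norm_lborel:
  "distr lborel borel (norm :: 'a::euclidean_space \<Rightarrow> real)
    = density lborel (\<lambda>r. ennreal (real DIM('a) * unit_ball_vol DIM('a) * r ^ (DIM('a) - 1)) * indicator {0..} r)"
  (is "?M = ?N")
proof (rule measure_eqI_generator_eq[where E="range atMost" and \<Omega>=UNIV and A="\<lambda>i. {..real i}"])
  show "Int_stable (range atMost :: real set set)" by (auto simp: Int_stable_def)
  have em: "emeasure ?M {..x} = (if x < 0 then 0 else ennreal (unit_ball_vol DIM('a) * x ^ DIM('a)))" for x
  proof -
    have "emeasure ?M {..x} = emeasure lborel (cball (0 :: 'a) x)"
      by (subst emeasure_distr) (auto intro!: arg_cong[where f="emeasure _"])
    then show ?thesis by (simp add: emeasure_cball)
  qed
  have en: "emeasure ?N {..x} = (if x < 0 then 0 else ennreal (unit_ball_vol DIM('a) * x ^ DIM('a)))" for x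
  proof -
    have "emeasure ?N {..x} = (\<integral>\<^sup>+r. ennreal (real DIM('a) * unit_ball_vol DIM('a) * r ^ (DIM('a) - 1)) * indicator {0..x} r \<partial>lborel)"
      by (subst emeasure_density) (auto intro!: nn_integral_cong simp: indicator_def)
    also have "\<dots> = (if x < 0 then 0 else ennreal (unit_ball_vol DIM('a) * x ^ DIM('a)))"
    proof (cases "x < 0")
      case False
      have "(\<integral>\<^sup>+r. ennreal (real DIM('a) * unit_ball_vol DIM('a) * r ^ (DIM('a) - 1)) * indicator {0..x} r \<partial>lborel)
        = unit_ball_vol DIM('a) * x ^ DIM('a) - unit_ball_vol DIM('a) * 0 ^ DIM('a)"
        by (rule nn_integral_FTC_Icc) (use False in \<open>auto intro!: derivative_eq_intros\<close>)
      with False show ?thesis by (simp add: power_0_left)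
    qed (auto simp: indicator_def)
    finally show ?thesis .
  qed
  show "emeasure ?M X = emeasure ?N X" if "X \<in> range atMost" for X
    using that em en by auto
  show "sets ?M = sigma_sets UNIV (range atMost)" "sets ?N = sigma_sets UNIV (range atMost)"
    by (simp_all add: borel_eq_atMost)
  show "(\<Union>i. {..real i}) = UNIV"
    by (auto intro: real_arch_simple)
  show "emeasure ?M {..real i} \<noteq> \<infinity>" for i by (simp add: em)
qed auto

lemma nn_integral_radial:
  fixes h :: "real \<Rightarrow> ennreal"
  assumes [measurable]: "h \<in> borel_measurable borel"
  shows "(\<integral>\<^sup>+x. h (norm x) \<partial>(lborel :: 'a::euclidean_space measure))
    = ennreal (real DIM('a) * unit_ball_vol DIM('a)) * (\<integral>\<^sup>+r. ennreal (r ^ (DIM('a) - 1)) * h r * indicator {0..} r \<partial>lborel)"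
proof -
  have "(\<integral>\<^sup>+x. h (norm x) \<partial>(lborel :: 'a measure)) = integral\<^sup>N (distr lborel borel (norm :: 'a \<Rightarrow> real)) h"
    by (simp add: nn_integral_distr)
  also have "\<dots> = (\<integral>\<^sup>+r. ennreal (real DIM('a) * unit_ball_vol DIM('a)) * (ennreal (r ^ (DIM('a) - 1)) * h r * indicator {0..} r) \<partial>lborel)"
    unfolding distr_norm_lborel
    by (subst nn_integral_density) (auto intro!: nn_integral_cong simp: indicator_def ennreal_mult mult_ac)
  also have "\<dots> = ennreal (real DIM('a) * unit_ball_vol DIM('a)) * (\<integral>\<^sup>+r. ennreal (r ^ (DIM('a) - 1)) * h r * indicator {0..} r \<partial>lborel)"
    by (rule nn_integral_cmult) measurable
  finally show ?thesis .
qed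

text \<open>The minorant \<open>\<phi>'\<close> may be negative in places, as happens in dimension
  2, so it is compared with \<open>g\<close> through Henstock-Kurzweil integrals instead of
  nonnegative ones.\<close>

lemma FTC_le_nn_integral:
  fixes \<phi> g :: "real \<Rightarrow> real"
  assumes "a \<le> b" and d: "\<And>x. x \<in> {a..b} \<Longrightarrow> (\<phi> has_real_derivative \<phi>' x) (at x)"
    and [measurable]: "g \<in> borel_measurable borel"
    and g: "\<And>x. x \<in> {a..b} \<Longrightarrow> \<phi>' x \<le> g x" "\<And>x. x \<in> {a..b} \<Longrightarrow> 0 \<le> g x"
  shows "ennreal (\<phi> b - \<phi> a) \<le> (\<integral>\<^sup>+x. ennreal (g x) * indicator {a..b} x \<partial>lborel)"
proof (cases "(\<integral>\<^sup>+x. ennreal (g x) * indicator {a..b} x \<partial>lborel)")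
  case (real r)
  have "(\<integral>\<^sup>+x. ennreal (g x * indicator {a..b} x) \<partial>lborel) = ennreal r"
    using real(2) by (simp add: ennreal_mult'' ennreal_indicator)
  then have "((\<lambda>x. g x * indicator {a..b} x) has_integral r) UNIV"
    using real(1) g(2) by (intro nn_integral_has_integral) (auto simp: indicator_def)
  also have "(\<lambda>x. g x * indicator {a..b} x) = (\<lambda>x. if x \<in> {a..b} then g x else 0)"
    by (auto simp: indicator_def)
  finally have 1: "(g has_integral r) {a..b}" by (simp only: has_integral_restrict_UNIV)
  have 2: "(\<phi>' has_integral \<phi> b - \<phi> a) {a..b}"
    using d by (intro fundamental_theorem_of_calculus[OF \<open>a \<le> b\<close>])
      (auto simp: has_real_derivative_iff_has_vector_derivative[symmetric] intro: has_field_derivative_at_within)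
  have "\<phi> b - \<phi> a \<le> r"
    by (rule has_integral_le[OF 2 1 g(1)])
  then show ?thesis using real by (simp add: ennreal_leI)
qed simp

section \<open>The radial multiplier and its elementary bounds\<close>

definition damp :: "real \<Rightarrow> real" where
  "damp r = ln (1 + r\<^sup>2)"

definition freq :: "real \<Rightarrow> real" where
  "freq r = sqrt (damp r - (damp r)\<^sup>2 / 4)"

text \<open>
  The square of the Fourier multiplier of the solution operator at a frequency of length
  $0 < r < 1$. At $r = 0$, where \<open>freq\<close> vanishes, division by zero makes it 0 instead of $t^2$.
\<close>

definition osc :: "real \<Rightarrow> real \<Rightarrow> real" where
  "osc t r = exp (- (damp r * t)) * (sin (freq r * t) / freq r)\<^sup>2"

lemma borel_measurable_osc [measurable]: "osc t \<in> borel_measurable borel"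
  unfolding osc_def[abs_def] freq_def[abs_def] damp_def[abs_def] by measurable

lemma osc_nonneg: "osc t r \<ge> 0"
  by (simp add: osc_def)

text \<open>x / (1 + x) <= ln (1 + x) <= x for x = r^2 <= 1.\<close>

lemma damp_bounds:
  assumes "0 \<le> r" "r \<le> 1"
  shows "r\<^sup>2 / 2 \<le> damp r" "damp r \<le> r\<^sup>2"
proof -
  have r2: "r\<^sup>2 \<le> 1" using assms by (simp add: power_le_one)
  show "damp r \<le> r\<^sup>2" unfolding damp_def by (rule ln_add_one_self_le_self) simp
  have "ln (inverse (1 + r\<^sup>2)) \<le> inverse (1 + r\<^sup>2) - 1"
    by (intro ln_le_minus_one) (simp add: add_pos_nonneg)
  then have "1 - inverse (1 + r\<^sup>2) \<le> damp r"
    by (simp add: damp_def ln_inverse add_pos_nonneg)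
  moreover have "1 - inverse (1 + r\<^sup>2) = r\<^sup>2 / (1 + r\<^sup>2)"
    using add_pos_nonneg[of 1 "r\<^sup>2"] by (simp add: field_simps)
  moreover have "r\<^sup>2 / 2 \<le> r\<^sup>2 / (1 + r\<^sup>2)"
    using r2 by (intro divide_left_mono) (auto simp: add_pos_nonneg)
  ultimately show "r\<^sup>2 / 2 \<le> damp r" by linarith
qed

lemma freq_power2:
  assumes "0 \<le> r" "r \<le> 1"
  shows "(freq r)\<^sup>2 = damp r - (damp r)\<^sup>2 / 4" "(3 / 4) * damp r \<le> (freq r)\<^sup>2" "(freq r)\<^sup>2 \<le> damp r"
proof -
  have d: "0 \<le> damp r" "damp r \<le> 1"
    using damp_bounds[OF assms] zero_le_power2[of r] power_le_one[OF assms, of 2] by linarith+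
  then have "(damp r)\<^sup>2 \<le> damp r" by (simp add: power2_eq_square mult_left_le)
  with d have "0 \<le> damp r - (damp r)\<^sup>2 / 4" by linarith
  then show eq: "(freq r)\<^sup>2 = damp r - (damp r)\<^sup>2 / 4" unfolding freq_def by (rule real_sqrt_pow2)
  show "(3 / 4) * damp r \<le> (freq r)\<^sup>2" "(freq r)\<^sup>2 \<le> damp r"
    unfolding eq using \<open>(damp r)\<^sup>2 \<le> damp r\<close> zero_le_power2[of "damp r"] by linarith+
qed

lemma freq_bounds:
  assumes "0 \<le> r" "r \<le> 1"
  shows "r / 2 \<le> freq r" "freq r \<le> r"
proof -
  have "0 \<le> damp r - (damp r)\<^sup>2 / 4"
    using freq_power2(1,2)[OF assms] damp_bounds(1)[OF assms] zero_le_power2[of r] by linarith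
  then have f0: "0 \<le> freq r" unfolding freq_def by (rule real_sqrt_ge_zero)
  have "(r / 2)\<^sup>2 \<le> (freq r)\<^sup>2"
  proof -
    have "(r / 2)\<^sup>2 = r\<^sup>2 / 4" by (simp add: power_divide)
    with freq_power2(2)[OF assms] damp_bounds(1)[OF assms] zero_le_power2[of r] show ?thesis by linarith
  qed
  then show "r / 2 \<le> freq r" by (rule power2_le_imp_le) (rule f0)
  have "(freq r)\<^sup>2 \<le> r\<^sup>2"
    using freq_power2(3)[OF assms] damp_bounds(2)[OF assms] by linarith
  then show "freq r \<le> r" by (rule power2_le_imp_le) (rule assms(1))
qed

text \<open>The first bound, from |sin x| <= |x|, is the useful one for r below 1/t; the second,
  from |sin x| <= 1 and freq r >= r/2, for r above 1/t.\<close>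

lemma osc_le:
  assumes r: "0 \<le> r" "r \<le> 1" and t: "t \<ge> 0"
  shows "osc t r \<le> t\<^sup>2" "osc t r \<le> 4 / r\<^sup>2 * exp (- (r\<^sup>2 * t / 2))"
proof -
  have e: "exp (- (damp r * t)) \<le> exp (- (r\<^sup>2 * t / 2))"
    using mult_right_mono[OF damp_bounds(1)[OF r] t] by simp
  have f0: "0 \<le> freq r" using freq_bounds[OF r] r by linarith
  have "\<bar>sin (freq r * t) / freq r\<bar> \<le> t"
  proof (cases "freq r = 0")
    case False
    then show ?thesis
      using abs_sin_x_le_abs_x[of "freq r * t"] f0 t by (simp add: pos_divide_le_eq abs_mult mult.commute)
  qed (use t in simp)
  then have "(sin (freq r * t) / freq r)\<^sup>2 \<le> t\<^sup>2" by (metis abs_ge_zero power2_abs power_mono)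
  moreover have "exp (- (damp r * t)) \<le> 1"
  proof -
    have "0 \<le> damp r" using damp_bounds(1)[OF r] zero_le_power2[of r] by linarith
    with t show ?thesis by simp
  qed
  ultimately show "osc t r \<le> t\<^sup>2"
    unfolding osc_def by (smt (verit) mult_left_le_one_le exp_gt_zero zero_le_power2)
  show "osc t r \<le> 4 / r\<^sup>2 * exp (- (r\<^sup>2 * t / 2))"
  proof (cases "r = 0")
    case False
    then have rp: "r > 0" using r by simp
    have "\<bar>sin (freq r * t) / freq r\<bar> \<le> 1 / (r / 2)"
      unfolding abs_divide using freq_bounds(1)[OF r] f0 rp by (intro frac_le) auto
    then have "(sin (freq r * t) / freq r)\<^sup>2 \<le> (2 / r)\<^sup>2" by (metis abs_ge_zero power2_abs power_mono divide_divide_eq_right mult.left_neutral)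
    then have "(sin (freq r * t) / freq r)\<^sup>2 \<le> 4 / r\<^sup>2" by (simp add: power_divide)
    then have "osc t r \<le> exp (- (r\<^sup>2 * t / 2)) * (4 / r\<^sup>2)"
      unfolding osc_def by (intro mult_mono e) auto
    then show ?thesis by (simp add: mult.commute)
  qed (simp add: osc_def freq_def damp_def)
qed

text \<open>Differentiating freq^2 = a - a^2/4 gives freq' freq = a' (1 - a/2) / 2, and a' <= 2 r.
  The bound on \<open>d * freq r\<close> is the Jacobian estimate for the substitution s = freq r *
  t in the lower bounds.\<close>

lemma freq_has_derivative:
  assumes r: "0 < r" "r < 1"
  obtains d where "(freq has_real_derivative d) (at r)" "0 \<le> d" "d * freq r \<le> r"
proof -
  have p: "1 + r\<^sup>2 > 0" by (simp add: add_pos_nonneg)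
  have fp: "freq r > 0" using freq_bounds(1)[of r] r by simp
  then have q: "damp r - (damp r)\<^sup>2 / 4 > 0" by (simp add: freq_def)
  define a' where "a' = 2 * r / (1 + r\<^sup>2)"
  have a: "(damp has_real_derivative a') (at r)"
    unfolding damp_def[abs_def] a'_def by (auto intro!: derivative_eq_intros simp: p)
  define d where "d = (a' - 2 * damp r * a' / 4) / (2 * freq r)"
  have "(freq has_real_derivative d) (at r)"
    unfolding freq_def[abs_def] d_def
    by (rule DERIV_cong[OF DERIV_chain2[OF DERIV_real_sqrt[OF q] DERIV_diff[OF a DERIV_cdivide[OF DERIV_power[OF a, of 2]]]]])
      (simp add: freq_def field_simps)
  moreover have d1: "damp r \<ge> 0" "damp r \<le> 1"
    using damp_bounds[of r] zero_le_power2[of r] power_le_one[of r 2] r by auto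
  have a0: "0 \<le> a'" "a' \<le> 2 * r"
    using r p by (auto simp: a'_def pos_divide_le_eq algebra_simps)
  have n: "a' - 2 * damp r * a' / 4 = a' * (1 - damp r / 2)" by (simp add: algebra_simps)
  have "0 \<le> d" unfolding d_def n using d1 a0 fp by simp
  moreover have "d * freq r \<le> r"
  proof -
    have "d * freq r = a' * (1 - damp r / 2) / 2" unfolding d_def n using fp by simp
    also have "\<dots> \<le> (2 * r) * 1 / 2" using d1 a0 r by (intro divide_right_mono mult_mono) auto
    finally show ?thesis by simp
  qed
  ultimately show thesis by (rule that)
qed

section \<open>Size of the radial multiplier integrals\<close>

text \<open>Gives the derivative as a function of \<open>r\<close>, so that it can occur in an
  integrand.\<close>

lemma deriv_freq:
  assumes "0 < r" "r < 1"
  shows "(freq has_real_derivative deriv freq r) (at r)" "0 \<le> deriv freq r" "deriv freq r * freq r \<le> r"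
proof -
  obtain d where d: "(freq has_real_derivative d) (at r)" "0 \<le> d" "d * freq r \<le> r"
    by (rule freq_has_derivative[OF assms])
  then have "deriv freq r = d" by (intro DERIV_imp_deriv)
  with d show "(freq has_real_derivative deriv freq r) (at r)" "0 \<le> deriv freq r" "deriv freq r * freq r \<le> r"
    by simp_all
qed

text \<open>The integral of the squared multiplier over the ball of radius \<rho> in polar
  coordinates, without the area of the sphere. The upper bound takes \<rho> = 1, the lower bound a
  radius depending on the datum.\<close>

definition osc_int :: "nat \<Rightarrow> real \<Rightarrow> real \<Rightarrow> ennreal" where
  "osc_int n \<rho> t = (\<integral>\<^sup>+r. ennreal (r ^ (n - 1)) * (ennreal (osc t r) * indicator {..<\<rho>} r) * indicator {0..} r \<partial>lborel)"

text \<open>Rates for the squared norm; their square roots are the rates of the theorem.\<close>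

definition rate :: "nat \<Rightarrow> real \<Rightarrow> real" where
  "rate n t = (if n = 1 then t else if n = 2 then ln t else t powr (- (real n - 2) / 2))"

lemma inverse_sqrt_power: "t > 0 \<Longrightarrow> (1 / sqrt t) ^ m = t powr (- real m / 2)"
  by (simp add: powr_half_sqrt[symmetric] powr_minus_divide[symmetric] powr_powr flip: powr_realpow)

section \<open>Upper bounds for the radial integrals\<close>

text \<open>Splitting at r = 1/t: the bound t^2 contributes t, the bound 4/r^2 contributes 4 t -
  4.\<close>

lemma osc_int_upper_1:
  assumes t: "t \<ge> 3"
  shows "osc_int 1 1 t \<le> ennreal (5 * t)"
proof -
  have "osc_int 1 1 t \<le> (\<integral>\<^sup>+r. ennreal (t\<^sup>2) * indicator {0..1/t} r + ennreal (4 / r\<^sup>2) * indicator {1/t..1} r \<partial>lborel)"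
    unfolding osc_int_def
  proof (rule nn_integral_mono)
    fix r :: real
    have "ennreal (osc t r) \<le> ennreal (t\<^sup>2)" "ennreal (osc t r) \<le> ennreal (4 / r\<^sup>2)" if "0 \<le> r" "r < 1"
    proof -
      show "ennreal (osc t r) \<le> ennreal (t\<^sup>2)" using osc_le(1)[of r t] that t by (intro ennreal_leI) simp
      have "osc t r \<le> 4 / r\<^sup>2 * exp (- (r\<^sup>2 * t / 2))" using osc_le(2)[of r t] that t by simp
      also have "\<dots> \<le> 4 / r\<^sup>2 * 1" using t by (intro mult_left_mono) auto
      finally show "ennreal (osc t r) \<le> ennreal (4 / r\<^sup>2)" by (intro ennreal_leI) simp
    qed
    then show "ennreal (r ^ (1 - 1)) * (ennreal (osc t r) * indicator {..<1} r) * indicator {0..} r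
        \<le> ennreal (t\<^sup>2) * indicator {0..1/t} r + ennreal (4 / r\<^sup>2) * indicator {1/t..1} r"
      by (cases "0 \<le> r \<and> r < 1"; cases "r \<le> 1 / t") (auto simp: indicator_def intro: add_increasing2)
  qed
  also have "\<dots> = (\<integral>\<^sup>+r. ennreal (t\<^sup>2) * indicator {0..1/t} r \<partial>lborel) + (\<integral>\<^sup>+r. ennreal (4 / r\<^sup>2) * indicator {1/t..1} r \<partial>lborel)"
    by (rule nn_integral_add) measurable
  also have "(\<integral>\<^sup>+r. ennreal (t\<^sup>2) * indicator {0..1/t} r \<partial>lborel) = ennreal t"
    using t by (subst nn_integral_cmult_indicator) (auto simp: power2_eq_square simp flip: ennreal_mult)
  also have "(\<integral>\<^sup>+r. ennreal (4 / r\<^sup>2) * indicator {1/t..1} r \<partial>lborel) = ennreal (- 4 / 1 - (- 4 / (1 / t)))"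
  proof (rule nn_integral_FTC_Icc)
    fix r assume "r \<in> {1/t..1}"
    then have "1 / t \<le> r" by simp
    with t have "r > 0" by (intro less_le_trans[of 0 "1 / t" r]) auto
    then show "((\<lambda>r. - 4 / r) has_real_derivative 4 / r\<^sup>2) (at r)"
      by (auto intro!: derivative_eq_intros simp: power2_eq_square)
  qed (use t in auto)
  also have "ennreal t + ennreal (- 4 / 1 - (- 4 / (1 / t))) \<le> ennreal (5 * t)"
    using t by (subst ennreal_plus[symmetric]) (auto intro!: ennreal_leI)
  finally show ?thesis .
qed

lemma ln_ge_1: "t \<ge> 3 \<Longrightarrow> ln t \<ge> (1::real)"
  using exp_le by (subst ln_ge_iff) auto

text \<open>The same splitting with the weight r: the inner part contributes 1/2, the outer one 4 ln
  t. For t >= 3 the 1/2 is absorbed, as ln t >= 1.\<close>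

lemma osc_int_upper_2:
  assumes t: "t \<ge> 3"
  shows "osc_int 2 1 t \<le> ennreal (5 * ln t)"
proof -
  have "osc_int 2 1 t \<le> (\<integral>\<^sup>+r. ennreal (t\<^sup>2 * r) * indicator {0..1/t} r + ennreal (4 / r) * indicator {1/t..1} r \<partial>lborel)"
    unfolding osc_int_def
  proof (rule nn_integral_mono)
    fix r :: real
    have "ennreal r * ennreal (osc t r) \<le> ennreal (t\<^sup>2 * r)" "ennreal r * ennreal (osc t r) \<le> ennreal (4 / r)" if r: "0 \<le> r" "r < 1"
    proof -
      have "r * osc t r \<le> r * t\<^sup>2" using osc_le(1)[of r t] that t by (intro mult_left_mono) simp_all
      then show "ennreal r * ennreal (osc t r) \<le> ennreal (t\<^sup>2 * r)" using r by (simp add: mult.commute ennreal_leI osc_nonneg flip: ennreal_mult)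
      have "osc t r \<le> 4 / r\<^sup>2 * exp (- (r\<^sup>2 * t / 2))" using osc_le(2)[of r t] that t by simp
      also have "\<dots> \<le> 4 / r\<^sup>2 * 1" using t by (intro mult_left_mono) auto
      finally have "r * osc t r \<le> r * (4 / r\<^sup>2)" using r by (intro mult_left_mono) simp_all
      then have "r * osc t r \<le> 4 / r" by (cases "r = 0") (simp_all add: power2_eq_square)
      then show "ennreal r * ennreal (osc t r) \<le> ennreal (4 / r)" using r by (simp add: ennreal_leI osc_nonneg flip: ennreal_mult)
    qed
    then show "ennreal (r ^ (2 - 1)) * (ennreal (osc t r) * indicator {..<1} r) * indicator {0..} r
        \<le> ennreal (t\<^sup>2 * r) * indicator {0..1/t} r + ennreal (4 / r) * indicator {1/t..1} r"
      by (cases "0 \<le> r \<and> r < 1"; cases "r \<le> 1 / t") (auto simp: indicator_def intro: add_increasing2)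
  qed
  also have "\<dots> = (\<integral>\<^sup>+r. ennreal (t\<^sup>2 * r) * indicator {0..1/t} r \<partial>lborel) + (\<integral>\<^sup>+r. ennreal (4 / r) * indicator {1/t..1} r \<partial>lborel)"
    by (rule nn_integral_add) measurable
  also have "(\<integral>\<^sup>+r. ennreal (t\<^sup>2 * r) * indicator {0..1/t} r \<partial>lborel) = ennreal (t\<^sup>2 * (1 / t)\<^sup>2 / 2 - t\<^sup>2 * 0\<^sup>2 / 2)"
    by (rule nn_integral_FTC_Icc) (use t in \<open>auto intro!: derivative_eq_intros\<close>)
  also have "(\<integral>\<^sup>+r. ennreal (4 / r) * indicator {1/t..1} r \<partial>lborel) = ennreal (4 * ln 1 - 4 * ln (1 / t))"
  proof (rule nn_integral_FTC_Icc)
    fix r assume "r \<in> {1/t..1}"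
    then have "1 / t \<le> r" by simp
    with t have "r > 0" by (intro less_le_trans[of 0 "1 / t" r]) auto
    then show "((\<lambda>r. 4 * ln r) has_real_derivative 4 / r) (at r)" "0 \<le> 4 / r"
      by (auto intro!: derivative_eq_intros)
  qed (use t in auto)
  also have "ennreal (t\<^sup>2 * (1 / t)\<^sup>2 / 2 - t\<^sup>2 * 0\<^sup>2 / 2) + ennreal (4 * ln 1 - 4 * ln (1 / t)) = ennreal (1 / 2 + 4 * ln t)"
    using t ln_ge_1[OF t] by (subst ennreal_plus) (auto simp: ln_div power_divide)
  also have "\<dots> \<le> ennreal (5 * ln t)"
    using ln_ge_1[OF t] by (intro ennreal_leI) simp
  finally show ?thesis .
qed

lemma osc_int_upper_3:
  assumes n: "n \<ge> 3"
  obtains K where "K > 0" "\<And>t. t \<ge> 3 \<Longrightarrow> osc_int n 1 t \<le> ennreal (K * t powr (- (real n - 2) / 2))"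
proof -
  define k where "k = n - 3"
  define M where "M = (\<integral>\<^sup>+s. ennreal (\<bar>s\<bar> ^ k * exp (- s\<^sup>2 / 2)) \<partial>lborel)"
  have "integrable lborel (\<lambda>s. sqrt (2 * pi) * (std_normal_density s * \<bar>s\<bar> ^ k))"
    using integrable_std_normal_moment_abs[of k] by simp
  also have "(\<lambda>s. sqrt (2 * pi) * (std_normal_density s * \<bar>s\<bar> ^ k)) = (\<lambda>s. \<bar>s\<bar> ^ k * exp (- s\<^sup>2 / 2))"
    by (auto simp: std_normal_density_def)
  finally have i: "integrable lborel (\<lambda>s::real. \<bar>s\<bar> ^ k * exp (- s\<^sup>2 / 2))" .
  have M: "M = ennreal (enn2real M)"
    using nn_integral_eq_integral[OF i] by (simp add: M_def)
  show thesis
  proof (rule that)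
    \<comment> \<open>The added 1 makes the constant positive without evaluating the moment.\<close>
    show "4 * enn2real M + 1 > 0" by (simp add: add_nonneg_pos)
    fix t :: real assume t: "t \<ge> 3"
    define c where "c = 1 / sqrt t"
    have c: "c > 0" "c\<^sup>2 * t = 1" using t by (auto simp: c_def power_divide)
    have "osc_int n 1 t \<le> (\<integral>\<^sup>+r. ennreal (4 * (\<bar>r\<bar> ^ k * exp (- (r\<^sup>2 * t / 2)))) \<partial>lborel)"
      unfolding osc_int_def
    proof (rule nn_integral_mono)
      fix r :: real
      have "ennreal (r ^ (n - 1)) * ennreal (osc t r) \<le> ennreal (4 * (\<bar>r\<bar> ^ k * exp (- (r\<^sup>2 * t / 2))))" if r: "0 \<le> r" "r < 1"
      proof -
        have "r ^ (n - 1) * osc t r \<le> r ^ (n - 1) * (4 / r\<^sup>2 * exp (- (r\<^sup>2 * t / 2)))"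
          using osc_le(2)[of r t] that t by (intro mult_left_mono) simp_all
        also have "r ^ (n - 1) * (4 / r\<^sup>2 * exp (- (r\<^sup>2 * t / 2))) = (r ^ (n - 1) / r\<^sup>2) * (4 * exp (- (r\<^sup>2 * t / 2)))" by simp
        \<comment> \<open>Only an inequality: at r = 0 the quotient is 0 by convention, while |r|^k
          is 1 for n = 3.\<close>
        also have "\<dots> \<le> \<bar>r\<bar> ^ k * (4 * exp (- (r\<^sup>2 * t / 2)))"
        proof (rule mult_right_mono)
          have "n - 1 = k + 2" using n by (simp add: k_def)
          then show "r ^ (n - 1) / r\<^sup>2 \<le> \<bar>r\<bar> ^ k" using r by (cases "r = 0") (simp_all add: power_add power2_eq_square)
        qed simp
        finally show ?thesis using r by (simp add: ennreal_leI osc_nonneg mult_ac flip: ennreal_mult)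
      qed
      then show "ennreal (r ^ (n - 1)) * (ennreal (osc t r) * indicator {..<1} r) * indicator {0..} r
        \<le> ennreal (4 * (\<bar>r\<bar> ^ k * exp (- (r\<^sup>2 * t / 2))))"
        by (cases "0 \<le> r \<and> r < 1") (auto simp: indicator_def)
    qed
    also have "\<dots> = ennreal c * (\<integral>\<^sup>+s. ennreal (4 * (\<bar>0 + c * s\<bar> ^ k * exp (- ((0 + c * s)\<^sup>2 * t / 2)))) \<partial>lborel)"
      using c by (subst nn_integral_real_affine[where c=c and t=0]) auto
    also have "(\<lambda>s. ennreal (4 * (\<bar>0 + c * s\<bar> ^ k * exp (- ((0 + c * s)\<^sup>2 * t / 2)))))
        = (\<lambda>s. ennreal (4 * c ^ k) * ennreal (\<bar>s\<bar> ^ k * exp (- s\<^sup>2 / 2)))"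
    proof
      fix s
      have "(c * s)\<^sup>2 * t = s\<^sup>2" using c(2) by (simp add: power_mult_distrib mult_ac)
      then show "ennreal (4 * (\<bar>0 + c * s\<bar> ^ k * exp (- ((0 + c * s)\<^sup>2 * t / 2)))) = ennreal (4 * c ^ k) * ennreal (\<bar>s\<bar> ^ k * exp (- s\<^sup>2 / 2))"
        using c(1) by (simp add: abs_mult power_mult_distrib mult_ac flip: ennreal_mult)
    qed
    also have "(\<integral>\<^sup>+s. ennreal (4 * c ^ k) * ennreal (\<bar>s\<bar> ^ k * exp (- s\<^sup>2 / 2)) \<partial>lborel) = ennreal (4 * c ^ k) * M"
      unfolding M_def by (rule nn_integral_cmult) measurable
    also have "ennreal c * (ennreal (4 * c ^ k) * M) = ennreal ((4 * enn2real M) * c ^ Suc k)"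
      using c(1) by (subst M) (simp add: mult_ac flip: ennreal_mult)
    also have "c ^ Suc k = t powr (- (real n - 2) / 2)"
      using t n inverse_sqrt_power[of t "Suc k"] by (simp add: c_def k_def of_nat_diff)
    also have "ennreal (4 * enn2real M * t powr (- (real n - 2) / 2)) \<le> ennreal ((4 * enn2real M + 1) * t powr (- (real n - 2) / 2))"
      by (intro ennreal_leI mult_right_mono) auto
    finally show "osc_int n 1 t \<le> ennreal ((4 * enn2real M + 1) * t powr (- (real n - 2) / 2))" .
  qed
qed

lemma osc_int_upper:
  assumes n: "n \<ge> 1"
  obtains K where "K > 0" "\<And>t. t \<ge> 3 \<Longrightarrow> osc_int n 1 t \<le> ennreal (K * rate n t)"
proof -
  consider "n = 1" | "n = 2" | "n \<ge> 3" using n by linarith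
  then show thesis
  proof cases
    case 1
    then show thesis by (intro that[of 5]) (use osc_int_upper_1 in \<open>auto simp: rate_def\<close>)
  next
    case 2
    then show thesis by (intro that[of 5]) (use osc_int_upper_2 in \<open>auto simp: rate_def\<close>)
  next
    case 3
    obtain K where "K > 0" "\<And>t. t \<ge> 3 \<Longrightarrow> osc_int n 1 t \<le> ennreal (K * t powr (- (real n - 2) / 2))"
      using osc_int_upper_3[OF 3] by blast
    with 3 show thesis by (intro that[of K]) (auto simp: rate_def)
  qed
qed

section \<open>Lower bounds for the radial integrals\<close>

text \<open>As \<open>damp r\<close> is at most r^2, the exponential stays above e^(-1) while r^2 t
  <= 1. All lower bounds integrate over part of this range, where only the oscillation is left to
  control.\<close>

lemma osc_ge:
  assumes r: "0 \<le> r" "r \<le> 1" and t: "t \<ge> 0" "r\<^sup>2 * t \<le> 1"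
  shows "exp (- 1) * (sin (freq r * t) / freq r)\<^sup>2 \<le> osc t r"
proof -
  have "damp r * t \<le> r\<^sup>2 * t" using damp_bounds(2)[OF r] t by (intro mult_right_mono)
  with t have "exp (- 1) \<le> exp (- (damp r * t))" by simp
  then show ?thesis unfolding osc_def by (rule mult_right_mono) simp
qed

text \<open>Reduces a lower bound to finding an explicit \<open>\<phi>\<close> whose derivative
  stays below the undamped integrand on some \<open>{r1..r2}\<close> away from 0.\<close>

lemma osc_int_ge:
  assumes r: "0 < r1" "r1 \<le> r2" "r2 < \<rho>" "\<rho> \<le> 1" and t: "t \<ge> 0" "r2\<^sup>2 * t \<le> 1"
    and d: "\<And>x. x \<in> {r1..r2} \<Longrightarrow> (\<phi> has_real_derivative \<phi>' x) (at x)"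
    and le: "\<And>x. x \<in> {r1..r2} \<Longrightarrow> \<phi>' x \<le> x ^ (n - 1) * (sin (freq x * t) / freq x)\<^sup>2"
  shows "ennreal (exp (- 1) * (\<phi> r2 - \<phi> r1)) \<le> osc_int n \<rho> t"
proof -
  let ?g = "\<lambda>x. x ^ (n - 1) * (sin (freq x * t) / freq x)\<^sup>2"
  have m[measurable]: "?g \<in> borel_measurable borel"
    unfolding freq_def[abs_def] damp_def[abs_def] by measurable
  have "ennreal (exp (- 1) * (\<phi> r2 - \<phi> r1)) = ennreal (exp (- 1)) * ennreal (\<phi> r2 - \<phi> r1)"
    by (rule ennreal_mult') simp
  also have "\<dots> \<le> ennreal (exp (- 1)) * (\<integral>\<^sup>+x. ennreal (?g x) * indicator {r1..r2} x \<partial>lborel)"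
    by (intro mult_left_mono FTC_le_nn_integral[OF r(2) d m]) (use r le in auto)
  also have "\<dots> = (\<integral>\<^sup>+x. ennreal (exp (- 1)) * (ennreal (?g x) * indicator {r1..r2} x) \<partial>lborel)"
    by (rule nn_integral_cmult[symmetric]) measurable
  also have "\<dots> \<le> osc_int n \<rho> t"
    unfolding osc_int_def
  proof (rule nn_integral_mono)
    fix x
    show "ennreal (exp (- 1)) * (ennreal (?g x) * indicator {r1..r2} x)
      \<le> ennreal (x ^ (n - 1)) * (ennreal (osc t x) * indicator {..<\<rho>} x) * indicator {0..} x"
    proof (cases "x \<in> {r1..r2}")
      case True
      then have x: "0 \<le> x" "x \<le> 1" "x < \<rho>" "x \<le> r2" using r by auto
      have "x\<^sup>2 * t \<le> r2\<^sup>2 * t" using x t by (intro mult_right_mono power_mono) auto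
      then have "exp (- 1) * (sin (freq x * t) / freq x)\<^sup>2 \<le> osc t x"
        using osc_ge[of x t] x t by simp
      then have "x ^ (n - 1) * (exp (- 1) * (sin (freq x * t) / freq x)\<^sup>2) \<le> x ^ (n - 1) * osc t x"
        using x by (intro mult_left_mono) auto
      then have "exp (- 1) * ?g x \<le> x ^ (n - 1) * osc t x" by (simp only: mult.left_commute)
      then have "ennreal (exp (- 1) * ?g x) \<le> ennreal (x ^ (n - 1) * osc t x)" by (rule ennreal_leI)
      then show ?thesis using True x by (simp add: osc_nonneg ennreal_mult)
    qed simp
  qed
  finally show ?thesis .
qed

text \<open>On [1/(2 t), 1/t] the phase freq x * t lies in (0, 1], where the sine does not vanish;
  the integrand is at least t^2/4, and the length 1/(2 t) gives t/8.\<close>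

lemma osc_int_lower_1:
  assumes \<rho>: "0 < \<rho>" "\<rho> \<le> 1" and t: "t > 1 / \<rho>"
  shows "ennreal (exp (- 1) / 8 * t) \<le> osc_int 1 \<rho> t"
proof -
  have "1 / \<rho> \<ge> 1" using \<rho> by simp
  then have t1: "t > 1" using t by simp
  have "ennreal (exp (- 1) * (t\<^sup>2 / 4 * (1 / t) - t\<^sup>2 / 4 * (1 / (2 * t)))) \<le> osc_int 1 \<rho> t"
  proof (rule osc_int_ge[where \<phi>="\<lambda>x. t\<^sup>2 / 4 * x" and \<phi>'="\<lambda>_. t\<^sup>2 / 4"])
    show "0 < 1 / (2 * t)" "1 / (2 * t) \<le> 1 / t" "1 / t < \<rho>" "\<rho> \<le> 1" "t \<ge> 0" "(1 / t)\<^sup>2 * t \<le> 1"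
      using t1 t \<rho> by (auto simp: divide_simps power2_eq_square mult.commute)
    fix x assume x: "x \<in> {1 / (2 * t)..1 / t}"
    show "((\<lambda>x. t\<^sup>2 / 4 * x) has_real_derivative t\<^sup>2 / 4) (at x)"
      by (auto intro!: derivative_eq_intros)
    have x0: "0 < x" using x t1 by (intro less_le_trans[of 0 "1 / (2 * t)" x]) auto
    have xt: "x * t \<le> 1" using x t1 by (simp add: pos_le_divide_eq)
    have "x \<le> 1" using x t1 by (intro order_trans[of x "1 / t" 1]) auto
    then have f: "x / 2 \<le> freq x" "freq x \<le> x" using freq_bounds[of x] x0 by auto
    define s where "s = freq x * t"
    have s: "0 < s" "s \<le> 1"
    proof -
      show "0 < s" unfolding s_def using f x0 t1 by (intro mult_pos_pos) auto
      have "s \<le> x * t" unfolding s_def using f t1 by (intro mult_right_mono) auto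
      with xt show "s \<le> 1" by simp
    qed
    \<comment> \<open>sin s >= s/2 on [0, 1] because the derivative cos y - 1/2 is nonnegative
      there: 1 < pi/3 and cos (pi/3) = 1/2.\<close>
    have "sin s - s / 2 \<ge> sin 0 - 0 / 2"
    proof (rule DERIV_nonneg_imp_nondecreasing[where f="\<lambda>s. sin s - s / 2"])
      show "0 \<le> s" using s by simp
      fix y assume y: "0 \<le> y" "y \<le> s"
      have "cos (pi / 3) \<le> cos y" using y s pi_gt3 by (intro cos_monotone_0_pi_le) auto
      then show "\<exists>d. ((\<lambda>s. sin s - s / 2) has_real_derivative d) (at y) \<and> 0 \<le> d"
        by (intro exI[of _ "cos y - 1 / 2"]) (auto intro!: derivative_eq_intros simp: cos_60)
    qed
    then have "t / 2 \<le> sin s / freq x"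
      using f x0 t1 by (simp add: s_def pos_le_divide_eq mult.commute)
    then have "(t / 2)\<^sup>2 \<le> (sin s / freq x)\<^sup>2" using t1 by (intro power_mono) auto
    then show "t\<^sup>2 / 4 \<le> x ^ (1 - 1) * (sin (freq x * t) / freq x)\<^sup>2"
      by (simp add: s_def power_divide)
  qed
  also have "exp (- 1) * (t\<^sup>2 / 4 * (1 / t) - t\<^sup>2 / 4 * (1 / (2 * t))) = exp (- 1) / 8 * t"
    using t1 by (simp add: power2_eq_square field_simps)
  finally show ?thesis .
qed

text \<open>sin^2(s)/s = 1/(2 s) - cos(2 s)/(2 s). Integrating the cosine term by parts produces
  -sin(2 s)/(4 s) and an error sin(2 s)/(4 s^2) without a sign; adding 1/(4 s) turns the error into
  (sin(2 s) - 1)/(4 s^2) <= 0.\<close>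

lemma sin_square_over_primitive:
  fixes s :: real
  assumes "s > 0"
  shows "((\<lambda>s. ln s / 2 - sin (2 * s) / (4 * s) + 1 / (4 * s)) has_real_derivative
      (sin s)\<^sup>2 / s + sin (2 * s) / (4 * s\<^sup>2) - 1 / (4 * s\<^sup>2)) (at s)"
  using assms
  by (auto intro!: derivative_eq_intros simp: cos_double_sin) (simp add: field_simps power2_eq_square)

lemma inverse_sqrt_mult:
  fixes t :: real
  assumes "t > 0"
  shows "(1 / sqrt t)\<^sup>2 * t = 1" "1 / sqrt t * t = sqrt t"
  using assms by (auto simp: power_divide real_div_sqrt)

text \<open>The range from 2/t to 1/sqrt t has logarithmic length about (ln t)/2, and sin^2 averages
  to 1/2, which suggests (ln t)/4; half of this is given up to absorb constants.\<close>

lemma osc_int_lower_2: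
  assumes \<rho>: "0 < \<rho>" "\<rho> \<le> 1" and t: "sqrt t > 1 / \<rho>" "ln t \<ge> 12"
  shows "ennreal (exp (- 1) / 8 * ln t) \<le> osc_int 2 \<rho> t"
proof -
  \<comment> \<open>A primitive of a lower bound for $\sin^2(s)/s$, which itself has no elementary primitive.\<close>
  define H where "H s = ln s / 2 - sin (2 * s) / (4 * s) + 1 / (4 * s)" for s :: real
  have "1 / \<rho> \<ge> 1" using \<rho> by simp
  then have "sqrt t > 1" using t(1) by linarith
  then have t1: "t > 1" by simp
  have "exp 12 \<le> t" using t(2) t1 by (metis exp_le_cancel_iff exp_ln order.strict_trans zero_less_one)
  moreover have "(4::real) \<le> exp 12" using exp_ge_add_one_self[of 12] by simp
  ultimately have t4: "t \<ge> 4" by linarith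
  then have st: "sqrt t \<ge> 2" by (simp add: real_le_rsqrt)
  \<comment> \<open>The lower end keeps its phase in [1, 2], where \<open>H\<close> is bounded; the
    upper end is where r^2 t = 1 and the damping sets in.\<close>
  define r1 r2 where "r1 = 2 / t" and "r2 = 1 / sqrt t"
  have r2t: "r2 * t = sqrt t" "r2\<^sup>2 * t = 1" using inverse_sqrt_mult[of t] t1 by (auto simp: r2_def)
  have r1t: "r1 * t = 2" using t1 by (simp add: r1_def)
  have r: "0 < r1" "r1 \<le> r2" "r2 < \<rho>"
  proof -
    show "0 < r1" using t1 by (simp add: r1_def)
    have "r1 * t \<le> r2 * t" using r1t r2t st by simp
    then show "r1 \<le> r2" using t1 by simp
    show "r2 < \<rho>" using t(1) \<rho> t1 by (simp add: r2_def divide_simps mult.commute)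
  qed
  then have r21: "r2 < 1" using \<rho> by simp
  define H' where "H' s = (sin s)\<^sup>2 / s + sin (2 * s) / (4 * s\<^sup>2) - 1 / (4 * s\<^sup>2)" for s :: real
  define \<phi>' where "\<phi>' x = H' (freq x * t) * (deriv freq x * t)" for x
  have "ennreal (exp (- 1) * (H (freq r2 * t) - H (freq r1 * t))) \<le> osc_int 2 \<rho> t"
  proof (rule osc_int_ge[where \<phi>="\<lambda>x. H (freq x * t)" and \<phi>'=\<phi>'])
    show "0 < r1" "r1 \<le> r2" "r2 < \<rho>" "\<rho> \<le> 1" "t \<ge> 0" "r2\<^sup>2 * t \<le> 1"
      using r \<rho> t1 r2t by auto
    fix x assume x: "x \<in> {r1..r2}"
    have x0: "0 < x" "x < 1" using x r r21 by auto
    then have f: "x / 2 \<le> freq x" using freq_bounds[of x] by auto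
    then have f0: "freq x > 0" using x0 by linarith
    then have s0: "freq x * t > 0" using t1 by simp
    note df = deriv_freq[OF x0]
    have D: "(H has_real_derivative H' (freq x * t)) (at (freq x * t))"
      unfolding H_def[abs_def] H'_def by (rule sin_square_over_primitive[OF s0])
    have "H' s \<le> (sin s)\<^sup>2 / s" for s
      using divide_right_mono[of "sin (2 * s)" 1 "4 * s\<^sup>2"] by (simp add: H'_def)
    note D' = this[of "freq x * t"]
    have "((\<lambda>x. freq x * t) has_real_derivative deriv freq x * t) (at x)"
      by (rule DERIV_cmult_right[OF df(1)])
    from DERIV_chain2[OF D this]
    show "((\<lambda>x. H (freq x * t)) has_real_derivative \<phi>' x) (at x)"
      unfolding \<phi>'_def .
    have "\<phi>' x \<le> (sin (freq x * t))\<^sup>2 / (freq x * t) * (deriv freq x * t)"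
      unfolding \<phi>'_def using D' df(2) t1 by (intro mult_right_mono) auto
    \<comment> \<open>The bound \<open>deriv freq x * freq x \<le> x\<close> converts ds/s for s =
      freq x * t into the weight x of polar coordinates divided by freq^2.\<close>
    also have "\<dots> = (deriv freq x * freq x) * ((sin (freq x * t))\<^sup>2 / (freq x)\<^sup>2)"
      using f0 t1 by (simp add: power2_eq_square)
    also have "\<dots> \<le> x * ((sin (freq x * t))\<^sup>2 / (freq x)\<^sup>2)"
      using df(3) by (intro mult_right_mono) auto
    finally show "\<phi>' x \<le> x ^ (2 - 1) * (sin (freq x * t) / freq x)\<^sup>2"
      by (simp add: power_divide)
  qed
  moreover have "ln t / 8 \<le> H (freq r2 * t) - H (freq r1 * t)"
  proof -
    have Hb: "ln s / 2 \<le> H s" "H s \<le> ln s / 2 + 1 / (2 * s)" if "s > 0" for s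
    proof -
      have "sin (2 * s) / (4 * s) \<le> 1 / (4 * s)" "- (1 / (4 * s)) \<le> sin (2 * s) / (4 * s)"
        using that divide_right_mono[of "sin (2 * s)" 1 "4 * s"] divide_right_mono[of "- 1" "sin (2 * s)" "4 * s"] by simp_all
      moreover have "1 / (2 * s) = 1 / (4 * s) + 1 / (4 * s)" by simp
      ultimately show "ln s / 2 \<le> H s" "H s \<le> ln s / 2 + 1 / (2 * s)" unfolding H_def by linarith+
    qed
    have f2: "sqrt t / 2 \<le> freq r2 * t"
      using mult_right_mono[OF freq_bounds(1)[of r2], of t] r r21 t1 r2t by auto
    have f1: "1 \<le> freq r1 * t" "freq r1 * t \<le> 2"
      using mult_right_mono[OF freq_bounds(1)[of r1], of t] mult_right_mono[OF freq_bounds(2)[of r1], of t] r r21 t1 r1t by auto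
    have "ln (sqrt t / 2) \<le> ln (freq r2 * t)" using f2 t1 by (intro ln_mono) auto
    moreover have "ln (sqrt t / 2) = ln t / 2 - ln 2" using t1 by (simp add: ln_div ln_sqrt)
    moreover have "ln (freq r1 * t) \<le> ln 2" using f1 by (intro ln_mono) auto
    moreover have "1 / (2 * (freq r1 * t)) \<le> 1 / (2 * 1)" using f1 by (intro divide_left_mono) auto
    moreover have "ln (2::real) \<le> 1" using ln_le_minus_one[of "2::real"] by simp
    moreover have "freq r2 * t > 0" "freq r1 * t > 0" using f2 f1 st by linarith+
    \<comment> \<open>The bounds add up to (ln t)/4 - ln 2 - 1/2 >= (ln t)/4 - 3/2, which is at
      least (ln t)/8 exactly when ln t >= 12.\<close>
    ultimately show ?thesis
      using Hb(1)[of "freq r2 * t"] Hb(2)[of "freq r1 * t"] t(2) by linarith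
  qed
  then have "ennreal (exp (- 1) / 8 * ln t) \<le> ennreal (exp (- 1) * (H (freq r2 * t) - H (freq r1 * t)))"
    using mult_left_mono[of "ln t / 8" _ "exp (- 1)"] by (intro ennreal_leI) simp
  ultimately show ?thesis by simp
qed

text \<open>For x between \<open>r1\<close> and \<open>r2\<close>, both of order 1/sqrt t, the
  weight x^(n-3) is bounded below by its value at \<open>r1\<close>. What remains is sin^2 of the
  phase, whose primitive grows like s/2.\<close>

lemma osc_int_lower_3:
  assumes n: "n \<ge> 3" and \<rho>: "0 < \<rho>" "\<rho> \<le> 1" and t: "sqrt t > 1 / \<rho>" "sqrt t \<ge> 8"
  shows "ennreal (exp (- 1) * (1 / 4) ^ (n - 3) / 16 * t powr (- (real n - 2) / 2)) \<le> osc_int n \<rho> t"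
proof -
  define H where "H s = s / 2 - sin (2 * s) / 4" for s :: real
  have "1 / \<rho> \<ge> 1" using \<rho> by simp
  then have "sqrt t > 1" using t(1) by linarith
  then have t1: "t > 1" by simp
  \<comment> \<open>The phase is only known to lie between x t/2 and x t; the ratio 4 of the
    endpoints keeps their phases at least sqrt t / 4 apart.\<close>
  define r1 r2 where "r1 = (1 / 4) * (1 / sqrt t)" and "r2 = 1 / sqrt t"
  have r2t: "r2 * t = sqrt t" "r2\<^sup>2 * t = 1" using inverse_sqrt_mult[of t] t1 by (auto simp: r2_def)
  have r1t: "r1 * t = sqrt t / 4" using inverse_sqrt_mult(2)[of t] t1 by (simp add: r1_def)
  have r: "0 < r1" "r1 \<le> r2" "r2 < \<rho>"
  proof -
    have "1 / sqrt t > 0" using t1 by simp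
    then show "0 < r1" "r1 \<le> r2" unfolding r1_def r2_def by linarith+
    show "r2 < \<rho>" using t(1) \<rho> t1 by (simp add: r2_def divide_simps mult.commute)
  qed
  then have r21: "r2 < 1" using \<rho> by simp
  define c where "c = r1 ^ (n - 3) / t"
  have c0: "c > 0" using r t1 by (simp add: c_def)
  have "ennreal (exp (- 1) * (c * H (freq r2 * t) - c * H (freq r1 * t))) \<le> osc_int n \<rho> t"
  proof (rule osc_int_ge[where \<phi>="\<lambda>x. c * H (freq x * t)" and \<phi>'="\<lambda>x. c * ((sin (freq x * t))\<^sup>2 * (deriv freq x * t))"])
    show "0 < r1" "r1 \<le> r2" "r2 < \<rho>" "\<rho> \<le> 1" "t \<ge> 0" "r2\<^sup>2 * t \<le> 1"
      using r \<rho> t1 r2t by auto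
    fix x assume x: "x \<in> {r1..r2}"
    have x0: "0 < x" "x < 1" using x r r21 by auto
    then have f: "x / 2 \<le> freq x" "freq x \<le> x" using freq_bounds[of x] by auto
    then have f0: "freq x > 0" using x0 by linarith
    note df = deriv_freq[OF x0]
    have dH: "(H has_real_derivative (sin s)\<^sup>2) (at s)" for s
      unfolding H_def[abs_def] by (auto intro!: derivative_eq_intros simp: cos_double_sin) (simp add: field_simps)
    have "((\<lambda>x. freq x * t) has_real_derivative deriv freq x * t) (at x)"
      by (rule DERIV_cmult_right[OF df(1)])
    from DERIV_cmult[OF DERIV_chain2[OF dH this], of c]
    show "((\<lambda>x. c * H (freq x * t)) has_real_derivative c * ((sin (freq x * t))\<^sup>2 * (deriv freq x * t))) (at x)" .
    have "deriv freq x * (freq x)\<^sup>2 \<le> x * freq x"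
      using mult_right_mono[OF df(3), of "freq x"] f0 by (simp add: power2_eq_square mult.assoc)
    also have "\<dots> \<le> x\<^sup>2" using f x0 by (simp add: power2_eq_square)
    finally have d: "deriv freq x \<le> x\<^sup>2 / (freq x)\<^sup>2" using f0 by (simp add: pos_le_divide_eq)
    have "c * ((sin (freq x * t))\<^sup>2 * (deriv freq x * t)) = r1 ^ (n - 3) * (deriv freq x * (sin (freq x * t))\<^sup>2)"
      using t1 by (simp add: c_def)
    also have "\<dots> \<le> x ^ (n - 3) * (x\<^sup>2 / (freq x)\<^sup>2 * (sin (freq x * t))\<^sup>2)"
      using x r d df(2) by (intro mult_mono power_mono mult_right_mono mult_nonneg_nonneg) auto
    also have "\<dots> = x ^ (n - 3 + 2) * (sin (freq x * t) / freq x)\<^sup>2"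
      by (simp add: power_divide power_add power2_eq_square)
    also have "n - 3 + 2 = n - 1" using n by simp
    finally show "c * ((sin (freq x * t))\<^sup>2 * (deriv freq x * t)) \<le> x ^ (n - 1) * (sin (freq x * t) / freq x)\<^sup>2" .
  qed
  moreover have "(1 / 4) ^ (n - 3) / 16 * t powr (- (real n - 2) / 2) \<le> c * H (freq r2 * t) - c * H (freq r1 * t)"
  proof -
    have Hb: "s / 2 - 1 / 4 \<le> H s" "H s \<le> s / 2 + 1 / 4" for s
      using sin_le_one[of "2 * s"] sin_ge_minus_one[of "2 * s"] unfolding H_def by linarith+
    have f2: "sqrt t / 2 \<le> freq r2 * t"
      using mult_right_mono[OF freq_bounds(1)[of r2], of t] r r21 t1 r2t by auto
    have f1: "freq r1 * t \<le> sqrt t / 4"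
      using mult_right_mono[OF freq_bounds(2)[of r1], of t] r r21 t1 r1t by auto
    \<comment> \<open>This distance of the phases makes \<open>H\<close> grow by at least sqrt t / 8
      - 1/2, which is at least sqrt t / 16 once sqrt t >= 8.\<close>
    have "sqrt t / 16 \<le> H (freq r2 * t) - H (freq r1 * t)"
      using Hb(1)[of "freq r2 * t"] Hb(2)[of "freq r1 * t"] f1 f2 t(2) by linarith
    then have "c * (sqrt t / 16) \<le> c * (H (freq r2 * t) - H (freq r1 * t))"
      using c0 by (intro mult_left_mono) auto
    moreover have "c * (sqrt t / 16) = (1 / 4) ^ (n - 3) / 16 * t powr (- (real n - 2) / 2)"
    proof -
      have "sqrt t / t = 1 / sqrt t" using t1 by (simp add: field_simps)
      moreover have "c * (sqrt t / 16) = r1 ^ (n - 3) / 16 * (sqrt t / t)" by (simp add: c_def)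
      ultimately have "c * (sqrt t / 16) = r1 ^ (n - 3) / 16 * (1 / sqrt t)" by (simp only:)
      also have "\<dots> = (1 / 4) ^ (n - 3) / 16 * ((1 / sqrt t) ^ (n - 3) * (1 / sqrt t))"
        unfolding r1_def power_mult_distrib by simp
      also have "(1 / sqrt t) ^ (n - 3) * (1 / sqrt t) = (1 / sqrt t) ^ (n - 2)"
      proof -
        have "n - 2 = Suc (n - 3)" using n by simp
        then show ?thesis by (simp only: power_Suc2)
      qed
      also have "(1 / sqrt t) ^ (n - 2) = t powr (- (real n - 2) / 2)"
        using inverse_sqrt_power[of t "n - 2"] t1 n by (simp add: of_nat_diff)
      finally show ?thesis .
    qed
    ultimately show ?thesis by (simp add: right_diff_distrib)
  qed
  then have "ennreal (exp (- 1) * (1 / 4) ^ (n - 3) / 16 * t powr (- (real n - 2) / 2)) \<le> ennreal (exp (- 1) * (c * H (freq r2 * t) - c * H (freq r1 * t)))"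
    using mult_left_mono[of _ _ "exp (- 1)"] by (intro ennreal_leI) (simp add: mult.assoc)
  ultimately show ?thesis by simp
qed

text \<open>One constant serves every \<open>\<rho>\<close>: the intervals of integration shrink to
  0 as \<open>t\<close> grows, so a smaller \<open>\<rho>\<close> only delays the threshold.\<close>

lemma osc_int_lower:
  assumes n: "n \<ge> 1"
  obtains c where "c > 0" "\<And>\<rho>. 0 < \<rho> \<Longrightarrow> \<rho> \<le> 1 \<Longrightarrow> eventually (\<lambda>t. ennreal (c * rate n t) \<le> osc_int n \<rho> t) at_top"
proof -
  have s: "eventually (\<lambda>t. sqrt t > b) at_top" "eventually (\<lambda>t. sqrt t \<ge> b) at_top"  "eventually (\<lambda>t. ln t \<ge> b) at_top" for b :: real
    using filterlim_at_top_dense sqrt_at_top filterlim_at_top ln_at_top by blast+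
  consider "n = 1" | "n = 2" | "n \<ge> 3" using n by linarith
  then show thesis
  proof cases
    case 1
    show thesis
    proof (rule that[of "exp (- 1) / 8"])
      fix \<rho> :: real assume *: "0 < \<rho>" "\<rho> \<le> 1"
      show "eventually (\<lambda>t. ennreal (exp (- 1) / 8 * rate n t) \<le> osc_int n \<rho> t) at_top"
        using eventually_gt_at_top[of "1 / \<rho>"] by eventually_elim (use * osc_int_lower_1 1 in \<open>auto simp: rate_def\<close>)
    qed simp
  next
    case 2
    show thesis
    proof (rule that[of "exp (- 1) / 8"])
      fix \<rho> :: real assume *: "0 < \<rho>" "\<rho> \<le> 1"
      show "eventually (\<lambda>t. ennreal (exp (- 1) / 8 * rate n t) \<le> osc_int n \<rho> t) at_top"
        using s(1)[of "1 / \<rho>"] s(3)[of 12] by eventually_elim (use * osc_int_lower_2 2 in \<open>auto simp: rate_def\<close>)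
    qed simp
  next
    case 3
    show thesis
    proof (rule that[of "exp (- 1) * (1 / 4) ^ (n - 3) / 16"])
      fix \<rho> :: real assume *: "0 < \<rho>" "\<rho> \<le> 1"
      show "eventually (\<lambda>t. ennreal (exp (- 1) * (1 / 4) ^ (n - 3) / 16 * rate n t) \<le> osc_int n \<rho> t) at_top"
        using s(1)[of "1 / \<rho>"] s(2)[of 8] by eventually_elim (use * osc_int_lower_3[OF 3] 3 in \<open>auto simp: rate_def\<close>)
    qed simp
  qed
qed

section \<open>Decay and growth rates\<close>

lemma fourier_0: "fourier f 0 = P1 f"
  by (simp add: fourier_def P1_def)

lemma L2_fourier_zero:
  assumes "L2_fourier (\<lambda>x :: 'a::euclidean_space. 0) g"
  shows "AE \<xi> in lebesgue. g \<xi> = 0"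
proof -
  have g: "g \<in> L2_space" using assms by (simp add: L2_fourier_def)
  then have [measurable]: "g \<in> borel_measurable lebesgue" by (simp add: L2_space_def)
  have "(L2_norm g)\<^sup>2 = 0"
    unfolding plancherel[OF assms] by (simp add: L2_norm_def)
  then have "sq_int g = 0" by (simp add: L2_space_sq_int[OF g])
  then have "AE \<xi> in lebesgue. ennreal ((norm (g \<xi>))\<^sup>2) = 0"
    by (subst (asm) nn_integral_0_iff_AE) measurable
  then show ?thesis by eventually_elim simp
qed

section \<open>From the transformed equation to the multiplier\<close>

text \<open>Collects what the rates need from the solution, with the unspecified versions of the
  transformed data replaced by 0 and \<open>fourier u1\<close>. The exceptional null sets do not
  depend on \<open>t\<close>, because the equation holds for all times at once.\<close>

lemma mild_solution_fourier:
  fixes u :: "real \<Rightarrow> 'a::euclidean_space \<Rightarrow> complex"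
  assumes u1: "integrable lebesgue u1" and u: "mild_solution (\<lambda>x. 0) u1 u"
  obtains uh where "\<And>t. t \<ge> 0 \<Longrightarrow> L2_fourier (u t) (uh t)"
    "sq_int (fourier u1) = ennreal ((2 * pi) ^ DIM('a) * (L2_norm u1)\<^sup>2)"
    "AE \<xi> in lebesgue. \<forall>t\<ge>0. norm \<xi> < 1 \<longrightarrow> (norm (uh t \<xi>))\<^sup>2 = osc t (norm \<xi>) * (norm (fourier u1 \<xi>))\<^sup>2"
    "AE \<xi> in lebesgue. \<forall>t\<ge>0. norm \<xi> \<ge> 1 \<longrightarrow> (norm (uh t \<xi>))\<^sup>2 \<le> 4 * exp (- t / 4) * (norm (fourier u1 \<xi>))\<^sup>2"
proof -
  from u obtain uh u0h u1h where uh: "\<And>t. t \<ge> 0 \<Longrightarrow> L2_fourier (u t) (uh t)"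
    and u0h: "L2_fourier (\<lambda>x::'a. 0) u0h" and u1h: "L2_fourier u1 u1h"
    and ode: "AE \<xi> in lebesgue. \<exists>z. uh 0 \<xi> = u0h \<xi> \<and> z 0 = u1h \<xi> \<and>
           (\<forall>t\<ge>0.
              ((\<lambda>s. uh s \<xi>) has_vector_derivative z t) (at t within {0..}) \<and>
              (z has_vector_derivative
                 - of_real (logL_symbol \<xi>) * uh t \<xi> - of_real (logL_symbol \<xi>) * z t)
                (at t within {0..}))"
    unfolding mild_solution_def by blast
  have F: "AE \<xi> in lebesgue. u1h \<xi> = fourier u1 \<xi>"
    by (rule L2_fourier_integrable[OF u1h u1])
  note Z = L2_fourier_zero[OF u0h]
  \<comment> \<open>At the origin a = 0 and the solution is linear in \<open>t\<close>, whereas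
    \<open>osc t 0\<close> is 0 by division by zero; discarding a null set removes the
    discrepancy.\<close>
  have nz: "AE \<xi> in lebesgue. \<xi> \<noteq> (0::'a)"
    using AE_not_in[of "{0::'a}" lebesgue] by (simp add: negligible_iff_null_sets[symmetric])
  have "sq_int (fourier u1) = sq_int u1h"
    using F by (intro nn_integral_cong_AE) (auto elim: eventually_mono)
  also have "\<dots> = ennreal ((2 * pi) ^ DIM('a) * (L2_norm u1)\<^sup>2)"
    using u1h by (subst L2_space_sq_int) (auto simp: L2_fourier_def plancherel[OF u1h])
  finally have 1: "sq_int (fourier u1) = ennreal ((2 * pi) ^ DIM('a) * (L2_norm u1)\<^sup>2)" .
  have 2: "AE \<xi> in lebesgue. \<forall>t\<ge>0. norm \<xi> < 1 \<longrightarrow> (norm (uh t \<xi>))\<^sup>2 = osc t (norm \<xi>) * (norm (fourier u1 \<xi>))\<^sup>2"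
    using ode F Z nz
  proof eventually_elim
    case (elim \<xi>)
    then obtain z where z: "uh 0 \<xi> = 0" "z 0 = fourier u1 \<xi>"
      "\<And>t. t \<ge> 0 \<Longrightarrow> ((\<lambda>s. uh s \<xi>) has_vector_derivative z t) (at t within {0..})"
      "\<And>t. t \<ge> 0 \<Longrightarrow> (z has_vector_derivative
                 - of_real (logL_symbol \<xi>) * uh t \<xi> - of_real (logL_symbol \<xi>) * z t) (at t within {0..})"
      by auto
    define a where "a = logL_symbol \<xi>"
    have ad: "a = damp (norm \<xi>)" by (simp add: a_def logL_symbol_def damp_def)
    show ?case
    proof (intro allI impI)
      fix t :: real assume t: "t \<ge> 0" and less: "norm \<xi> < 1"
      have a: "0 < a" "a < 4"
      proof -
        have r: "norm \<xi> > 0" using elim(4) by simp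
        then show "0 < a" using damp_bounds(1)[of "norm \<xi>"] less zero_less_power[OF r, of 2] unfolding ad by linarith
        show "a < 4" using damp_bounds(2)[of "norm \<xi>"] less power_le_one[of "norm \<xi>" 2] unfolding ad by simp
      qed
      have "uh t \<xi> = of_real (exp (- (a * t) / 2) * (sin (sqrt (a - a\<^sup>2 / 4) * t) / sqrt (a - a\<^sup>2 / 4))) * z 0"
        by (rule damped_oscillator_solution[OF a, of "\<lambda>t. uh t \<xi>" z]) (use z t a_def in auto)
      then have "norm (uh t \<xi>) = \<bar>exp (- (a * t) / 2) * (sin (freq (norm \<xi>) * t) / freq (norm \<xi>))\<bar> * norm (fourier u1 \<xi>)"
        by (simp only: norm_mult norm_of_real z(2) freq_def ad)
      then have "(norm (uh t \<xi>))\<^sup>2 = (exp (- (a * t) / 2))\<^sup>2 * (sin (freq (norm \<xi>) * t) / freq (norm \<xi>))\<^sup>2 * (norm (fourier u1 \<xi>))\<^sup>2"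
        by (simp only: power_mult_distrib power2_abs)
      also have "(exp (- (a * t) / 2))\<^sup>2 = exp (- (damp (norm \<xi>) * t))"
        by (simp add: ad flip: exp_double)
      finally show "(norm (uh t \<xi>))\<^sup>2 = osc t (norm \<xi>) * (norm (fourier u1 \<xi>))\<^sup>2"
        by (simp only: osc_def)
    qed
  qed
  have 3: "AE \<xi> in lebesgue. \<forall>t\<ge>0. norm \<xi> \<ge> 1 \<longrightarrow> (norm (uh t \<xi>))\<^sup>2 \<le> 4 * exp (- t / 4) * (norm (fourier u1 \<xi>))\<^sup>2"
    using ode F Z
  proof eventually_elim
    case (elim \<xi>)
    then obtain z where z: "uh 0 \<xi> = 0" "z 0 = fourier u1 \<xi>"
      "\<And>t. t \<ge> 0 \<Longrightarrow> ((\<lambda>s. uh s \<xi>) has_vector_derivative z t) (at t within {0..})"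
      "\<And>t. t \<ge> 0 \<Longrightarrow> (z has_vector_derivative
                 - of_real (logL_symbol \<xi>) * uh t \<xi> - of_real (logL_symbol \<xi>) * z t) (at t within {0..})"
      by auto
    show ?case
    proof (intro allI impI)
      fix t :: real assume t: "t \<ge> 0" and ge: "norm \<xi> \<ge> 1"
      have "1 / 2 \<le> damp 1" using damp_bounds(1)[of 1] by simp
      also have "damp 1 \<le> logL_symbol \<xi>"
        unfolding damp_def logL_symbol_def using ge by (intro ln_mono) (auto simp: add_pos_nonneg)
      finally have a: "1 / 2 \<le> logL_symbol \<xi>" .
      show "(norm (uh t \<xi>))\<^sup>2 \<le> 4 * exp (- t / 4) * (norm (fourier u1 \<xi>))\<^sup>2"
        using damped_oscillator_decay[OF a z(3,4,1) t] z(2) by simp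
    qed
  qed
  from uh 1 2 3 show thesis by (rule that)
qed

lemma rate_pos: "t \<ge> 3 \<Longrightarrow> rate n t > 0"
  using ln_ge_1[of t] by (auto simp: rate_def)

text \<open>Allows the high-frequency part to be absorbed into the rate.\<close>

lemma exp_le_rate:
  assumes "n \<ge> 1"
  shows "eventually (\<lambda>t. exp (- t / 4) \<le> rate n t) at_top"
proof -
  consider "n = 1" | "n = 2" | "n \<ge> 3" using assms by linarith
  then show ?thesis
  proof cases
    case 1
    then show ?thesis unfolding rate_def by simp real_asymp
  next
    case 2
    then show ?thesis unfolding rate_def by simp real_asymp
  next
    case 3
    then have "- (real n - 2) / 2 < 0" by simp
    have "eventually (\<lambda>t::real. exp (- t / 4) \<le> t powr (- (real n - 2) / 2)) at_top"
      by real_asymp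
    with 3 show ?thesis unfolding rate_def by simp
  qed
qed

lemma nn_integral_osc:
  "(\<integral>\<^sup>+\<xi>. ennreal (osc t (norm \<xi>)) * indicator {..<\<rho>} (norm \<xi>) \<partial>(lebesgue :: 'a::euclidean_space measure))
    = ennreal (real DIM('a) * unit_ball_vol DIM('a)) * osc_int DIM('a) \<rho> t"
  unfolding nn_integral_completion osc_int_def
  by (rule nn_integral_radial[where h="\<lambda>r. ennreal (osc t r) * indicator {..<\<rho>} r"]) measurable

section \<open>Two-sided bounds for the solution\<close>

text \<open>At low frequencies the transformed datum is at most the L^1 norm of \<open>u1\<close>;
  at high ones the exponential decay meets its L^2 norm through Plancherel. Both norms are at most
  \<open>I0 u1\<close>.\<close>

theorem mild_solution_upper:
  obtains C where "C > 0" "\<And>u1 (u :: real \<Rightarrow> 'a::euclidean_space \<Rightarrow> complex).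
      u1 \<in> L2_space \<Longrightarrow> u1 \<in> L11_space \<Longrightarrow> mild_solution (\<lambda>x. 0) u1 u \<Longrightarrow>
      eventually (\<lambda>t. L2_norm (u t) \<le> C * I0 u1 * sqrt (rate DIM('a) t)) at_top"
proof -
  let ?n = "DIM('a)" and ?c = "(2 * pi) ^ DIM('a)"
  let ?v = "real DIM('a) * unit_ball_vol DIM('a)"
  obtain K where K: "K > 0" "\<And>t. t \<ge> 3 \<Longrightarrow> osc_int ?n 1 t \<le> ennreal (K * rate ?n t)"
    using osc_int_upper[of ?n] by (metis DIM_positive Suc_leI One_nat_def)
  have c: "?c > 0" and v: "?v > 0" by simp_all
  \<comment> \<open>The low frequencies contribute ?v K / ?c after division by the Plancherel factor
    \<open>?c\<close>; the high ones contribute 4, as there the factor \<open>?c\<close> of the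
    datum cancels.\<close>
  define C where "C = sqrt (?v * K / ?c + 4)"
  show thesis
  proof (rule that)
    show C: "C > 0" unfolding C_def using K c v by (auto intro!: add_nonneg_pos)
    fix u1 and u :: "real \<Rightarrow> 'a \<Rightarrow> complex"
    assume L2: "u1 \<in> L2_space" and L11: "u1 \<in> L11_space" and sol: "mild_solution (\<lambda>x. 0) u1 u"
    have i1: "integrable lebesgue u1" and i2: "integrable lebesgue (\<lambda>x. (1 + norm x) * norm (u1 x))"
      using L11 by (auto simp: L11_space_def)
    define B where "B = (\<integral>x. norm (u1 x) \<partial>lebesgue)"
    have B0: "B \<ge> 0" by (simp add: B_def)
    have "B \<le> (\<integral>x. (1 + norm x) * norm (u1 x) \<partial>lebesgue)"
      unfolding B_def using i1 i2 by (intro integral_mono) (auto simp: distrib_right)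
    moreover have "L2_norm u1 \<ge> 0" by (simp add: L2_norm_def)
    ultimately have I: "B \<le> I0 u1" "L2_norm u1 \<le> I0 u1" "I0 u1 \<ge> 0"
      using B0 by (auto simp: I0_def)
    obtain uh where uh: "\<And>t. t \<ge> 0 \<Longrightarrow> L2_fourier (u t) (uh t)"
      and F: "sq_int (fourier u1) = ennreal (?c * (L2_norm u1)\<^sup>2)"
      and lo: "AE \<xi> in lebesgue. \<forall>t\<ge>0. norm \<xi> < 1 \<longrightarrow> (norm (uh t \<xi>))\<^sup>2 = osc t (norm \<xi>) * (norm (fourier u1 \<xi>))\<^sup>2"
      and hi: "AE \<xi> in lebesgue. \<forall>t\<ge>0. norm \<xi> \<ge> 1 \<longrightarrow> (norm (uh t \<xi>))\<^sup>2 \<le> 4 * exp (- t / 4) * (norm (fourier u1 \<xi>))\<^sup>2"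
      using mild_solution_fourier[OF i1 sol] by blast
    have [measurable]: "fourier u1 \<in> borel_measurable lebesgue"
      by (intro measurable_completion) (simp add: borel_measurable_fourier[OF i1])
    have [measurable]: "(\<lambda>\<xi>::'a. ennreal (osc t (norm \<xi>)) * indicator {..<1} (norm \<xi>)) \<in> borel_measurable lebesgue" for t
      by (intro measurable_completion) measurable
    show "eventually (\<lambda>t. L2_norm (u t) \<le> C * I0 u1 * sqrt (rate ?n t)) at_top"
      using eventually_ge_at_top[of 3] exp_le_rate[of ?n, OF DIM_ge_Suc0[folded One_nat_def]]
    proof eventually_elim
      case (elim t)
      then have t: "t \<ge> 3" "t \<ge> 0" and e: "exp (- t / 4) \<le> rate ?n t" by auto
      have R: "rate ?n t > 0" by (rule rate_pos[OF t(1)])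
      have ut: "L2_fourier (u t) (uh t)" by (rule uh[OF t(2)])
      have "ennreal ((L2_norm (uh t))\<^sup>2) = sq_int (uh t)"
        using ut by (subst L2_space_sq_int) (auto simp: L2_fourier_def)
      also have "\<dots> \<le> (\<integral>\<^sup>+\<xi>. ennreal (B\<^sup>2) * (ennreal (osc t (norm \<xi>)) * indicator {..<1} (norm \<xi>))
          + ennreal (4 * exp (- t / 4)) * ennreal ((norm (fourier u1 \<xi>))\<^sup>2) \<partial>lebesgue)"
      proof (rule nn_integral_mono_AE)
        show "AE \<xi> in lebesgue. ennreal ((norm (uh t \<xi>))\<^sup>2) \<le> ennreal (B\<^sup>2) * (ennreal (osc t (norm \<xi>)) * indicator {..<1} (norm \<xi>))
          + ennreal (4 * exp (- t / 4)) * ennreal ((norm (fourier u1 \<xi>))\<^sup>2)"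
          using lo hi
        proof eventually_elim
          case (elim \<xi>)
          show ?case
          proof (cases "norm \<xi> < 1")
            case True
            have "(norm (uh t \<xi>))\<^sup>2 = osc t (norm \<xi>) * (norm (fourier u1 \<xi>))\<^sup>2"
              using elim(1) t True by simp
            also have "\<dots> \<le> osc t (norm \<xi>) * B\<^sup>2"
              unfolding B_def by (intro mult_left_mono power_mono norm_fourier_le osc_nonneg) simp
            finally have "ennreal ((norm (uh t \<xi>))\<^sup>2) \<le> ennreal (B\<^sup>2) * ennreal (osc t (norm \<xi>))"
              by (simp add: mult.commute osc_nonneg ennreal_leI flip: ennreal_mult)
            with True show ?thesis by (intro add_increasing2) auto
          next
            case False
            then have "(norm (uh t \<xi>))\<^sup>2 \<le> 4 * exp (- t / 4) * (norm (fourier u1 \<xi>))\<^sup>2"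
              using elim(2) t by simp
            then have "ennreal ((norm (uh t \<xi>))\<^sup>2) \<le> ennreal (4 * exp (- t / 4)) * ennreal ((norm (fourier u1 \<xi>))\<^sup>2)"
              by (subst ennreal_mult[symmetric]) (auto intro: ennreal_leI)
            then show ?thesis by (intro add_increasing) auto
          qed
        qed
      qed
      also have "\<dots> = ennreal (B\<^sup>2) * (ennreal ?v * osc_int ?n 1 t) + ennreal (4 * exp (- t / 4)) * ennreal (?c * (L2_norm u1)\<^sup>2)"
        unfolding F[symmetric] nn_integral_osc[symmetric]
        by (subst nn_integral_add, measurable) (subst nn_integral_cmult, measurable, subst nn_integral_cmult, measurable)
      also have "\<dots> \<le> ennreal (B\<^sup>2) * (ennreal ?v * ennreal (K * rate ?n t)) + ennreal (4 * exp (- t / 4)) * ennreal (?c * (L2_norm u1)\<^sup>2)"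
        by (intro add_mono mult_left_mono K(2) t) auto
      also have "\<dots> = ennreal (B\<^sup>2 * (?v * (K * rate ?n t)) + 4 * exp (- t / 4) * (?c * (L2_norm u1)\<^sup>2))"
        using v K(1) R c by (simp add: ennreal_mult less_imp_le)
      finally have "(L2_norm (uh t))\<^sup>2 \<le> B\<^sup>2 * (?v * (K * rate ?n t)) + 4 * exp (- t / 4) * (?c * (L2_norm u1)\<^sup>2)"
        by (subst (asm) ennreal_le_iff) (use v K(1) R c in \<open>auto intro!: add_nonneg_nonneg mult_nonneg_nonneg\<close>)
      also have "\<dots> \<le> (I0 u1)\<^sup>2 * (?v * (K * rate ?n t)) + 4 * rate ?n t * (?c * (I0 u1)\<^sup>2)"
        using v K(1) R c I B0 e by (intro add_mono mult_mono power_mono mult_nonneg_nonneg) (auto simp: L2_norm_def)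
      also have "\<dots> = ?c * ((?v * K / ?c + 4) * (I0 u1)\<^sup>2 * rate ?n t)"
      proof -
        have "i * (w * (K * r)) + 4 * r * (b * i) = b * ((w * K / b + 4) * i * r)" if "b > 0" for b i r w :: real
          using that by (simp add: field_simps)
        from this[OF c] show ?thesis .
      qed
      finally have "?c * (L2_norm (u t))\<^sup>2 \<le> ?c * ((?v * K / ?c + 4) * (I0 u1)\<^sup>2 * rate ?n t)"
        unfolding plancherel[OF ut] .
      then have "(L2_norm (u t))\<^sup>2 \<le> (?v * K / ?c + 4) * (I0 u1)\<^sup>2 * rate ?n t"
        using c by (simp only: mult_le_cancel_left_pos)
      also have "\<dots> = (C * I0 u1 * sqrt (rate ?n t))\<^sup>2"
        unfolding C_def power_mult_distrib using v K(1) c R by (simp add: add_nonneg_nonneg)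
      finally show "L2_norm (u t) \<le> C * I0 u1 * sqrt (rate ?n t)"
        by (rule power2_le_imp_le) (use C I R in auto)
    qed
  qed
qed

text \<open>Discarding all frequencies outside a small ball only decreases the norm, and inside it
  continuity keeps |fourier u1| above |P1|/2. The radius depends on the datum, but the constant of
  \<open>osc_int_lower\<close> does not depend on the radius.\<close>

theorem mild_solution_lower:
  obtains C where "C > 0" "\<And>u1 (u :: real \<Rightarrow> 'a::euclidean_space \<Rightarrow> complex).
      u1 \<in> L11_space \<Longrightarrow> mild_solution (\<lambda>x. 0) u1 u \<Longrightarrow>
      eventually (\<lambda>t. C * norm (P1 u1) * sqrt (rate DIM('a) t) \<le> L2_norm (u t)) at_top"
proof -
  let ?n = "DIM('a)" and ?c = "(2 * pi) ^ DIM('a)"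
  let ?v = "real DIM('a) * unit_ball_vol DIM('a)"
  obtain k where k: "k > 0" "\<And>\<rho>. 0 < \<rho> \<Longrightarrow> \<rho> \<le> 1 \<Longrightarrow> eventually (\<lambda>t. ennreal (k * rate ?n t) \<le> osc_int ?n \<rho> t) at_top"
    using osc_int_lower[of ?n] by (metis DIM_positive Suc_leI One_nat_def)
  have c: "?c > 0" and v: "?v > 0" by simp_all
  \<comment> \<open>The 4 comes from squaring |P1|/2, and \<open>?c\<close> from Plancherel.\<close>
  define C where "C = sqrt (?v * k / (4 * ?c))"
  show thesis
  proof (rule that)
    show C: "C > 0" unfolding C_def using k(1) c v by simp
    fix u1 and u :: "real \<Rightarrow> 'a \<Rightarrow> complex"
    assume L11: "u1 \<in> L11_space" and sol: "mild_solution (\<lambda>x. 0) u1 u"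
    have i1: "integrable lebesgue u1" using L11 by (auto simp: L11_space_def)
    obtain uh where uh: "\<And>t. t \<ge> 0 \<Longrightarrow> L2_fourier (u t) (uh t)"
      and lo: "AE \<xi> in lebesgue. \<forall>t\<ge>0. norm \<xi> < 1 \<longrightarrow> (norm (uh t \<xi>))\<^sup>2 = osc t (norm \<xi>) * (norm (fourier u1 \<xi>))\<^sup>2"
      using mild_solution_fourier[OF i1 sol] by blast
    have [measurable]: "(\<lambda>\<xi>::'a. ennreal (osc t (norm \<xi>)) * indicator {..<\<rho>} (norm \<xi>)) \<in> borel_measurable lebesgue" for t \<rho>
      by (intro measurable_completion) measurable
    show "eventually (\<lambda>t. C * norm (P1 u1) * sqrt (rate ?n t) \<le> L2_norm (u t)) at_top"
    \<comment> \<open>The radius is found from the tolerance |P1|/2, which has to be positive; for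
      mean 0 the left side vanishes.\<close>
    proof (cases "P1 u1 = 0")
      case True
      then show ?thesis by (simp add: L2_norm_def)
    next
      case False
      have "isCont (fourier u1) 0"
        using continuous_on_fourier[OF i1] by (simp add: continuous_on_eq_continuous_at)
      moreover have "norm (P1 u1) / 2 > 0" using False by simp
      ultimately obtain d where d: "d > 0" "\<And>\<xi>. norm \<xi> < d \<Longrightarrow> norm (fourier u1 \<xi> - P1 u1) < norm (P1 u1) / 2"
        unfolding continuous_at_eps_delta dist_norm fourier_0 by (metis diff_zero)
      define \<rho> where "\<rho> = min d 1"
      have \<rho>: "0 < \<rho>" "\<rho> \<le> 1" "\<rho> \<le> d" using d by (auto simp: \<rho>_def)
      have F: "norm (P1 u1) / 2 \<le> norm (fourier u1 \<xi>)" if "norm \<xi> < \<rho>" for \<xi>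
        using d(2)[of \<xi>] that \<rho> norm_triangle_ineq2[of "P1 u1" "fourier u1 \<xi>"] by (simp add: norm_minus_commute)
      show ?thesis
        using eventually_ge_at_top[of 3] k(2)[OF \<rho>(1,2)]
      proof eventually_elim
        case (elim t)
        then have t: "t \<ge> 3" "t \<ge> 0" by auto
        have R: "rate ?n t > 0" by (rule rate_pos[OF t(1)])
        have ut: "L2_fourier (u t) (uh t)" by (rule uh[OF t(2)])
        let ?p = "(norm (P1 u1) / 2)\<^sup>2"
        have "ennreal (?p * (?v * (k * rate ?n t))) = ennreal ?p * (ennreal ?v * ennreal (k * rate ?n t))"
          using v k(1) R by (simp add: ennreal_mult less_imp_le)
        also have "\<dots> \<le> ennreal ?p * (ennreal ?v * osc_int ?n \<rho> t)"
          by (intro mult_left_mono elim) auto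
        also have "\<dots> = (\<integral>\<^sup>+\<xi>. ennreal ?p * (ennreal (osc t (norm \<xi>)) * indicator {..<\<rho>} (norm \<xi>)) \<partial>(lebesgue :: 'a measure))"
          unfolding nn_integral_osc[symmetric] by (rule nn_integral_cmult[symmetric]) measurable
        also have "\<dots> \<le> sq_int (uh t)"
        proof (rule nn_integral_mono_AE)
          show "AE \<xi> in lebesgue. ennreal ?p * (ennreal (osc t (norm \<xi>)) * indicator {..<\<rho>} (norm \<xi>)) \<le> ennreal ((norm (uh t \<xi>))\<^sup>2)"
            using lo
          proof eventually_elim
            case (elim \<xi>)
            show ?case
            proof (cases "norm \<xi> < \<rho>")
              case True
              have "?p * osc t (norm \<xi>) \<le> (norm (fourier u1 \<xi>))\<^sup>2 * osc t (norm \<xi>)"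
                by (intro mult_right_mono power_mono F True osc_nonneg) simp
              also have "\<dots> = (norm (uh t \<xi>))\<^sup>2"
                using elim t True \<rho> by (simp add: mult.commute)
              finally have "ennreal (?p * osc t (norm \<xi>)) \<le> ennreal ((norm (uh t \<xi>))\<^sup>2)"
                by (rule ennreal_leI)
              with True show ?thesis by (simp add: osc_nonneg ennreal_mult)
            qed simp
          qed
        qed
        also have "\<dots> = ennreal ((L2_norm (uh t))\<^sup>2)"
          using ut by (subst L2_space_sq_int) (auto simp: L2_fourier_def)
        finally have "?p * (?v * (k * rate ?n t)) \<le> ?c * (L2_norm (u t))\<^sup>2"
          unfolding plancherel[OF ut] by (subst (asm) ennreal_le_iff) (auto simp: less_imp_le)
        moreover have "?p * (?v * (k * rate ?n t)) = ?c * (?v * k / (4 * ?c) * (norm (P1 u1))\<^sup>2 * rate ?n t)"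
          using c by (simp add: field_simps power_divide)
        ultimately have "?v * k / (4 * ?c) * (norm (P1 u1))\<^sup>2 * rate ?n t \<le> (L2_norm (u t))\<^sup>2"
          using c by (simp only: mult_le_cancel_left_pos)
        also have "?v * k / (4 * ?c) * (norm (P1 u1))\<^sup>2 * rate ?n t = (C * norm (P1 u1) * sqrt (rate ?n t))\<^sup>2"
          unfolding C_def power_mult_distrib using v k(1) c R by simp
        finally show "C * norm (P1 u1) * sqrt (rate ?n t) \<le> L2_norm (u t)"
          by (rule power2_le_imp_le) (simp add: L2_norm_def)
      qed
    qed
  qed
qed

theorem theorem1p2:
  "\<exists>C::real. C > 0 \<and>
     (\<forall>(u1 :: real ^ 'n \<Rightarrow> complex) (u :: real \<Rightarrow> real ^ 'n \<Rightarrow> complex).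
        u1 \<in> L2_space \<inter> L11_space \<longrightarrow> mild_solution (\<lambda>x. 0) u1 u \<longrightarrow>
        (\<forall>\<^sub>F t in at_top.
           (CARD('n) = 1 \<longrightarrow>
              C * norm (P1 u1) * sqrt t \<le> L2_norm (u t) \<and>
              L2_norm (u t) \<le> inverse C * I0 u1 * sqrt t) \<and>
           (CARD('n) = 2 \<longrightarrow>
              C * norm (P1 u1) * sqrt (ln t) \<le> L2_norm (u t) \<and>
              L2_norm (u t) \<le> inverse C * I0 u1 * sqrt (ln t)) \<and>
           (CARD('n) \<ge> 3 \<longrightarrow>
              C * norm (P1 u1) * t powr (- (real CARD('n) - 2) / 4) \<le> L2_norm (u t) \<and>
              L2_norm (u t) \<le> inverse C * I0 u1 * t powr (- (real CARD('n) - 2) / 4))))"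
proof -
  have D: "DIM(real ^ 'n) = CARD('n)" by simp
  obtain A where A: "A > 0" "\<And>u1 (u :: real \<Rightarrow> real ^ 'n \<Rightarrow> complex).
      u1 \<in> L11_space \<Longrightarrow> mild_solution (\<lambda>x. 0) u1 u \<Longrightarrow>
      eventually (\<lambda>t. A * norm (P1 u1) * sqrt (rate CARD('n) t) \<le> L2_norm (u t)) at_top"
    using mild_solution_lower[where 'a="real ^ 'n", unfolded D] by blast
  obtain B where B: "B > 0" "\<And>u1 (u :: real \<Rightarrow> real ^ 'n \<Rightarrow> complex).
      u1 \<in> L2_space \<Longrightarrow> u1 \<in> L11_space \<Longrightarrow> mild_solution (\<lambda>x. 0) u1 u \<Longrightarrow>
      eventually (\<lambda>t. L2_norm (u t) \<le> B * I0 u1 * sqrt (rate CARD('n) t)) at_top"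
    using mild_solution_upper[where 'a="real ^ 'n", unfolded D] by blast
  \<comment> \<open>One constant has to serve both bounds: \<open>C\<close> lies below
    \<open>A\<close> for the lower one, \<open>inverse C\<close> above \<open>B\<close> for the
    upper one.\<close>
  define C where "C = min A (inverse B)"
  have C: "C > 0" "C \<le> A" "B \<le> inverse C"
  proof -
    show "C > 0" "C \<le> A" using A(1) B(1) by (auto simp: C_def)
    then have "inverse (inverse B) \<le> inverse C" by (intro le_imp_inverse_le) (auto simp: C_def)
    then show "B \<le> inverse C" by simp
  qed
  have *: "eventually (\<lambda>t. C * norm (P1 u1) * sqrt (rate CARD('n) t) \<le> L2_norm (u t) \<and>
      L2_norm (u t) \<le> inverse C * I0 u1 * sqrt (rate CARD('n) t)) at_top"
    if u1: "u1 \<in> L2_space" "u1 \<in> L11_space" and u: "mild_solution (\<lambda>x. 0) u1 u"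
    for u1 and u :: "real \<Rightarrow> real ^ 'n \<Rightarrow> complex"
    using A(2)[OF u1(2) u] B(2)[OF u1 u] eventually_ge_at_top[of 3]
  proof eventually_elim
    case (elim t)
    have R: "sqrt (rate CARD('n) t) \<ge> 0" using rate_pos[OF elim(3)] by (simp add: less_imp_le)
    have I: "I0 u1 \<ge> 0" unfolding I0_def L2_norm_def by (intro add_nonneg_nonneg Bochner_Integration.integral_nonneg) auto
    have "C * norm (P1 u1) * sqrt (rate CARD('n) t) \<le> A * norm (P1 u1) * sqrt (rate CARD('n) t)"
      using C R by (intro mult_right_mono) auto
    moreover have "B * I0 u1 * sqrt (rate CARD('n) t) \<le> inverse C * I0 u1 * sqrt (rate CARD('n) t)"
      using C R I by (intro mult_right_mono) auto
    ultimately show ?case using elim by linarith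
  qed
  \<comment> \<open>Here the exponent -(n - 2)/2 of the squared norm becomes -(n - 2)/4.\<close>
  have rate3: "sqrt (rate CARD('n) t) = t powr (- (real CARD('n) - 2) / 4)" if "CARD('n) \<ge> 3" "t \<ge> 3" for t
    using that by (simp add: rate_def powr_half_sqrt[symmetric] powr_powr)
  show ?thesis
  proof (intro exI[of _ C] conjI allI impI)
    fix u1 and u :: "real \<Rightarrow> real ^ 'n \<Rightarrow> complex"
    assume u1: "u1 \<in> L2_space \<inter> L11_space" and u: "mild_solution (\<lambda>x. 0) u1 u"
    have "eventually (\<lambda>t. C * norm (P1 u1) * sqrt (rate CARD('n) t) \<le> L2_norm (u t) \<and>
      L2_norm (u t) \<le> inverse C * I0 u1 * sqrt (rate CARD('n) t)) at_top"
      using u1 by (intro *[OF _ _ u]) auto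
    then show "\<forall>\<^sub>F t in at_top.
           (CARD('n) = 1 \<longrightarrow>
              C * norm (P1 u1) * sqrt t \<le> L2_norm (u t) \<and>
              L2_norm (u t) \<le> inverse C * I0 u1 * sqrt t) \<and>
           (CARD('n) = 2 \<longrightarrow>
              C * norm (P1 u1) * sqrt (ln t) \<le> L2_norm (u t) \<and>
              L2_norm (u t) \<le> inverse C * I0 u1 * sqrt (ln t)) \<and>
           (CARD('n) \<ge> 3 \<longrightarrow>
              C * norm (P1 u1) * t powr (- (real CARD('n) - 2) / 4) \<le> L2_norm (u t) \<and>
              L2_norm (u t) \<le> inverse C * I0 u1 * t powr (- (real CARD('n) - 2) / 4))"
      using eventually_ge_at_top[of 3]
    proof eventually_elim
      case (elim t)
      have "sqrt (rate CARD('n) t) = sqrt t" if "CARD('n) = 1" using that by (simp add: rate_def)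
      moreover have "sqrt (rate CARD('n) t) = sqrt (ln t)" if "CARD('n) = 2" using that by (simp add: rate_def)
      ultimately show ?case using elim(1) rate3[OF _ elim(2)] by metis
    qed
  qed (rule C(1))
qed

end
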